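(* Let $T>0$, $Q>0$, and let $S\in L^\infty(I)$ satisfy $S_1\ge S(x)\ge S_0>0$ for a.e. $x\in I=(-1,1)$. Let $g:\mathbb{R}\to\mathbb{R}$ be continuous and increasing with $g(r)r\ge C_gr^2$ for all $r$, for some $C_g>0$. Let $\beta:\mathbb{R}\to\mathbb{R}$ be nondecreasing, bounded and Lipschitz continuous. Let $W$ and $G$ be as in the context with $\int_0^T\|G_t\mathcal{J}\|^2_{\mathcal{L}_2(H)}dt<\infty$ and $(G\cdot W)\in C([0,T];H)\cap L^2(0,T;V)$ $\mathbb{P}$-a.s. Let $u_0\in L^2(I)$ and $f\in L^2(0,T;V')$, and assume that $QS\beta(u)-g(u)+f\in L^2(0,T;V')$ for every $u\in C([0,T];H)\cap L^2(0,T;V)$. For $n\in\mathbb{N}$, $n\geq 1$, let $u^n$ be the (unique analytically weak) solution in $C([0,T];H)\cap L^2(0,T;V)$ of $$(E_{\beta,\frac1nG})\qquad\frac{\partial u}{\partial t}-\frac{\partial}{\partial x}\Big((1-x^2)\frac{\partial u}{\partial x}\Big)+g(u)=QS(x)\beta(u)+f+\frac1nG\frac{\partial W}{\partial t},\qquad u(x,0)=u_0(x).$$ Then, as $n\to\infty$, $u^n\to u^\infty$ in $C([0,T];H)$ ($\mathbb{P}$-a.s.), where $u^\infty$ is the solution of the deterministic problem $(E_{\beta,0})$, i.e. of the same problem with the noise term $\frac1nG\frac{\partial W}{\partial t}$ removed.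
   Context: $I=(-1,1)$, $\varrho(x)=1-x^2$, $H=L^2(I)$, $V=\{w\in L^2(I):\int_I\varrho|w'|^2dx<\infty\}$ with norm $\|w\|_V=\|w\|_{L^2(I)}+(\int_I\varrho|w'|^2dx)^{1/2}$; $V\hookrightarrow H\hookrightarrow V'$ is a Gelfand triple. Noise: $e_n$ are the orthonormal Legendre polynomials in $L^2(I)$, eigenfunctions of $-(\varrho u')'$ with eigenvalues $\mu_n=n(n+1)$. $\{B^n\}_{n\ge1}$ are mutually independent real standard Brownian motions on a filtered probability space $(\Omega,\mathcal{F},\{\mathcal{F}_t\},\mathbb{P})$ with right-continuous filtration, and $W_t=\sum_{n\ge1}\mu_n^{-1/2}B^n(t)e_n$. $\mathcal{J}:H\to H$ is linear with $\mathcal{J}e_n=\mu_n^{-1/2}e_n$ for $n\ge1$, $\mathcal{J}e_0=0$. $\mathcal{L}_2(H)$ is the space of Hilbert–Schmidt operators on $H$. $G=(G_t)_{0<t<T}$ is a deterministic measurable family with $G_t\in\mathcal{L}_2(H)$, and $(G\cdot W)_t=\int_0^tG_s\,dW_s$. A predictable $H$-valued process $u$ is an analytically weak solution of $(E_{\beta,\varepsilon G})$ on $[0,T]$ if, $\mathbb{P}$-a.s., for each $t\in[0,T]$ and $v\in V$, $$\langle u_t,v\rangle=\langle u_0,v\rangle-\int_0^t\int_I\varrho\,\frac{\partial u_s}{\partial x}\frac{\partial v}{\partial x}\,dx\,ds+\int_0^t\langle QS\beta(u_s)-g(u_s)+f_s,v\rangle ds+\varepsilon\int_0^t\langle G_s^*v,dW_s\rangle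 .$$ *)

theory Defs
  imports "HOL-Probability.Probability" "HOL-Computational_Algebra.Polynomial"
begin

abbreviation I_meas :: "real measure" where
  "I_meas \<equiv> lebesgue_on {-1<..<1}"

definition square_integrable :: "(real \<Rightarrow> real) \<Rightarrow> bool" where
  "square_integrable w \<longleftrightarrow>
     w \<in> borel_measurable I_meas \<and> integrable I_meas (\<lambda>x. (w x)\<^sup>2)"

lemma square_integrable_mult:
  assumes "square_integrable v" "square_integrable w"
  shows "integrable I_meas (\<lambda>x. v x * w x)"
proof (rule Bochner_Integration.integrable_bound[where f = "\<lambda>x. (v x)\<^sup>2 + (w x)\<^sup>2"])
  show "integrable I_meas (\<lambda>x. (v x)\<^sup>2 + (w x)\<^sup>2)"
    using assms by (auto simp: square_integrable_def)
  show "(\<lambda>x. v x * w x) \<in> borel_measurable I_meas"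
    using assms by (auto simp: square_integrable_def)
  have "\<bar>a * b\<bar> \<le> a\<^sup>2 + b\<^sup>2" for a b :: real
  proof -
    have "0 \<le> (\<bar>a\<bar> - \<bar>b\<bar>)\<^sup>2" by simp
    then have "2 * (\<bar>a\<bar> * \<bar>b\<bar>) \<le> a\<^sup>2 + b\<^sup>2"
      by (simp add: power2_diff)
    moreover have "0 \<le> \<bar>a\<bar> * \<bar>b\<bar>" by simp
    ultimately show ?thesis unfolding abs_mult by linarith
  qed
  then show "AE x in I_meas. norm (v x * w x) \<le> norm ((v x)\<^sup>2 + (w x)\<^sup>2)"
    by (auto intro!: AE_I2)
qed

lemma square_integrable_add:
  assumes "square_integrable v" "square_integrable w"
  shows "square_integrable (\<lambda>x. v x + w x)"
  using assms square_integrable_mult[OF assms]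
  by (auto simp: square_integrable_def power2_sum mult.assoc)

lemma square_integrable_scale:
  assumes "square_integrable w"
  shows "square_integrable (\<lambda>x. c * w x)"
  using assms by (auto simp: square_integrable_def power_mult_distrib)

lemma square_integrable_zero: "square_integrable (\<lambda>x. 0)"
  by (auto simp: square_integrable_def)

quotient_type L2I = "real \<Rightarrow> real" / partial:
  "\<lambda>v w. square_integrable v \<and> square_integrable w \<and> (AE x in I_meas. v x = w x)"
proof (rule part_equivpI)
  show "\<exists>x. square_integrable x \<and> square_integrable x \<and> (AE t in I_meas. x t = x t)"
    using square_integrable_zero by auto
qed (auto intro!: sympI transpI)

instantiation L2I :: real_inner
begin

lift_definition zero_L2I :: L2I is "\<lambda>x. 0"
  by (simp add: square_integrable_zero)

lift_definition plus_L2I :: "L2I \<Rightarrow> L2I \<Rightarrow> L2I" is "\<lambda>v w x. v x + w x"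
  by (auto simp: square_integrable_add)

lift_definition scaleR_L2I :: "real \<Rightarrow> L2I \<Rightarrow> L2I" is "\<lambda>c w x. c * w x"
  by (auto simp: square_integrable_scale)

lift_definition inner_L2I :: "L2I \<Rightarrow> L2I \<Rightarrow> real" is
  "\<lambda>v w. integral\<^sup>L I_meas (\<lambda>x. v x * w x)"
  by (rule integral_cong_AE) (auto simp: square_integrable_def)

definition uminus_L2I :: "L2I \<Rightarrow> L2I" where "uminus_L2I w = (-1) *\<^sub>R w"
definition minus_L2I :: "L2I \<Rightarrow> L2I \<Rightarrow> L2I" where "minus_L2I v w = v + - w"
definition norm_L2I :: "L2I \<Rightarrow> real" where "norm_L2I w = sqrt (inner w w)"
definition sgn_L2I :: "L2I \<Rightarrow> L2I" where "sgn_L2I w = inverse (norm w) *\<^sub>R w"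
definition dist_L2I :: "L2I \<Rightarrow> L2I \<Rightarrow> real" where "dist_L2I v w = norm (v - w)"
definition uniformity_L2I :: "(L2I \<times> L2I) filter" where
  "uniformity_L2I = (INF e\<in>{0<..}. principal {(v, w). dist v w < e})"
definition open_L2I :: "L2I set \<Rightarrow> bool" where
  "open_L2I U \<longleftrightarrow> (\<forall>v\<in>U. \<forall>\<^sub>F (v', w) in uniformity. v' = v \<longrightarrow> w \<in> U)"

instance
proof
  fix u v w :: L2I and a b c :: real
  show "u + v + w = u + (v + w)"
    by transfer (auto simp: add.assoc square_integrable_add)
  show "u + v = v + u"
    by transfer (auto simp: add.commute square_integrable_add)
  show zero: "0 + u = u"
    by transfer (auto simp: square_integrable_zero square_integrable_add)
  show "- u + u = 0"
    unfolding uminus_L2I_def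
    by transfer (auto intro!: square_integrable_zero square_integrable_add square_integrable_scale
        simp: square_integrable_scale[where c = "-1", simplified] square_integrable_zero)
  show "u - v = u + - v" by (rule minus_L2I_def)
  show "a *\<^sub>R (u + v) = a *\<^sub>R u + a *\<^sub>R v"
    by transfer (auto intro!: square_integrable_add square_integrable_scale simp: distrib_left)
  show "(a + b) *\<^sub>R u = a *\<^sub>R u + b *\<^sub>R u"
    by transfer (auto intro!: square_integrable_add square_integrable_scale simp: distrib_right)
  show "a *\<^sub>R b *\<^sub>R u = (a * b) *\<^sub>R u"
    by transfer (auto intro!: square_integrable_scale simp: mult.assoc)
  show "1 *\<^sub>R u = u"
    by transfer auto
  show "inner u v = inner v u"
    by transfer (simp add: mult.commute)
  show "inner (u + v) w = inner u w + inner v w"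
    by transfer (auto simp: distrib_right square_integrable_mult)
  show "inner (a *\<^sub>R u) v = a * inner u v"
    by transfer (auto simp: mult.assoc)
  show "0 \<le> inner u u"
    by transfer (auto intro!: integral_nonneg_AE)
  show "(inner u u = 0) = (u = 0)"
  proof transfer
    fix w :: "real \<Rightarrow> real"
    assume w: "square_integrable w \<and> square_integrable w \<and> (AE x in I_meas. w x = w x)"
    then have "(integral\<^sup>L I_meas (\<lambda>x. w x * w x) = 0) = (AE x in I_meas. w x * w x = 0)"
      by (intro integral_nonneg_eq_0_iff_AE square_integrable_mult) auto
    then show "(integral\<^sup>L I_meas (\<lambda>x. w x * w x) = 0) =
        (square_integrable w \<and> square_integrable (\<lambda>x. 0) \<and> (AE x in I_meas. w x = 0))"
      using w by (simp add: square_integrable_zero)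
  qed
  show "norm u = sqrt (inner u u)" by (rule norm_L2I_def)
  show "sgn u = scaleR (inverse (norm u)) u" by (rule sgn_L2I_def)
  show "dist u v = norm (u - v)" by (rule dist_L2I_def)
  show "(uniformity :: (L2I \<times> L2I) filter) = (INF e\<in>{0<..}. principal {(v, w). dist v w < e})"
    by (rule uniformity_L2I_def)
  show "open U \<longleftrightarrow> (\<forall>v\<in>U. \<forall>\<^sub>F (v', w) in uniformity. v' = v \<longrightarrow> w \<in> U)" for U :: "L2I set"
    by (rule open_L2I_def)
qed

end

text \<open>A representative of the class; every use below is invariant under changes on null sets.\<close>

abbreviation fun_of :: "L2I \<Rightarrow> real \<Rightarrow> real" where
  "fun_of \<equiv> rep_L2I"

definition rho :: "real \<Rightarrow> real" where
  "rho x = 1 - x\<^sup>2"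

text \<open>In one dimension compactly supported test functions of class \<open>C\<^sup>1\<close> and of class
  \<open>C\<^sup>\<infinity>\<close> yield the same weak derivatives.\<close>

definition test_function :: "(real \<Rightarrow> real) \<Rightarrow> bool" where
  "test_function \<phi> \<longleftrightarrow> \<phi> C1_differentiable_on UNIV \<and>
     (\<exists>a b. -1 < a \<and> b < 1 \<and> (\<forall>x. x \<notin> {a..b} \<longrightarrow> \<phi> x = 0))"

definition has_weak_deriv :: "(real \<Rightarrow> real) \<Rightarrow> (real \<Rightarrow> real) \<Rightarrow> bool" where
  "has_weak_deriv w d \<longleftrightarrow>
     (\<forall>a b. -1 < a \<and> b < 1 \<longrightarrow> integrable (lebesgue_on {a..b}) d) \<and>
     (\<forall>\<phi>. test_function \<phi> \<longrightarrow>
        integral\<^sup>L I_meas (\<lambda>x. w x * deriv \<phi> x) = - integral\<^sup>L I_meas (\<lambda>x. d x * \<phi> x))"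

definition weak_deriv :: "L2I \<Rightarrow> real \<Rightarrow> real" where
  "weak_deriv w = (SOME d. has_weak_deriv (fun_of w) d)"

definition V :: "L2I set" where
  "V = {w. \<exists>d. has_weak_deriv (fun_of w) d \<and> integrable I_meas (\<lambda>x. rho x * (d x)\<^sup>2)}"

definition V_form :: "L2I \<Rightarrow> L2I \<Rightarrow> real" where
  "V_form v w = integral\<^sup>L I_meas (\<lambda>x. rho x * weak_deriv v x * weak_deriv w x)"

definition V_norm :: "L2I \<Rightarrow> real" where
  "V_norm w = norm w + sqrt (integral\<^sup>L I_meas (\<lambda>x. rho x * (weak_deriv w x)\<^sup>2))"

text \<open>Elements of \<open>V'\<close> are functionals whose values outside \<open>V\<close> are irrelevant.\<close>

definition in_V_dual :: "(L2I \<Rightarrow> real) \<Rightarrow> bool" where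
  "in_V_dual l \<longleftrightarrow>
     (\<forall>v\<in>V. \<forall>w\<in>V. l (v + w) = l v + l w) \<and>
     (\<forall>c. \<forall>v\<in>V. l (c *\<^sub>R v) = c * l v) \<and>
     (\<exists>C. \<forall>v\<in>V. \<bar>l v\<bar> \<le> C * V_norm v)"

definition V_dual_norm :: "(L2I \<Rightarrow> real) \<Rightarrow> ennreal" where
  "V_dual_norm l = (SUP v\<in>{v\<in>V. V_norm v \<le> 1}. ennreal \<bar>l v\<bar>)"

text \<open>Measurability into the separable Hilbert spaces \<open>V\<close> and \<open>V'\<close> is expressed by
  measurability into \<open>H\<close> (the Borel sets of \<open>V\<close> are the traces of those of \<open>H\<close>)
  and by weak measurability (Pettis), respectively.\<close>

definition L2_V :: "real \<Rightarrow> (real \<Rightarrow> L2I) set" where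
  "L2_V T = {u. u \<in> borel_measurable (lebesgue_on {0<..<T}) \<and>
     (AE t in lebesgue_on {0<..<T}. u t \<in> V) \<and>
     (\<integral>\<^sup>+ t. ennreal ((V_norm (u t))\<^sup>2) \<partial>lebesgue_on {0<..<T}) < \<infinity>}"

definition L2_V_dual :: "real \<Rightarrow> (real \<Rightarrow> L2I \<Rightarrow> real) set" where
  "L2_V_dual T = {l. (\<forall>v\<in>V. (\<lambda>t. l t v) \<in> borel_measurable (lebesgue_on {0<..<T})) \<and>
     (AE t in lebesgue_on {0<..<T}. in_V_dual (l t)) \<and>
     (\<integral>\<^sup>+ t. (V_dual_norm (l t))\<^sup>2 \<partial>lebesgue_on {0<..<T}) < \<infinity>}"

definition energy_paths :: "real \<Rightarrow> (real \<Rightarrow> L2I) set" where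
  "energy_paths T = {u. continuous_on {0..T} u} \<inter> L2_V T"

text \<open>A measurable function \<open>h\<close> on \<open>(-1,1)\<close> is identified with the functional
  \<open>v \<mapsto> \<integral> h v\<close>, provided that the integral exists for all \<open>v \<in> V\<close>.\<close>

definition acts_on_V :: "(real \<Rightarrow> real) \<Rightarrow> bool" where
  "acts_on_V h \<longleftrightarrow> (\<forall>v\<in>V. integrable I_meas (\<lambda>x. h x * fun_of v x))"

definition fun_pairing :: "(real \<Rightarrow> real) \<Rightarrow> L2I \<Rightarrow> real" where
  "fun_pairing h v = integral\<^sup>L I_meas (\<lambda>x. h x * fun_of v x)"

definition reaction ::
  "real \<Rightarrow> (real \<Rightarrow> real) \<Rightarrow> (real \<Rightarrow> real) \<Rightarrow> (real \<Rightarrow> real) \<Rightarrow> L2I \<Rightarrow> real \<Rightarrow> real" where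
  "reaction Q S \<beta> g w x = Q * S x * \<beta> (fun_of w x) - g (fun_of w x)"

definition total_forcing ::
  "real \<Rightarrow> (real \<Rightarrow> real) \<Rightarrow> (real \<Rightarrow> real) \<Rightarrow> (real \<Rightarrow> real) \<Rightarrow> (real \<Rightarrow> L2I \<Rightarrow> real)
    \<Rightarrow> (real \<Rightarrow> L2I) \<Rightarrow> real \<Rightarrow> L2I \<Rightarrow> real" where
  "total_forcing Q S \<beta> g f u t v = fun_pairing (reaction Q S \<beta> g (u t)) v + f t v"

text \<open>Rodrigues' formula; \<open>leg n\<close> is the \<open>L\<^sup>2\<close>-normalised polynomial, so that
  \<open>(leg n)\<close> with \<open>n \<ge> 0\<close> is an orthonormal basis, as used in the Hilbert-Schmidt norm.\<close>

definition legendre :: "nat \<Rightarrow> real poly" where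
  "legendre n = smult (1 / (2 ^ n * fact n)) ((pderiv ^^ n) ([:-1, 0, 1:] ^ n))"

definition leg :: "nat \<Rightarrow> L2I" where
  "leg n = abs_L2I (\<lambda>x. sqrt ((2 * real n + 1) / 2) * poly (legendre n) x)"

definition leg_eigenvalue :: "nat \<Rightarrow> real" where
  "leg_eigenvalue n = real n * (real n + 1)"

definition J_op :: "L2I \<Rightarrow> L2I" where
  "J_op h = (\<Sum>n. (inner h (leg (Suc n)) / sqrt (leg_eigenvalue (Suc n))) *\<^sub>R leg (Suc n))"

definition hs_norm_sq :: "(L2I \<Rightarrow> 'k::real_normed_vector) \<Rightarrow> ennreal" where
  "hs_norm_sq \<Phi> = (\<Sum>n. ennreal ((norm (\<Phi> (leg n)))\<^sup>2))"

definition filtered_probability :: "'w measure \<Rightarrow> (real \<Rightarrow> 'w measure) \<Rightarrow> bool" where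
  "filtered_probability M F \<longleftrightarrow> prob_space M \<and>
     (\<forall>t\<ge>0. subalgebra M (F t)) \<and>
     (\<forall>s\<ge>0. \<forall>t\<ge>s. sets (F s) \<subseteq> sets (F t)) \<and>
     (\<forall>t\<ge>0. sets (F t) = (\<Inter>s\<in>{t<..}. sets (F s)))"

definition brownian_motion ::
  "'w measure \<Rightarrow> (real \<Rightarrow> 'w measure) \<Rightarrow> (real \<Rightarrow> 'w \<Rightarrow> real) \<Rightarrow> bool" where
  "brownian_motion M F b \<longleftrightarrow>
     (\<forall>t\<ge>0. b t \<in> borel_measurable (F t)) \<and>
     (AE \<omega> in M. b 0 \<omega> = 0) \<and>
     (AE \<omega> in M. continuous_on {0..} (\<lambda>t. b t \<omega>)) \<and>
     (\<forall>s\<ge>0. \<forall>t>s.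
        distributed M lborel (\<lambda>\<omega>. b t \<omega> - b s \<omega>) (normal_density 0 (sqrt (t - s))) \<and>
        prob_space.indep_set M (sets (F s))
          {(\<lambda>\<omega>. b t \<omega> - b s \<omega>) -` A \<inter> space M | A. A \<in> sets borel})"

definition independent_brownian_motions ::
  "'w measure \<Rightarrow> (real \<Rightarrow> 'w measure) \<Rightarrow> (nat \<Rightarrow> real \<Rightarrow> 'w \<Rightarrow> real) \<Rightarrow> bool" where
  "independent_brownian_motions M F B \<longleftrightarrow>
     (\<forall>n\<ge>1. brownian_motion M F (B n)) \<and>
     prob_space.indep_vars M (\<lambda>_. PiM {0..} (\<lambda>_. borel))
       (\<lambda>n \<omega>. restrict (\<lambda>t. B n t \<omega>) {0..}) {1..}"

definition noise :: "(nat \<Rightarrow> real \<Rightarrow> 'w \<Rightarrow> real) \<Rightarrow> real \<Rightarrow> 'w \<Rightarrow> L2I" where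
  "noise B t \<omega> = (\<Sum>n. (B (Suc n) t \<omega> / sqrt (leg_eigenvalue (Suc n))) *\<^sub>R leg (Suc n))"

text \<open>A list of triples \<open>(a, b, \<Phi>)\<close> encodes the step integrand \<open>\<Sum> 1\<^bsub>(a,b]\<^esub> \<Phi>\<close>.\<close>

definition step_integrand ::
  "real \<Rightarrow> (real \<times> real \<times> (L2I \<Rightarrow>\<^sub>L 'k::real_normed_vector)) list \<Rightarrow> bool" where
  "step_integrand T E \<longleftrightarrow> (\<forall>(a, b, \<Phi>)\<in>set E. 0 \<le> a \<and> a \<le> b \<and> b \<le> T)"

definition step_value ::
  "(real \<times> real \<times> (L2I \<Rightarrow>\<^sub>L 'k::real_normed_vector)) list \<Rightarrow> real \<Rightarrow> L2I \<Rightarrow> 'k" where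
  "step_value E s h = (\<Sum>(a, b, \<Phi>)\<leftarrow>E. if s \<in> {a<..b} then blinfun_apply \<Phi> h else 0)"

definition step_integral ::
  "(real \<Rightarrow> 'w \<Rightarrow> L2I) \<Rightarrow> (real \<times> real \<times> (L2I \<Rightarrow>\<^sub>L 'k::real_normed_vector)) list
    \<Rightarrow> real \<Rightarrow> 'w \<Rightarrow> 'k" where
  "step_integral W E t \<omega> =
     (\<Sum>(a, b, \<Phi>)\<leftarrow>E. blinfun_apply \<Phi> (W (min b t) \<omega> - W (min a t) \<omega>))"

text \<open>\<open>X\<close> is a continuous version of \<open>(\<integral>\<^sub>0\<^sup>t \<Psi>\<^sub>s dW\<^sub>s)\<close> for \<open>0 \<le> t \<le> T\<close>: the limit
  in \<open>L\<^sup>2(\<Omega>)\<close> of the integrals of step integrands converging to \<open>\<Psi>\<close> in the norm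
  \<open>(\<integral>\<^sub>0\<^sup>T \<parallel>\<Psi>\<^sub>s J\<parallel>\<^sup>2 ds)\<^sup>1\<^sup>/\<^sup>2\<close> given by the Ito isometry.\<close>

definition stochastic_integral ::
  "'w measure \<Rightarrow> (nat \<Rightarrow> real \<Rightarrow> 'w \<Rightarrow> real) \<Rightarrow> real \<Rightarrow> (real \<Rightarrow> L2I \<Rightarrow> 'k::real_normed_vector)
    \<Rightarrow> (real \<Rightarrow> 'w \<Rightarrow> 'k) \<Rightarrow> bool" where
  "stochastic_integral M B T \<Psi> X \<longleftrightarrow>
     (\<forall>t\<in>{0..T}. X t \<in> borel_measurable M) \<and>
     (AE \<omega> in M. continuous_on {0..T} (\<lambda>t. X t \<omega>)) \<and>
     (\<exists>E. (\<forall>k. step_integrand T (E k)) \<and>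
        (\<lambda>k. \<integral>\<^sup>+ s. hs_norm_sq (\<lambda>h. \<Psi> s (J_op h) - step_value (E k) s (J_op h))
              \<partial>lebesgue_on {0<..<T}) \<longlonglongrightarrow> 0 \<and>
        (\<forall>t\<in>{0..T}. (\<lambda>k. \<integral>\<^sup>+ \<omega>. ennreal ((norm (X t \<omega> - step_integral (noise B) (E k) t \<omega>))\<^sup>2) \<partial>M)
              \<longlonglongrightarrow> 0))"

definition predictable_sigma ::
  "'w measure \<Rightarrow> (real \<Rightarrow> 'w measure) \<Rightarrow> real \<Rightarrow> (real \<times> 'w) measure" where
  "predictable_sigma M F T = sigma ({0..T} \<times> space M)
     ({{0} \<times> A | A. A \<in> sets (F 0)} \<union>
      {{s<..t} \<times> A | s t A. 0 \<le> s \<and> s < t \<and> t \<le> T \<and> A \<in> sets (F s)})"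

text \<open>The weak formulation along a single path; \<open>R v t\<close> is the noise contribution.\<close>

definition weak_equation ::
  "real \<Rightarrow> real \<Rightarrow> (real \<Rightarrow> real) \<Rightarrow> (real \<Rightarrow> real) \<Rightarrow> (real \<Rightarrow> real) \<Rightarrow> (real \<Rightarrow> L2I \<Rightarrow> real) \<Rightarrow> L2I
    \<Rightarrow> (L2I \<Rightarrow> real \<Rightarrow> real) \<Rightarrow> (real \<Rightarrow> L2I) \<Rightarrow> bool" where
  "weak_equation T Q S \<beta> g f u0 R u \<longleftrightarrow>
     (\<forall>t\<in>{0..T}. \<forall>v\<in>V.
        inner (u t) v = inner u0 v
          - integral\<^sup>L (lebesgue_on {0..t}) (\<lambda>s. V_form (u s) v)
          + integral\<^sup>L (lebesgue_on {0..t}) (\<lambda>s. total_forcing Q S \<beta> g f u s v)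
          + R v t)"

text \<open>The real integrals \<open>\<integral>\<^sub>0\<^sup>t \<langle>G\<^sub>s\<^sup>* v, dW\<^sub>s\<rangle>\<close> are defined only up to a null set
  depending on \<open>v\<close>. As the equation is required for all \<open>t\<close> and \<open>v\<close> outside one null set,
  a version \<open>N v\<close> is chosen for every \<open>v\<close>.\<close>

definition weak_solution ::
  "'w measure \<Rightarrow> (real \<Rightarrow> 'w measure) \<Rightarrow> (nat \<Rightarrow> real \<Rightarrow> 'w \<Rightarrow> real)
    \<Rightarrow> real \<Rightarrow> real \<Rightarrow> (real \<Rightarrow> real) \<Rightarrow> (real \<Rightarrow> real) \<Rightarrow> (real \<Rightarrow> real) \<Rightarrow> (real \<Rightarrow> L2I \<Rightarrow> real) \<Rightarrow> L2I
    \<Rightarrow> real \<Rightarrow> (real \<Rightarrow> L2I \<Rightarrow>\<^sub>L L2I) \<Rightarrow> (real \<Rightarrow> 'w \<Rightarrow> L2I) \<Rightarrow> bool" where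
  "weak_solution M F B T Q S \<beta> g f u0 \<epsilon> G u \<longleftrightarrow>
     (\<lambda>(t, \<omega>). u t \<omega>) \<in> borel_measurable (predictable_sigma M F T) \<and>
     (\<exists>N :: L2I \<Rightarrow> real \<Rightarrow> 'w \<Rightarrow> real.
        (\<forall>v\<in>V. stochastic_integral M B T
           (\<lambda>s h. inner (adjoint (blinfun_apply (G s)) v) h) (N v)) \<and>
        (AE \<omega> in M. weak_equation T Q S \<beta> g f u0 (\<lambda>v t. \<epsilon> * N v t \<omega>) (\<lambda>t. u t \<omega>)))"

end

theory Submission
  imports Defs
begin

text \<open>
  Write \<open>\<delta> = 1/n\<close>, let \<open>X\<close> be a path of \<open>G \<cdot> W\<close> and \<open>z = u\<^sup>n - u\<^sup>\<infinity> - \<delta> X\<close>. By the Ito isometry the noise term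
  tested with a Legendre polynomial \<open>e\<^sub>k\<close> is almost surely \<open>\<delta> \<langle>X, e\<^sub>k\<rangle>\<close>, so that the coefficients
  \<open>\<langle>z, e\<^sub>k\<rangle>\<close> are absolutely continuous. Multiplying their equations by \<open>\<langle>z, e\<^sub>k\<rangle>\<close> and summing over \<open>k\<close>
  (the \<open>e\<^sub>k\<close> are complete and orthogonal in both \<open>H\<close> and \<open>V\<close>) gives an energy inequality for \<open>z\<close>.

  The nonlinearity \<open>g\<close> has no growth bound, but monotonicity alone gives
  \<open>- (g (b + z + \<delta> X) - g b) z \<le> \<delta> (g (b + X) - g b) X\<close> for \<open>b = u\<^sup>\<infinity>\<close> and \<open>0 \<le> \<delta> \<le> 1\<close>, and the integral of the right-hand
  side is finite since \<open>u\<^sup>\<infinity> + X\<close> is an admissible argument of the forcing. Gronwall's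
  inequality yields \<open>\<parallel>z t\<parallel>\<^sup>2 \<le> A \<delta>\<close> uniformly in \<open>t\<close>.
\<close>

section \<open>Legendre polynomials\<close>

text \<open>The weak equation holds outside one null set, but each version \<open>N v\<close> agrees
  with \<open>\<langle>G \<cdot> W, v\<rangle>\<close> only outside a null set depending on
  \<open>v\<close>. The identification is therefore usable for countably many test vectors at once,
  and a countable complete family is needed. Since \<open>rho\<close> vanishes at the end points,
  \<open>V\<close> carries no boundary condition: every polynomial lies in \<open>V\<close>,
  integration by parts against \<open>rho p\<close> has no boundary term, and the Legendre
  polynomials diagonalise the form.

  Working with coefficients replaces the chain rule in the Gelfand triple by a scalar identity for
  squares of absolutely continuous functions. The form is tested at \<open>z + \<delta> X\<close>
  against \<open>z\<close>; completing the square absorbs the cross term and leaves an error of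
  order \<open>\<delta>^2\<close>.

  For \<open>g\<close>, the product of \<open>g (b + z + \<delta> X) - g b\<close> with
  \<open>z\<close> can be negative only where \<open>z\<close> lies between \<open>0\<close> and
  \<open>- \<delta> X\<close>, and there monotonicity controls both factors. As the reaction is
  known to be integrable against \<open>V\<close> only as a whole, the Lipschitz part is put back
  before integrating.\<close>

lemma integrable_I_continuous:
  fixes f :: "real \<Rightarrow> real"
  assumes "continuous_on {-1..1} f"
  shows "integrable I_meas f"
proof -
  have "integrable (lebesgue_on {-1..1}) f"
    using assms by (rule continuous_imp_integrable_real)
  then have "set_integrable lebesgue {-1..1} f"
    by (simp add: integrable_restrict_space set_integrable_def)
  then have "set_integrable lebesgue {-1<..<1} f"
    by (rule set_integrable_subset) auto
  then show ?thesis
    by (simp add: integrable_restrict_space set_integrable_def)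
qed

lemma integral_I_FTC:
  fixes F f :: "real \<Rightarrow> real"
  assumes "\<And>x. x \<in> {-1..1} \<Longrightarrow> (F has_real_derivative f x) (at x)" "continuous_on {-1..1} f"
  shows "integral\<^sup>L I_meas f = F 1 - F (-1)"
proof -
  have "integral\<^sup>L I_meas f = integral {-1<..<1} f"
    using integrable_I_continuous[OF assms(2)] by (intro lebesgue_integral_eq_integral) auto
  also have "\<dots> = integral {-1..1} f"
    by (simp add: integral_open_interval_real)
  also have "\<dots> = F 1 - F (-1)"
    using assms(1) by (intro integral_unique fundamental_theorem_of_calculus)
      (auto simp: has_real_derivative_iff_has_vector_derivative[symmetric] intro: has_field_derivative_at_within)
  finally show ?thesis .
qed

lemma integrable_I_poly [simp, intro]: "integrable I_meas (\<lambda>x. poly p x)"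
  by (intro integrable_I_continuous continuous_intros)

lemma integrable_I_poly' [simp, intro]: "integrable I_meas (poly p)"
  using integrable_I_poly[of p] by simp

lemma integral_I_pderiv: "integral\<^sup>L I_meas (\<lambda>x. poly (pderiv p) x) = poly p 1 - poly p (-1)"
  by (intro integral_I_FTC continuous_intros poly_DERIV)

text \<open>Staying with polynomials instead of classes turns orthogonality into algebra plus
  integration by parts; \<open>inner_polyL2_polyL2\<close> transfers the results to
  \<open>L2I\<close>.\<close>

definition poly_ip :: "real poly \<Rightarrow> real poly \<Rightarrow> real" where
  "poly_ip p q = integral\<^sup>L I_meas (\<lambda>x. poly (p * q) x)"

lemma poly_ip_commute: "poly_ip p q = poly_ip q p"
  by (simp add: poly_ip_def mult.commute)

lemma poly_ip_add: "poly_ip (p + q) r = poly_ip p r + poly_ip q r"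
  unfolding poly_ip_def distrib_right poly_add
  by (rule Bochner_Integration.integral_add) (rule integrable_I_poly)+

lemma poly_ip_smult: "poly_ip (smult c p) r = c * poly_ip p r"
  unfolding poly_ip_def mult_smult_left poly_smult
  by (rule integral_mult_right_zero)

lemma poly_ip_sum: "poly_ip (\<Sum>i\<in>A. f i) r = (\<Sum>i\<in>A. poly_ip (f i) r)"
proof -
  have "poly_ip 0 r = 0" by (simp add: poly_ip_def)
  then show ?thesis
    by (induction A rule: infinite_finite_induct) (auto simp: poly_ip_add)
qed

section \<open>Legendre's equation and orthogonality\<close>

abbreviation rho_poly :: "real poly" where "rho_poly \<equiv> [:1, 0, -1:]"

lemma poly_rho_poly [simp]: "poly rho_poly x = rho x"
  by (simp add: rho_def power2_eq_square)

text \<open>The boundary terms vanish because \<open>rho\<close> is zero at both end points,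
  whatever \<open>p\<close> and \<open>q\<close> are.\<close>

lemma poly_ip_parts:
  "poly_ip (pderiv (rho_poly * p)) q = - poly_ip (rho_poly * p) (pderiv q)"
proof -
  have "poly_ip (pderiv (rho_poly * p)) q + poly_ip (rho_poly * p) (pderiv q) =
      integral\<^sup>L I_meas (\<lambda>x. poly (pderiv (rho_poly * p * q)) x)"
    unfolding poly_ip_def pderiv_mult[of "rho_poly * p" q] poly_add
    by (subst Bochner_Integration.integral_add[symmetric]) (auto simp only: mult.commute add.commute integrable_I_poly)
  also have "\<dots> = 0"
    by (subst integral_I_pderiv) (simp add: rho_def)
  finally show ?thesis by simp
qed

text \<open>The power \<open>y\<close> satisfies \<open>(x^2 - 1) y' = 2 n x y\<close>;
  differentiating this \<open>k + 1\<close> times gives the identity.\<close>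

lemma pderiv_iterate_rodrigues:
  fixes n k :: nat
  defines "y \<equiv> [:-1, 0, 1:] ^ n :: real poly"
  shows "[:-1, 0, 1:] * (pderiv ^^ (k + 2)) y
     + [:0, 2 * (real k + 1) - 2 * real n:] * (pderiv ^^ (k + 1)) y
     + smult ((real k + 1) * (real k - 2 * real n)) ((pderiv ^^ k) y) = 0"
proof (induction k)
  case 0
  have "[:-1, 0, 1:] * pderiv y = [:0, 2 * real n:] * y"
  proof (cases n)
    case (Suc m)
    then show ?thesis
      by (simp add: y_def pderiv_power_Suc pderiv_pCons algebra_simps del: of_nat_Suc power_Suc)
         (simp add: algebra_simps)
  qed (simp add: y_def)
  then have "pderiv ([:-1, 0, 1:] * pderiv y) = pderiv ([:0, 2 * real n:] * y)"
    by simp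
  then have e: "[:-1, 0, 1:] * pderiv (pderiv y) + pderiv y * [:0, 2:] =
     [:0, 2 * real n:] * pderiv y + y * [:2 * real n:]"
    by (simp only: pderiv_mult) (simp add: pderiv_pCons)
  have "poly ([:-1, 0, 1:] * pderiv (pderiv y)) x + poly (pderiv y * [:0, 2:]) x =
     poly ([:0, 2 * real n:] * pderiv y) x + poly (y * [:2 * real n:]) x" for x
    unfolding poly_add[symmetric] e ..
  then show ?case
    by (intro poly_eq_poly_eq_iff[THEN iffD1] ext) (simp add: algebra_simps)
next
  case (Suc k)
  let ?a = "(pderiv ^^ k) y"
  have e: "pderiv ([:-1, 0, 1:] * (pderiv ^^ (k + 2)) y
     + [:0, 2 * (real k + 1) - 2 * real n:] * (pderiv ^^ (k + 1)) y
     + smult ((real k + 1) * (real k - 2 * real n)) ((pderiv ^^ k) y)) = 0"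
    by (subst Suc.IH) simp
  have "poly ([:-1, 0, 1:] * pderiv (pderiv (pderiv ?a)) + pderiv (pderiv ?a) * [:0, 2:]
     + ([:0, 2 * (real k + 1) - 2 * real n:] * pderiv (pderiv ?a) + pderiv ?a * [:2 * (real k + 1) - 2 * real n:])
     + smult ((real k + 1) * (real k - 2 * real n)) (pderiv ?a)) x = 0" for x
    using e by (simp only: pderiv_add pderiv_mult pderiv_smult) (simp add: pderiv_pCons algebra_simps)
  then show ?case
    by (intro poly_eq_poly_eq_iff[THEN iffD1] ext) (simp add: algebra_simps)
qed

text \<open>The case \<open>k = n\<close> of the previous identity: its last coefficient
  \<open>(n + 1) (n - 2 n)\<close> is minus the eigenvalue, and \<open>rho = - (x^2 - 1)\<close>
  reverses the signs of the first two terms.\<close>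

lemma legendre_ode:
  "pderiv (rho_poly * pderiv (legendre n)) = smult (- leg_eigenvalue n) (legendre n)"
proof -
  let ?y = "(pderiv ^^ n) ([:-1, 0, 1:] ^ n) :: real poly"
  have "pderiv (rho_poly * pderiv ?y) = smult (- leg_eigenvalue n) ?y"
  proof (intro poly_eq_poly_eq_iff[THEN iffD1] ext)
    fix x
    have "poly ([:-1, 0, 1:] * pderiv (pderiv ?y) + [:0, 2:] * pderiv ?y
       + smult ((real n + 1) * (real n - 2 * real n)) ?y) x = 0"
      using pderiv_iterate_rodrigues[of n n] by simp
    then show "poly (pderiv (rho_poly * pderiv ?y)) x = poly (smult (- leg_eigenvalue n) ?y) x"
      unfolding pderiv_mult[of rho_poly]
      by (simp add: pderiv_pCons leg_eigenvalue_def rho_def power2_eq_square algebra_simps)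
  qed
  then show ?thesis
    unfolding legendre_def by (simp add: pderiv_smult mult_smult_right smult_smult mult.commute)
qed

lemma degree_legendre [simp]: "degree (legendre n) = n"
proof -
  have "degree ((pderiv ^^ k) p) = degree p - k" for k and p :: "real poly"
    by (induction k) (auto simp: degree_pderiv)
  moreover have "degree ([:-1, 0, 1:] ^ n :: real poly) = 2 * n"
    by (simp add: degree_power_eq)
  ultimately show ?thesis by (simp add: legendre_def)
qed

lemma legendre_nonzero: "legendre n \<noteq> 0"
proof
  assume "legendre n = 0"
  moreover from this have "n = 0" using degree_legendre[of n] by simp
  ultimately show False by (simp add: legendre_def)
qed

text \<open>Both factors are eigenvectors of \<open>p \<mapsto> (rho p')'\<close>, which is
  symmetric by parts, and the eigenvalues \<open>n (n + 1)\<close> are pairwise distinct.\<close>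

lemma poly_ip_legendre_neq:
  assumes "n \<noteq> m"
  shows "poly_ip (legendre n) (legendre m) = 0"
proof -
  have a: "leg_eigenvalue n * poly_ip (legendre n) (legendre m) =
      poly_ip (rho_poly * pderiv (legendre n)) (pderiv (legendre m))" for n m
    using poly_ip_parts[of "pderiv (legendre n)" "legendre m"]
    unfolding legendre_ode poly_ip_smult by simp
  have "poly_ip (rho_poly * p) q = poly_ip (rho_poly * q) p" for p q
    unfolding poly_ip_def by (simp only: mult_ac)
  then have "leg_eigenvalue n * poly_ip (legendre n) (legendre m) = leg_eigenvalue m * poly_ip (legendre n) (legendre m)"
    using a[of n m] a[of m n] by (simp add: poly_ip_commute)
  moreover have "leg_eigenvalue n \<noteq> leg_eigenvalue m"
  proof -
    have "strict_mono leg_eigenvalue"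
      unfolding leg_eigenvalue_def strict_mono_Suc_iff by (auto simp: algebra_simps)
    then show ?thesis using assms by (simp add: strict_mono_eq)
  qed
  ultimately show ?thesis by simp
qed

section \<open>Triangularity and normalisation\<close>

lemma poly_in_span_legendre:
  assumes "degree p < n"
  shows "\<exists>c. p = (\<Sum>k<n. smult (c k) (legendre k))"
  using assms
proof (induction n arbitrary: p)
  case (Suc n)
  define c where "c = coeff p n / lead_coeff (legendre n)"
  define q where "q = p - smult c (legendre n)"
  have "coeff q n = 0"
    using leading_coeff_0_iff[of "legendre n"] legendre_nonzero[of n] unfolding q_def c_def
    by (simp add: field_simps)
  moreover have "degree q \<le> n"
    using Suc.prems by (auto simp: q_def intro!: degree_diff_le order.trans[OF degree_smult_le])
  \<comment> \<open>The zero polynomial has degree \<open>0\<close>, so for \<open>n = 0\<close> the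
    strict bound fails and \<open>q = 0\<close> must be recorded separately.\<close>
  ultimately have d: "n = 0 \<and> q = 0 \<or> degree q < n"
    by (metis degree_0 eq_zero_or_degree_less le_eq_less_or_eq leading_coeff_0_iff less_nat_zero_code not_gr_zero zero_less_iff_neq_zero)
  obtain c' where "q = (\<Sum>k<n. smult (c' k) (legendre k))"
    using d Suc.IH by auto
  then have "p = (\<Sum>k<Suc n. smult ((c'(n := c)) k) (legendre k))"
    by (simp add: q_def algebra_simps)
  then show ?case by blast
qed auto

lemma poly_ip_legendre_lower:
  assumes "degree p < n"
  shows "poly_ip p (legendre n) = 0"
proof -
  obtain c where "p = (\<Sum>k<n. smult (c k) (legendre k))"
    using poly_in_span_legendre[OF assms] by blast
  then show ?thesis
    by (auto simp: poly_ip_sum poly_ip_smult poly_ip_legendre_neq)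
qed

text \<open>Each derivative lowers the order of the root \<open>a\<close> by one. Only the value of
  the cofactor at \<open>a\<close> is tracked; for \<open>k = n\<close> it is the value of the
  \<open>n\<close>-th derivative at \<open>a\<close>.\<close>

lemma pderiv_iterate_linear_power:
  fixes a :: real and r :: "real poly"
  assumes "k \<le> n"
  shows "\<exists>s. (pderiv ^^ k) ([:-a, 1:] ^ n * r) = [:-a, 1:] ^ (n - k) * s \<and>
     poly s a * fact (n - k) = fact n * poly r a"
  using assms
proof (induction k)
  case (Suc k)
  then obtain s where s: "(pderiv ^^ k) ([:-a, 1:] ^ n * r) = [:-a, 1:] ^ (n - k) * s"
     "poly s a * fact (n - k) = fact n * poly r a" by auto
  obtain m where m: "n - k = Suc m" "n - Suc k = m" using Suc.prems
    by (metis Suc_diff_Suc Suc_le_lessD)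
  have "pderiv ([:-a, 1:] ^ Suc m * s) = [:-a, 1:] ^ m * (smult (real (Suc m)) s + [:-a, 1:] * pderiv s)"
    by (simp only: pderiv_mult pderiv_power_Suc) (simp add: pderiv_pCons algebra_simps)
  then have "(pderiv ^^ Suc k) ([:-a, 1:] ^ n * r) =
      [:-a, 1:] ^ m * (smult (real (Suc m)) s + [:-a, 1:] * pderiv s)"
    by (simp add: s m del: power_Suc)
  moreover have "poly (smult (real (Suc m)) s + [:-a, 1:] * pderiv s) a * fact m = fact n * poly r a"
    using s(2) m by (simp add: algebra_simps)
  ultimately show ?case using m by metis
qed auto

text \<open>For \<open>a = 1\<close> and \<open>a = -1\<close> the power in Rodrigues' formula is
  \<open>(x - a)^n (x + a)^n\<close>, whose \<open>n\<close>-th derivative at \<open>a\<close> is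
  \<open>n! (2 a)^n\<close>. Hence the value is \<open>a^n\<close>, and squaring removes the
  sign.\<close>

lemma legendre_endpoint:
  assumes "\<bar>a\<bar> = 1"
  shows "(poly (legendre n) a)\<^sup>2 = 1"
proof -
  have "[:-1, 0, 1:] = [:-a, 1:] * [:a, 1:]"
    using assms by (auto simp: abs_if split: if_splits)
  then have e: "[:-1, 0, 1:] ^ n = [:-a, 1:] ^ n * [:a, 1:] ^ n"
    by (simp only: power_mult_distrib)
  obtain s where "(pderiv ^^ n) ([:-a, 1:] ^ n * [:a, 1:] ^ n) = s" "poly s a = fact n * poly ([:a, 1:] ^ n) a"
    using pderiv_iterate_linear_power[of n n a "[:a, 1:] ^ n"] by auto
  then have "poly (legendre n) a = (2 * a) ^ n / 2 ^ n"
    unfolding legendre_def e by (simp add: poly_power)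
  then have "poly (legendre n) a = a ^ n" by (simp add: power_mult_distrib)
  then show ?thesis using assms
    by (metis power2_abs power_abs power_one)
qed

text \<open>The leading terms of \<open>x P'\<close> and \<open>n P\<close> cancel, so the
  difference is orthogonal to \<open>P\<close> and
  \<open>\<langle>x P', P\<rangle> = n \<langle>P, P\<rangle>\<close>. Integrating
  \<open>(x P^2)' = P^2 + 2 x P' P\<close>, with boundary value \<open>2\<close>, then yields
  \<open>(1 + 2 n) \<langle>P, P\<rangle> = 2\<close>.\<close>

lemma poly_ip_legendre_self: "poly_ip (legendre n) (legendre n) = 2 / (2 * real n + 1)"
proof -
  let ?P = "legendre n"
  have "degree ([:0, 1:] * pderiv ?P - smult (real n) ?P) < n \<or> [:0, 1:] * pderiv ?P - smult (real n) ?P = 0"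
  proof (cases n)
    case (Suc m)
    have "coeff ([:0, 1:] * pderiv ?P - smult (real n) ?P) i = 0" if "i \<ge> n" for i
    proof (cases "i = n")
      case True
      then show ?thesis using Suc by (simp add: coeff_pCons coeff_pderiv)
    next
      case False
      then have "i > n" using that by simp
      then show ?thesis by (cases i) (auto simp: coeff_pCons coeff_pderiv coeff_eq_0)
    qed
    then have "degree ([:0, 1:] * pderiv ?P - smult (real n) ?P) \<le> m"
      using Suc by (intro degree_le) auto
    then show ?thesis using Suc by auto
  next
    case 0
    then show ?thesis by (simp add: pderiv_eq_0_iff)
  qed
  then have "poly_ip ([:0, 1:] * pderiv ?P - smult (real n) ?P) ?P = 0"
    using poly_ip_legendre_lower by (metis mult_zero_left poly_ip_smult smult_0_left)
  then have x: "poly_ip ([:0, 1:] * pderiv ?P) ?P = real n * poly_ip ?P ?P"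
    using poly_ip_add[of "[:0, 1:] * pderiv ?P - smult (real n) ?P" "smult (real n) ?P" ?P]
    by (simp add: poly_ip_smult)
  have "integral\<^sup>L I_meas (\<lambda>x. poly (pderiv ([:0, 1:] * ?P * ?P)) x) = 2"
    by (subst integral_I_pderiv) (use legendre_endpoint[of 1 n] legendre_endpoint[of "-1" n] in
        \<open>simp add: power2_eq_square\<close>)
  moreover have "pderiv ([:0, 1:] * ?P * ?P) = ?P * ?P + smult 2 ([:0, 1:] * pderiv ?P * ?P)"
    by (intro poly_eq_poly_eq_iff[THEN iffD1] ext) (simp add: pderiv_mult pderiv_pCons algebra_simps)
  ultimately have "integral\<^sup>L I_meas (\<lambda>x. poly (?P * ?P) x + 2 * poly ([:0, 1:] * pderiv ?P * ?P) x) = 2"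
    by (simp only: poly_add poly_smult)
  then have "poly_ip ?P ?P + 2 * poly_ip ([:0, 1:] * pderiv ?P) ?P = 2"
    unfolding poly_ip_def
    by (subst (asm) Bochner_Integration.integral_add) (simp_all del: poly_mult poly_pCons mult_pCons_left)
  then show ?thesis unfolding x by (simp add: field_simps)
qed

section \<open>Functions and their classes\<close>

lemma fun_of_square_integrable [simp]: "square_integrable (fun_of w)"
  using Quotient_rep_reflp[OF Quotient_L2I] by simp

lemma fun_of_measurable [measurable]: "fun_of w \<in> borel_measurable I_meas"
  using fun_of_square_integrable by (simp only: square_integrable_def)

lemma fun_of_square_integral: "integrable I_meas (\<lambda>x. (fun_of w x)\<^sup>2)"
  using fun_of_square_integrable by (simp only: square_integrable_def)

lemma abs_fun_of [simp]: "abs_L2I (fun_of w) = w"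
  by (rule Quotient_abs_rep[OF Quotient_L2I])

lemma fun_of_abs:
  assumes "square_integrable h"
  shows "AE x in I_meas. fun_of (abs_L2I h) x = h x"
  using Quotient_rep_abs[OF Quotient_L2I, of h] assms by simp

lemma inner_fun_of: "inner v w = integral\<^sup>L I_meas (\<lambda>x. fun_of v x * fun_of w x)"
  by (simp add: inner_L2I_def)

lemma norm_fun_of: "(norm w)\<^sup>2 = integral\<^sup>L I_meas (\<lambda>x. (fun_of w x)\<^sup>2)"
  unfolding power2_norm_eq_inner inner_fun_of by (simp add: power2_eq_square)

lemma integrable_fun_of_mult [simp]: "integrable I_meas (\<lambda>x. fun_of v x * fun_of w x)"
  by (rule square_integrable_mult) auto

lemma plus_abs:
  assumes "square_integrable h" "square_integrable k"
  shows "abs_L2I h + abs_L2I k = abs_L2I (\<lambda>x. h x + k x)"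
  using assms by (intro plus_L2I.abs_eq) auto

lemma scaleR_abs:
  assumes "square_integrable h"
  shows "c *\<^sub>R abs_L2I h = abs_L2I (\<lambda>x. c * h x)"
  using assms by (intro scaleR_L2I.abs_eq) auto

lemma fun_of_add: "AE x in I_meas. fun_of (v + w) x = fun_of v x + fun_of w x"
  using fun_of_abs[OF square_integrable_add[OF fun_of_square_integrable[of v] fun_of_square_integrable[of w]]]
    plus_abs[of "fun_of v" "fun_of w"] by simp

lemma fun_of_scaleR: "AE x in I_meas. fun_of (c *\<^sub>R w) x = c * fun_of w x"
  using fun_of_abs[OF square_integrable_scale[OF fun_of_square_integrable[of w]], of c]
    scaleR_abs[of "fun_of w" c] by simp

lemma fun_of_diff: "AE x in I_meas. fun_of (v - w) x = fun_of v x - fun_of w x"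
  using fun_of_add[of v "(-1) *\<^sub>R w"] fun_of_scaleR[of "-1" w] by eventually_elim simp

lemma square_integrable_diff:
  assumes "square_integrable v" "square_integrable w"
  shows "square_integrable (\<lambda>x. v x - w x)"
  using square_integrable_add[OF assms(1) square_integrable_scale[OF assms(2), of "-1"]] by simp

lemma norm_abs_diff:
  assumes "square_integrable h" "square_integrable k"
  shows "(norm (abs_L2I h - abs_L2I k))\<^sup>2 = integral\<^sup>L I_meas (\<lambda>x. (h x - k x)\<^sup>2)"
  unfolding norm_fun_of
proof (rule integral_cong_AE)
  show "AE x in I_meas. (fun_of (abs_L2I h - abs_L2I k) x)\<^sup>2 = (h x - k x)\<^sup>2"
    using fun_of_diff[of "abs_L2I h" "abs_L2I k"] fun_of_abs[OF assms(1)] fun_of_abs[OF assms(2)]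
    by eventually_elim simp
qed (use assms in \<open>auto simp: square_integrable_def\<close>)

lemma finite_measure_I: "finite_measure I_meas"
  by (rule finite_measure_lebesgue_on) auto

lemma integrable_I_const [simp]: "integrable I_meas (\<lambda>x. c :: real)"
  using finite_measure_I by (simp add: finite_measure.integrable_const)

lemma AE_I: "AE x in I_meas. -1 < x \<and> x < 1"
  by (rule AE_I2) auto

section \<open>Completeness\<close>

text \<open>Young's inequality on an interval of length two. Taking \<open>e\<close> of the size of
  the norm turns the squared norm into a first power, without any square root.\<close>

lemma nn_integral_abs_le:
  "(\<integral>\<^sup>+ x. ennreal \<bar>fun_of w x\<bar> \<partial>I_meas) \<le> ennreal ((norm w)\<^sup>2 / e + e)" if e: "e > 0"
proof -
  have p: "\<bar>a\<bar> \<le> (a\<^sup>2 / e + e) / 2" for a :: real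
  proof -
    have "0 \<le> (\<bar>a\<bar> - e)\<^sup>2" by simp
    then have "2 * \<bar>a\<bar> * e \<le> a\<^sup>2 + e * e" by (simp add: power2_eq_square algebra_simps)
    then show ?thesis using e by (simp add: field_simps)
  qed
  have "(\<integral>\<^sup>+ x. ennreal \<bar>fun_of w x\<bar> \<partial>I_meas) \<le> (\<integral>\<^sup>+ x. ennreal (((fun_of w x)\<^sup>2 / e + e) / 2) \<partial>I_meas)"
    by (intro nn_integral_mono ennreal_leI p)
  also have "\<dots> = ennreal (integral\<^sup>L I_meas (\<lambda>x. ((fun_of w x)\<^sup>2 / e + e) / 2))"
    using e fun_of_square_integral[of w] by (intro nn_integral_eq_integral) auto
  also have "integral\<^sup>L I_meas (\<lambda>x. ((fun_of w x)\<^sup>2 / e + e) / 2) = ((norm w)\<^sup>2 / e + 2 * e) / 2"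
    using fun_of_square_integral[of w] by (simp add: norm_fun_of measure_restrict_space)
  also have "ennreal \<dots> \<le> ennreal ((norm w)\<^sup>2 / e + e)"
    using e by (intro ennreal_leI) (auto simp: field_simps)
  finally show ?thesis .
qed

text \<open>The increments are summable in \<open>L^1\<close>, hence absolutely summable at almost
  every point; this produces a pointwise limit, which Fatou's lemma shows to be the limit in the
  norm.\<close>

lemma fast_Cauchy_convergent_L2I:
  fixes Y :: "nat \<Rightarrow> L2I"
  assumes step: "\<And>n. norm (Y (Suc n) - Y n) \<le> (1/2) ^ n"
  shows "convergent Y"
proof -
  define f where "f n = fun_of (Y n)" for n
  have tail: "norm (Y n - Y m) \<le> 2 * (1/2) ^ m" if "m \<le> n" for m n
  proof -
    have "norm (Y (m + k) - Y m) \<le> 2 * (1/2) ^ m - 2 * (1/2) ^ (m + k)" for k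
    proof (induction k)
      case (Suc k)
      have "norm (Y (m + Suc k) - Y m) \<le> norm (Y (Suc (m + k)) - Y (m + k)) + norm (Y (m + k) - Y m)"
        using norm_triangle_ineq[of "Y (Suc (m + k)) - Y (m + k)" "Y (m + k) - Y m"] by simp
      also have "\<dots> \<le> (1/2) ^ (m + k) + (2 * (1/2) ^ m - 2 * (1/2) ^ (m + k))"
        using step[of "m + k"] Suc.IH by linarith
      finally show ?case by simp
    qed simp
    from this[of "n - m"] that have "norm (Y n - Y m) \<le> 2 * (1/2) ^ m - 2 * (1/2) ^ n" by simp
    moreover have "(0::real) \<le> 2 * (1/2) ^ n" by simp
    ultimately show ?thesis by linarith
  qed
  have "(\<integral>\<^sup>+ x. (\<Sum>n. ennreal \<bar>fun_of (Y (Suc n) - Y n) x\<bar>) \<partial>I_meas) =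
      (\<Sum>n. \<integral>\<^sup>+ x. ennreal \<bar>fun_of (Y (Suc n) - Y n) x\<bar> \<partial>I_meas)"
    by (rule nn_integral_suminf) measurable
  also have "\<dots> \<le> (\<Sum>n. ennreal (2 * (1/2) ^ n))"
  \<comment> \<open>With \<open>e = (1/2) ^ n\<close> both summands of the \<open>L^1\<close> bound
    are at most \<open>(1/2) ^ n\<close>.\<close>
  proof (intro suminf_le)
    fix n
    have "(\<integral>\<^sup>+ x. ennreal \<bar>fun_of (Y (Suc n) - Y n) x\<bar> \<partial>I_meas) \<le>
        ennreal ((norm (Y (Suc n) - Y n))\<^sup>2 / (1/2) ^ n + (1/2) ^ n)"
      by (rule nn_integral_abs_le) simp
    also have "\<dots> \<le> ennreal (2 * (1/2) ^ n)"
    proof (rule ennreal_leI)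
      have "(norm (Y (Suc n) - Y n))\<^sup>2 \<le> ((1/2) ^ n)\<^sup>2"
        by (intro power_mono step) auto
      then show "(norm (Y (Suc n) - Y n))\<^sup>2 / (1/2) ^ n + (1/2) ^ n \<le> 2 * (1/2) ^ n"
        by (simp add: field_simps power2_eq_square)
    qed
    finally show "(\<integral>\<^sup>+ x. ennreal \<bar>fun_of (Y (Suc n) - Y n) x\<bar> \<partial>I_meas) \<le> ennreal (2 * (1/2) ^ n)" .
  qed auto
  also have "\<dots> = ennreal (\<Sum>n. 2 * (1/2) ^ n)"
    by (rule suminf_ennreal2) (auto intro!: summable_mult summable_geometric)
  also have "\<dots> < \<infinity>" by simp
  finally have fin: "(\<integral>\<^sup>+ x. (\<Sum>n. ennreal \<bar>fun_of (Y (Suc n) - Y n) x\<bar>) \<partial>I_meas) < \<infinity>" .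
  have "AE x in I_meas. (\<Sum>n. ennreal \<bar>fun_of (Y (Suc n) - Y n) x\<bar>) \<noteq> \<infinity>"
    by (rule nn_integral_PInf_AE) (measurable, use fin in simp)
  moreover have "AE x in I_meas. \<forall>n. fun_of (Y (Suc n) - Y n) x = f (Suc n) x - f n x"
    unfolding AE_all_countable f_def using fun_of_diff by blast
  ultimately have conv: "AE x in I_meas. convergent (\<lambda>n. f n x)"
  proof eventually_elim
    case (elim x)
    then have "summable (\<lambda>n. \<bar>f (Suc n) x - f n x\<bar>)"
      by (intro summable_suminf_not_top) auto
    then have "summable (\<lambda>n. f (Suc n) x - f n x)"
      by (rule summable_rabs_cancel)
    then have "convergent (\<lambda>n. \<Sum>i<n. f (Suc i) x - f i x)"
      by (simp add: summable_iff_convergent)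
    then have "convergent (\<lambda>n. f n x - f 0 x)"
      by (subst (asm) sum_lessThan_telescope)
    from convergent_add[OF this convergent_const[of "f 0 x"]] show ?case by simp
  qed
  define h where "h x = lim (\<lambda>n. f n x)" for x
  have [measurable]: "f n \<in> borel_measurable I_meas" for n
    by (simp add: f_def)
  have hm [measurable]: "h \<in> borel_measurable I_meas"
    unfolding h_def by measurable
  have lim: "AE x in I_meas. (\<lambda>n. f n x) \<longlonglongrightarrow> h x"
    using conv by eventually_elim (auto simp: h_def convergent_LIMSEQ_iff)
  \<comment> \<open>Fatou's lemma in \<open>n\<close> for fixed \<open>m\<close>, with the geometric
    tail as the common bound. It gives both the square integrability of \<open>h\<close> and the
    rate of convergence.\<close>
  have bound: "(\<integral>\<^sup>+ x. ennreal ((h x - f m x)\<^sup>2) \<partial>I_meas) \<le> ennreal ((2 * (1/2) ^ m)\<^sup>2)" for m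
  proof -
    have "(\<integral>\<^sup>+ x. ennreal ((h x - f m x)\<^sup>2) \<partial>I_meas) = (\<integral>\<^sup>+ x. liminf (\<lambda>n. ennreal ((f n x - f m x)\<^sup>2)) \<partial>I_meas)"
    proof (rule nn_integral_cong_AE, use lim in eventually_elim)
      case (elim x)
      have "(\<lambda>n. ennreal ((f n x - f m x)\<^sup>2)) \<longlonglongrightarrow> ennreal ((h x - f m x)\<^sup>2)"
        by (intro tendsto_ennrealI tendsto_power tendsto_diff tendsto_const elim)
      then show ?case by (intro lim_imp_Liminf[symmetric]) auto
    qed
    also have "\<dots> \<le> liminf (\<lambda>n. \<integral>\<^sup>+ x. ennreal ((f n x - f m x)\<^sup>2) \<partial>I_meas)"
      by (rule nn_integral_liminf) measurable
    also have "\<dots> \<le> ennreal ((2 * (1/2) ^ m)\<^sup>2)"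
    proof (rule order.trans[OF Liminf_le_Limsup[OF trivial_limit_sequentially]
          Limsup_bounded[OF eventually_sequentiallyI[of m]]])
      fix n assume "m \<le> n"
      have "(\<integral>\<^sup>+ x. ennreal ((f n x - f m x)\<^sup>2) \<partial>I_meas) = ennreal (integral\<^sup>L I_meas (\<lambda>x. (f n x - f m x)\<^sup>2))"
        unfolding f_def using square_integrable_diff[OF fun_of_square_integrable[of "Y n"] fun_of_square_integrable[of "Y m"]]
        by (intro nn_integral_eq_integral) (auto simp: square_integrable_def)
      also have "\<dots> = ennreal ((norm (Y n - Y m))\<^sup>2)"
        unfolding f_def using norm_abs_diff[of "fun_of (Y n)" "fun_of (Y m)"] by simp
      also have "\<dots> \<le> ennreal ((2 * (1/2) ^ m)\<^sup>2)"
        by (intro ennreal_leI power_mono tail \<open>m \<le> n\<close>) auto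
      finally show "(\<integral>\<^sup>+ x. ennreal ((f n x - f m x)\<^sup>2) \<partial>I_meas) \<le> ennreal ((2 * (1/2) ^ m)\<^sup>2)" .
    qed
    finally show ?thesis .
  qed
  have d: "square_integrable (\<lambda>x. h x - f m x)" for m
    unfolding square_integrable_def integrable_iff_bounded
    using le_less_trans[OF bound[of m] ennreal_less_top] by simp
  from square_integrable_add[OF d[of 0] fun_of_square_integrable[of "Y 0"]]
  have h: "square_integrable h" by (simp add: f_def)
  have "norm (abs_L2I h - Y m) \<le> 2 * (1/2) ^ m" for m
  proof (rule power2_le_imp_le)
    have "ennreal ((norm (abs_L2I h - Y m))\<^sup>2) = ennreal (integral\<^sup>L I_meas (\<lambda>x. (h x - f m x)\<^sup>2))"
      unfolding f_def using norm_abs_diff[OF h fun_of_square_integrable[of "Y m"]] by simp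
    also have "\<dots> = (\<integral>\<^sup>+ x. ennreal ((h x - f m x)\<^sup>2) \<partial>I_meas)"
      using d[of m] by (intro nn_integral_eq_integral[symmetric]) (auto simp: square_integrable_def)
    also note bound
    finally show "(norm (abs_L2I h - Y m))\<^sup>2 \<le> (2 * (1/2) ^ m)\<^sup>2" by simp
  qed simp
  moreover have "(\<lambda>m. 2 * (1/2) ^ m :: real) \<longlonglongrightarrow> 0"
    using tendsto_mult[OF tendsto_const[of 2] LIMSEQ_realpow_zero[of "1/2"]] by simp
  ultimately have "(\<lambda>m. abs_L2I h - Y m) \<longlonglongrightarrow> 0"
    by - (rule Lim_null_comparison[of _ "\<lambda>m. 2 * (1/2) ^ m"], rule always_eventually, blast, assumption)
  from tendsto_diff[OF tendsto_const[of "abs_L2I h"] this] have "Y \<longlonglongrightarrow> abs_L2I h" by simp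
  then show ?thesis by (rule convergentI)
qed

text \<open>Completeness gives meaning to the orthogonal series in \<open>noise\<close> and in the
  construction of adjoints. A Cauchy sequence converges as soon as a rapidly converging subsequence
  does.\<close>

instance L2I :: complete_space
proof
  fix X :: "nat \<Rightarrow> L2I"
  assume X: "Cauchy X"
  then have "\<exists>N. \<forall>m\<ge>N. \<forall>k\<ge>N. norm (X m - X k) < (1/2) ^ n" for n
    by (metis (full_types) CauchyD zero_less_power half_gt_zero_iff zero_less_one)
  then obtain N where N: "\<And>n m k. m \<ge> N n \<Longrightarrow> k \<ge> N n \<Longrightarrow> norm (X m - X k) < (1/2) ^ n"
    by metis
  \<comment> \<open>Summing \<open>Suc (N i)\<close> makes \<open>r\<close> strictly increasing and
    keeps \<open>r n\<close> above \<open>N n\<close>, so consecutive terms of the subsequence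
    differ by less than \<open>(1/2) ^ n\<close>.\<close>
  define r where "r n = (\<Sum>i\<le>n. Suc (N i))" for n
  have r: "strict_mono r"
    by (auto simp: strict_mono_Suc_iff r_def)
  have rN: "N n \<le> r n" for n
    using member_le_sum[of n "{..n}" "\<lambda>i. Suc (N i)"] by (simp add: r_def)
  have "r n \<le> r (Suc n)" for n
    using r by (simp add: strict_mono_leD)
  then have "norm (X (r (Suc n)) - X (r n)) \<le> (1/2) ^ n" for n
    using N[of n "r (Suc n)" "r n"] rN[of n] by (meson le_trans less_imp_le)
  then have "convergent (\<lambda>n. X (r n))"
    by (rule fast_Cauchy_convergent_L2I)
  then obtain L where "(X \<circ> r) \<longlonglongrightarrow> L"
    by (auto simp: convergent_def o_def)
  then show "convergent X"
    using Cauchy_converges_subseq[OF X] r by (metis convergentI comp_def)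
qed

instance L2I :: banach ..

section \<open>Density of the polynomials\<close>

lemma real_polynomial_function_imp_poly:
  assumes "real_polynomial_function f"
  shows "\<exists>p. f = poly p"
proof -
  obtain a n where "f = (\<lambda>x. \<Sum>i\<le>n. a i * x ^ i)"
    using assms real_polynomial_function_iff_sum by blast
  then have "f = poly (\<Sum>i\<le>n. monom (a i) i)"
    by (auto simp: poly_sum poly_monom)
  then show ?thesis by blast
qed

lemma poly_measurable_I [measurable]: "poly p \<in> borel_measurable I_meas"
  using integrable_I_poly'[of p] by (simp add: integrable_iff_bounded)

text \<open>A measurable function is almost everywhere a limit of continuous ones. Truncating these
  at \<open>C\<close> and approximating each uniformly within \<open>1 / (n + 1)\<close> on the
  closed interval costs at most \<open>1\<close> in the bound, which dominated convergence will
  use.\<close>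

lemma bounded_approx_poly:
  assumes "h \<in> borel_measurable I_meas" "\<And>x. \<bar>h x\<bar> \<le> C"
  shows "\<exists>p. (\<forall>n. \<forall>x\<in>{-1..1}. \<bar>poly (p n) x\<bar> \<le> C + 1) \<and> (AE x in I_meas. (\<lambda>n. poly (p n) x) \<longlonglongrightarrow> h x)"
proof -
  \<comment> \<open>\<open>measurable_on\<close> extends by zero off the set, hence the detour
    through the cut-off function.\<close>
  have "(\<lambda>x. if x \<in> {-1<..<1} then h x else 0) \<in> borel_measurable lebesgue"
    using assms(1) by (subst borel_measurable_if) auto
  then have "h measurable_on {-1<..<1}"
    using lebesgue_measurable_imp_measurable_on_real[of "\<lambda>x. if x \<in> {-1<..<1} then h x else 0" "{-1<..<1}"]
    unfolding measurable_on_def by (simp cong: if_cong)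
  then obtain N g where N: "negligible N" and g: "\<And>n. continuous_on UNIV (g n)"
    and lim: "\<And>x. x \<notin> N \<Longrightarrow> (\<lambda>n. g n x) \<longlonglongrightarrow> (if x \<in> {-1<..<1} then h x else 0)"
    unfolding measurable_on_def by blast
  have "\<exists>p. \<forall>x\<in>{-1..1}. \<bar>max (- C) (min C (g n x)) - poly p x\<bar> < 1 / (real n + 1)" for n
  proof -
    have "continuous_on {-1..1} (\<lambda>x. max (- C) (min C (g n x)))"
      by (intro continuous_intros continuous_on_subset[OF g]) auto
    then obtain f where "real_polynomial_function f"
      "\<And>x. x \<in> {-1..1} \<Longrightarrow> \<bar>max (- C) (min C (g n x)) - f x\<bar> < 1 / (real n + 1)"
      using Stone_Weierstrass_real_polynomial_function[of "{-1..1::real}" "\<lambda>x. max (- C) (min C (g n x))" "1 / (real n + 1)"]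
      by (auto simp del: max_less_iff_conj)
    then show ?thesis using real_polynomial_function_imp_poly by metis
  qed
  then obtain p where p: "\<And>n x. x \<in> {-1..1} \<Longrightarrow> \<bar>max (- C) (min C (g n x)) - poly (p n) x\<bar> < 1 / (real n + 1)"
    by metis
  have "\<bar>poly (p n) x\<bar> \<le> C + 1" if "x \<in> {-1..1}" for n x
  proof -
    have "C \<ge> 0" using assms(2)[of 0] by linarith
    then have "\<bar>max (- C) (min C (g n x))\<bar> \<le> C" by (auto simp: abs_le_iff)
    moreover have "1 / (real n + 1) \<le> 1" by simp
    ultimately show ?thesis using p[OF that, of n] by linarith
  qed
  moreover have "AE x in I_meas. (\<lambda>n. poly (p n) x) \<longlonglongrightarrow> h x"
  proof -
    have "AE x in lebesgue. x \<notin> N"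
      using N by (simp add: negligible_iff_null_sets AE_not_in)
    then have "AE x in I_meas. x \<notin> N"
      by (simp add: AE_restrict_space_iff) (auto elim: eventually_mono)
    then show ?thesis using AE_I
    proof eventually_elim
      case (elim x)
      then have "(\<lambda>n. g n x) \<longlonglongrightarrow> h x" using lim[of x] by simp
      then have "(\<lambda>n. max (- C) (min C (g n x))) \<longlonglongrightarrow> max (- C) (min C (h x))"
        by (intro tendsto_intros)
      moreover have "max (- C) (min C (h x)) = h x"
        using assms(2)[of x] by (auto simp: max_def min_def)
      moreover have "(\<lambda>n. max (- C) (min C (g n x)) - poly (p n) x) \<longlonglongrightarrow> 0"
      proof (rule Lim_null_comparison)
        show "\<forall>\<^sub>F n in sequentially. norm (max (- C) (min C (g n x)) - poly (p n) x) \<le> 1 / (real n + 1)"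
          using p[of x] elim by (auto intro!: always_eventually less_imp_le)
        show "(\<lambda>n. 1 / (real n + 1)) \<longlonglongrightarrow> 0"
          using LIMSEQ_inverse_real_of_nat by (simp add: inverse_eq_divide add.commute)
      qed
      ultimately have "(\<lambda>n. max (- C) (min C (g n x)) - (max (- C) (min C (g n x)) - poly (p n) x)) \<longlonglongrightarrow> h x - 0"
        by (intro tendsto_diff) auto
      then show ?case by simp
    qed
  qed
  ultimately show ?thesis by blast
qed

lemma abs_diff_truncate_le: "0 \<le> c \<Longrightarrow> \<bar>d - max (- c) (min c d)\<bar> \<le> \<bar>d\<bar>" for c d :: real
  by (auto simp: max_def min_def abs_if)

text \<open>Serves with weight \<open>1\<close> for density in \<open>H\<close> and with weight
  \<open>rho\<close> for derivatives in \<open>V\<close>. The function is first truncated at height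
  \<open>m\<close>, since the polynomial approximation with a common bound applies to bounded
  functions.\<close>

lemma weighted_poly_dense:
  assumes [measurable]: "r \<in> borel_measurable I_meas" "d \<in> borel_measurable I_meas"
    and r: "\<And>x. x \<in> {-1<..<1} \<Longrightarrow> 0 \<le> r x \<and> r x \<le> 1"
    and int: "integrable I_meas (\<lambda>x. r x * (d x)\<^sup>2)" and e: "e > 0"
  shows "\<exists>p. integral\<^sup>L I_meas (\<lambda>x. r x * (d x - poly p x)\<^sup>2) < e"
proof -
  define t where "t m x = max (- real m) (min (real m) (d x))" for m x
  have [measurable]: "t m \<in> borel_measurable I_meas" for m
    unfolding t_def by measurable
  have "(\<lambda>m. integral\<^sup>L I_meas (\<lambda>x. r x * (d x - t m x)\<^sup>2)) \<longlonglongrightarrow> integral\<^sup>L I_meas (\<lambda>x. 0)"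
  proof (rule integral_dominated_convergence[where w = "\<lambda>x. r x * (d x)\<^sup>2"])
    show "AE x in I_meas. (\<lambda>m. r x * (d x - t m x)\<^sup>2) \<longlonglongrightarrow> 0"
    proof (rule AE_I2)
      fix x
      obtain m0 :: nat where "\<bar>d x\<bar> \<le> real m0" using real_arch_simple by blast
      then have "\<forall>\<^sub>F m in sequentially. r x * (d x - t m x)\<^sup>2 = 0"
        by (intro eventually_sequentiallyI[of m0]) (auto simp: t_def max_def min_def)
      then show "(\<lambda>m. r x * (d x - t m x)\<^sup>2) \<longlonglongrightarrow> 0"
        by (rule tendsto_eventually)
    qed
    show "AE x in I_meas. norm (r x * (d x - t m x)\<^sup>2) \<le> r x * (d x)\<^sup>2" for m
    proof (rule AE_I2)
      fix x :: real assume "x \<in> space I_meas"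
      then have "0 \<le> r x" using r by auto
      moreover have "(d x - t m x)\<^sup>2 \<le> (d x)\<^sup>2"
        unfolding t_def by (intro abs_le_square_iff[THEN iffD1] abs_diff_truncate_le) simp
      ultimately show "norm (r x * (d x - t m x)\<^sup>2) \<le> r x * (d x)\<^sup>2"
        by (simp add: abs_mult mult_left_mono)
    qed
  qed (use int in auto)
  then have "\<forall>\<^sub>F m in sequentially. integral\<^sup>L I_meas (\<lambda>x. r x * (d x - t m x)\<^sup>2) < e / 4"
    using e by (intro order_tendstoD(2)) auto
  \<comment> \<open>A quarter of \<open>e\<close> because the two errors are combined by
    \<open>(a + b)^2 \<le> 2 a^2 + 2 b^2\<close>.\<close>
  then obtain m where m: "integral\<^sup>L I_meas (\<lambda>x. r x * (d x - t m x)\<^sup>2) < e / 4"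
    by (meson eventually_happens sequentially_bot trivial_limit_sequentially)
  obtain p where p: "\<And>n x. x \<in> {-1..1} \<Longrightarrow> \<bar>poly (p n) x\<bar> \<le> real m + 1"
    "AE x in I_meas. (\<lambda>n. poly (p n) x) \<longlonglongrightarrow> t m x"
    using bounded_approx_poly[of "t m" "real m"] by (force simp: t_def)
  have tm: "\<bar>t m x\<bar> \<le> real m" for x by (auto simp: t_def)
  \<comment> \<open>The bound \<open>2 m + 1\<close> adds the height \<open>m\<close> of the
    truncation and the height \<open>m + 1\<close> of the polynomials.\<close>
  have i1: "\<And>n. integrable I_meas (\<lambda>x. r x * (t m x - poly (p n) x)\<^sup>2)"
    and b1: "\<And>n. AE x in I_meas. norm (r x * (t m x - poly (p n) x)\<^sup>2) \<le> (2 * real m + 1)\<^sup>2"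
  proof -
    show *: "AE x in I_meas. norm (r x * (t m x - poly (p n) x)\<^sup>2) \<le> (2 * real m + 1)\<^sup>2" for n
    proof (rule AE_I2)
      fix x :: real assume "x \<in> space I_meas"
      then have x: "0 \<le> r x" "r x \<le> 1" "\<bar>poly (p n) x\<bar> \<le> real m + 1" using r p(1)[of x n] by auto
      then have "(t m x - poly (p n) x)\<^sup>2 \<le> (2 * real m + 1)\<^sup>2"
        using tm[of x] by (intro abs_le_square_iff[THEN iffD1]) auto
      then show "norm (r x * (t m x - poly (p n) x)\<^sup>2) \<le> (2 * real m + 1)\<^sup>2"
        using x mult_mono[of "r x" 1 "(t m x - poly (p n) x)\<^sup>2" "(2 * real m + 1)\<^sup>2"] by (simp add: abs_mult)
    qed
    show "integrable I_meas (\<lambda>x. r x * (t m x - poly (p n) x)\<^sup>2)" for n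
      by (rule Bochner_Integration.integrable_bound[where f = "\<lambda>_. (2 * real m + 1)\<^sup>2"])
        (simp, measurable, use *[of n] in simp)
  qed
  have "(\<lambda>n. integral\<^sup>L I_meas (\<lambda>x. r x * (t m x - poly (p n) x)\<^sup>2)) \<longlonglongrightarrow> integral\<^sup>L I_meas (\<lambda>x. 0)"
  proof (rule integral_dominated_convergence[where w = "\<lambda>x. (2 * real m + 1)\<^sup>2"])
    show "AE x in I_meas. (\<lambda>n. r x * (t m x - poly (p n) x)\<^sup>2) \<longlonglongrightarrow> 0"
      using p(2)
    proof eventually_elim
      case (elim x)
      then have "(\<lambda>n. r x * (t m x - poly (p n) x)\<^sup>2) \<longlonglongrightarrow> r x * (t m x - t m x)\<^sup>2"
        by (intro tendsto_intros)
      then show ?case by simp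
    qed
  qed (use b1 in auto)
  then have "\<forall>\<^sub>F n in sequentially. integral\<^sup>L I_meas (\<lambda>x. r x * (t m x - poly (p n) x)\<^sup>2) < e / 4"
    using e by (intro order_tendstoD(2)) auto
  then obtain n where n: "integral\<^sup>L I_meas (\<lambda>x. r x * (t m x - poly (p n) x)\<^sup>2) < e / 4"
    by (meson eventually_happens sequentially_bot trivial_limit_sequentially)
  have i2: "integrable I_meas (\<lambda>x. r x * (d x - t m x)\<^sup>2)"
  proof (rule Bochner_Integration.integrable_bound[OF int])
    show "AE x in I_meas. norm (r x * (d x - t m x)\<^sup>2) \<le> norm (r x * (d x)\<^sup>2)"
    proof (rule AE_I2)
      fix x :: real assume "x \<in> space I_meas"
      then have "0 \<le> r x" using r by auto
      moreover have "(d x - t m x)\<^sup>2 \<le> (d x)\<^sup>2"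
        unfolding t_def by (intro abs_le_square_iff[THEN iffD1] abs_diff_truncate_le) simp
      ultimately show "norm (r x * (d x - t m x)\<^sup>2) \<le> norm (r x * (d x)\<^sup>2)"
        by (simp add: abs_mult mult_left_mono)
    qed
  qed measurable
  have "integral\<^sup>L I_meas (\<lambda>x. r x * (d x - poly (p n) x)\<^sup>2) \<le>
      integral\<^sup>L I_meas (\<lambda>x. 2 * (r x * (d x - t m x)\<^sup>2) + 2 * (r x * (t m x - poly (p n) x)\<^sup>2))"
  proof (rule integral_mono_AE')
    show "AE x in I_meas. r x * (d x - poly (p n) x)\<^sup>2 \<le>
        2 * (r x * (d x - t m x)\<^sup>2) + 2 * (r x * (t m x - poly (p n) x)\<^sup>2)"
    proof (rule AE_I2)
      fix x :: real assume "x \<in> space I_meas"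
      then have "0 \<le> r x" using r by auto
      moreover have "(a + b)\<^sup>2 \<le> 2 * a\<^sup>2 + 2 * b\<^sup>2" for a b :: real
        using zero_le_power2[of "a - b"] by (simp add: power2_eq_square algebra_simps)
      from this[of "d x - t m x" "t m x - poly (p n) x"]
      have "(d x - poly (p n) x)\<^sup>2 \<le> 2 * (d x - t m x)\<^sup>2 + 2 * (t m x - poly (p n) x)\<^sup>2" by simp
      ultimately show "r x * (d x - poly (p n) x)\<^sup>2 \<le>
        2 * (r x * (d x - t m x)\<^sup>2) + 2 * (r x * (t m x - poly (p n) x)\<^sup>2)"
        using mult_left_mono[of _ _ "r x"] by (fastforce simp: algebra_simps)
    qed
  qed (use i1 i2 r in auto)
  also have "\<dots> = 2 * integral\<^sup>L I_meas (\<lambda>x. r x * (d x - t m x)\<^sup>2) + 2 * integral\<^sup>L I_meas (\<lambda>x. r x * (t m x - poly (p n) x)\<^sup>2)"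
    using i1 i2 by simp
  also have "\<dots> < e" using m n by simp
  finally show ?thesis by blast
qed

section \<open>The Legendre basis\<close>

definition polyL2 :: "real poly \<Rightarrow> L2I" where
  "polyL2 p = abs_L2I (poly p)"

lemma square_integrable_poly [simp]: "square_integrable (poly p)"
proof -
  have "poly p \<in> borel_measurable I_meas"
    using integrable_I_poly'[of p] by (simp add: integrable_iff_bounded)
  moreover have "(\<lambda>x. (poly p x)\<^sup>2) = poly (p * p)"
    by (simp add: fun_eq_iff power2_eq_square)
  ultimately show ?thesis using integrable_I_poly'[of "p * p"] by (simp add: square_integrable_def)
qed

lemma fun_of_polyL2: "AE x in I_meas. fun_of (polyL2 p) x = poly p x"
  unfolding polyL2_def by (rule fun_of_abs) simp

lemma inner_polyL2: "inner (polyL2 p) w = integral\<^sup>L I_meas (\<lambda>x. poly p x * fun_of w x)"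
  unfolding inner_fun_of
proof (rule integral_cong_AE)
  show "AE x in I_meas. fun_of (polyL2 p) x * fun_of w x = poly p x * fun_of w x"
    using fun_of_polyL2[of p] by eventually_elim simp
qed (auto intro!: borel_measurable_times simp: square_integrable_poly[unfolded square_integrable_def])

lemma inner_polyL2_polyL2: "inner (polyL2 p) (polyL2 q) = poly_ip p q"
  unfolding inner_polyL2 poly_ip_def
proof (rule integral_cong_AE)
  show "AE x in I_meas. poly p x * fun_of (polyL2 q) x = poly (p * q) x"
    using fun_of_polyL2[of q] by eventually_elim simp
qed (auto intro!: borel_measurable_times simp: square_integrable_poly[unfolded square_integrable_def])

lemma polyL2_add: "polyL2 (p + q) = polyL2 p + polyL2 q"
  unfolding polyL2_def by (subst plus_abs) (auto simp: poly_add[abs_def])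

lemma polyL2_smult: "polyL2 (smult c p) = c *\<^sub>R polyL2 p"
  unfolding polyL2_def by (subst scaleR_abs) (auto simp: poly_smult[abs_def])

lemma polyL2_0 [simp]: "polyL2 0 = 0"
  using polyL2_smult[of 0 0] by simp

lemma polyL2_sum: "polyL2 (\<Sum>i\<in>A. f i) = (\<Sum>i\<in>A. polyL2 (f i))"
  by (induction A rule: infinite_finite_induct) (auto simp: polyL2_add)

definition leg_poly :: "nat \<Rightarrow> real poly" where
  "leg_poly n = smult (sqrt ((2 * real n + 1) / 2)) (legendre n)"

lemma leg_eq_polyL2: "leg n = polyL2 (leg_poly n)"
  by (simp add: leg_def polyL2_def leg_poly_def poly_smult[abs_def])

lemma inner_leg: "inner (leg n) (leg m) = (if n = m then 1 else 0)"
  unfolding leg_eq_polyL2 leg_poly_def polyL2_smult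
  by (simp add: inner_polyL2_polyL2 poly_ip_legendre_neq poly_ip_legendre_self)
     (simp add: real_sqrt_mult[symmetric] flip: mult.assoc)

lemma norm_leg [simp]: "norm (leg n) = 1"
  using inner_leg[of n n] by (simp add: norm_eq_sqrt_inner)

definition leg_proj :: "nat \<Rightarrow> L2I \<Rightarrow> L2I" where
  "leg_proj K w = (\<Sum>k<K. inner w (leg k) *\<^sub>R leg k)"

lemma polyL2_in_span_leg:
  assumes "degree p < K"
  shows "\<exists>c. polyL2 p = (\<Sum>k<K. c k *\<^sub>R leg k)"
proof -
  obtain c where c: "p = (\<Sum>k<K. smult (c k) (legendre k))"
    using poly_in_span_legendre[OF assms] by blast
  have "polyL2 (legendre k) = (1 / sqrt ((2 * real k + 1) / 2)) *\<^sub>R leg k" for k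
    by (simp add: leg_eq_polyL2 leg_poly_def polyL2_smult)
  then have "polyL2 p = (\<Sum>k<K. (c k * (1 / sqrt ((2 * real k + 1) / 2))) *\<^sub>R leg k)"
    by (subst c) (simp add: polyL2_sum polyL2_smult)
  then show ?thesis by (intro exI[of _ "\<lambda>k. c k * (1 / sqrt ((2 * real k + 1) / 2))"])
qed

lemma inner_leg_sum: "inner (\<Sum>k<K. c k *\<^sub>R leg k) (leg j) = (if j < K then c j else 0)"
  by (simp add: inner_sum_left inner_leg if_distrib[where f = "(*) _"] cong: if_cong)

lemma inner_leg_proj: "inner (leg_proj K w) (leg j) = (if j < K then inner w (leg j) else 0)"
  unfolding leg_proj_def by (rule inner_leg_sum)

lemma norm_leg_sum: "(norm (\<Sum>k<K. c k *\<^sub>R leg k))\<^sup>2 = (\<Sum>k<K. (c k)\<^sup>2)"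
  unfolding power2_norm_eq_inner inner_sum_right inner_scaleR_right inner_leg_sum
  by (simp add: power2_eq_square)

lemma norm_leg_proj: "(norm (leg_proj K w))\<^sup>2 = (\<Sum>k<K. (inner w (leg k))\<^sup>2)"
  unfolding leg_proj_def by (rule norm_leg_sum)

text \<open>Pythagoras: the residual of the projection is orthogonal to every combination of the
  first \<open>K\<close> basis vectors.\<close>

lemma norm_diff_leg_proj_le: "norm (w - leg_proj K w) \<le> norm (w - (\<Sum>k<K. c k *\<^sub>R leg k))"
proof (rule power2_le_imp_le)
  let ?d = "\<Sum>k<K. (inner w (leg k) - c k) *\<^sub>R leg k"
  have "inner (w - leg_proj K w) ?d = 0"
    by (simp add: inner_sum_right inner_diff_left inner_leg_proj)
  moreover have "w - (\<Sum>k<K. c k *\<^sub>R leg k) = (w - leg_proj K w) + ?d"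
    by (simp add: leg_proj_def scaleR_diff_left sum_subtractf)
  ultimately have "(norm (w - (\<Sum>k<K. c k *\<^sub>R leg k)))\<^sup>2 = (norm (w - leg_proj K w))\<^sup>2 + (norm ?d)\<^sup>2"
    by (simp only: power2_norm_eq_inner inner_add_left inner_add_right) (simp add: inner_commute)
  then show "(norm (w - leg_proj K w))\<^sup>2 \<le> (norm (w - (\<Sum>k<K. c k *\<^sub>R leg k)))\<^sup>2"
    by simp
qed simp

lemma polyL2_dense:
  assumes "e > 0"
  shows "\<exists>p. norm (w - polyL2 p) < e"
proof -
  obtain p where "integral\<^sup>L I_meas (\<lambda>x. 1 * (fun_of w x - poly p x)\<^sup>2) < e\<^sup>2"
    using weighted_poly_dense[of "\<lambda>_. 1" "fun_of w" "e\<^sup>2"] assms fun_of_square_integral by auto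
  then have "(norm (w - polyL2 p))\<^sup>2 < e\<^sup>2"
    using norm_abs_diff[of "fun_of w" "poly p"] by (simp add: polyL2_def)
  then show ?thesis using assms power2_less_imp_less[of _ e] by auto
qed

text \<open>A polynomial close to \<open>w\<close> lies in the span of the first \<open>K\<close>
  basis vectors once \<open>K\<close> exceeds its degree, and the projection is at least as
  good.\<close>

lemma leg_proj_tendsto: "(\<lambda>K. leg_proj K w) \<longlonglongrightarrow> w"
proof (rule LIMSEQ_I)
  fix e :: real assume "e > 0"
  then obtain p where p: "norm (w - polyL2 p) < e" using polyL2_dense by blast
  have "norm (leg_proj K w - w) < e" if K: "K \<ge> Suc (degree p)" for K
  proof -
    obtain c where "polyL2 p = (\<Sum>k<K. c k *\<^sub>R leg k)"
      using polyL2_in_span_leg[of p K] K by auto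
    then show ?thesis using norm_diff_leg_proj_le[of w K c] p by (simp add: norm_minus_commute)
  qed
  then show "\<exists>no. \<forall>K\<ge>no. norm (leg_proj K w - w) < e" by blast
qed

lemma parseval: "(\<lambda>k. (inner w (leg k))\<^sup>2) sums (norm w)\<^sup>2"
proof -
  have "(\<lambda>K. (norm (leg_proj K w))\<^sup>2) \<longlonglongrightarrow> (norm w)\<^sup>2"
    by (intro tendsto_intros leg_proj_tendsto)
  then show ?thesis by (simp add: sums_def norm_leg_proj)
qed

text \<open>The partial sums are Cauchy by orthonormality. The injection \<open>r\<close> admits the
  shift by one in \<open>noise\<close>, whose series omits the constant
  \<open>leg 0\<close>.\<close>

lemma riesz_fischer:
  assumes "summable (\<lambda>k. (c k)\<^sup>2)" "inj r"
  shows "summable (\<lambda>k. c k *\<^sub>R leg (r k))"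
  unfolding summable_Cauchy
proof (intro allI impI)
  fix e :: real assume e: "e > 0"
  then have "0 < e\<^sup>2" by simp
  then obtain N where N: "\<And>m n. m \<ge> N \<Longrightarrow> norm (\<Sum>k\<in>{m..<n}. (c k)\<^sup>2) < e\<^sup>2"
    using assms(1) unfolding summable_Cauchy by blast
  have "norm (\<Sum>k\<in>{m..<n}. c k *\<^sub>R leg (r k)) < e" if "m \<ge> N" for m n
  proof -
    have "inner (\<Sum>k\<in>{m..<n}. c k *\<^sub>R leg (r k)) (leg (r j)) = (if j \<in> {m..<n} then c j else 0)" for j
      using assms(2) by (simp add: inner_sum_left inner_leg inj_eq if_distrib[where f = "(*) _"] cong: if_cong)
    then have "(norm (\<Sum>k\<in>{m..<n}. c k *\<^sub>R leg (r k)))\<^sup>2 = (\<Sum>k\<in>{m..<n}. (c k)\<^sup>2)"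
      unfolding power2_norm_eq_inner inner_sum_right inner_scaleR_right by (simp add: power2_eq_square)
    also have "\<dots> < e\<^sup>2" using N[OF that, of n] by simp
    finally show ?thesis using e power2_less_imp_less[of _ e] by auto
  qed
  then show "\<exists>N. \<forall>m\<ge>N. \<forall>n. norm (\<Sum>k\<in>{m..<n}. c k *\<^sub>R leg (r k)) < e" by blast
qed

text \<open>\<open>adjoint\<close> is selected by description, so its identity follows only once
  some adjoint exists; the candidate is the orthogonal expansion \<open>A v\<close> with
  coefficients \<open>\<langle>v, G e_n\<rangle>\<close>.\<close>

lemma adjoint_blinfun_L2I:
  fixes G :: "L2I \<Rightarrow>\<^sub>L L2I"
  shows "inner (adjoint (blinfun_apply G) v) h = inner v (blinfun_apply G h)"
proof -
  define A where "A v = (\<Sum>n. inner v (blinfun_apply G (leg n)) *\<^sub>R leg n)" for v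
  have "inner (blinfun_apply G h) v = inner h (A v)" for v h
  proof -
    define y where "y N = (\<Sum>n<N. inner v (blinfun_apply G (leg n)) *\<^sub>R leg n)" for N
    let ?s = "\<lambda>N. \<Sum>n<N. (inner v (blinfun_apply G (leg n)))\<^sup>2"
    \<comment> \<open>Applying \<open>G\<close> to the partial sum \<open>y N\<close> itself gives
      \<open>norm (y N) ^ 2 = \<langle>v, G (y N)\<rangle>\<close>; cancelling one factor
      \<open>norm (y N)\<close> bounds all partial sums at once.\<close>
    have "?s N \<le> (norm v * norm G)\<^sup>2" for N
    proof -
      have y2: "?s N = (norm (y N))\<^sup>2"
        unfolding y_def by (simp add: norm_leg_sum)
      have "?s N = inner v (blinfun_apply G (y N))"
        by (simp add: y_def blinfun.bilinear_simps inner_sum_right power2_eq_square blinfun.sum_right)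
      also have "\<dots> \<le> norm v * (norm G * norm (y N))"
        by (rule order.trans[OF norm_cauchy_schwarz]) (simp add: mult_left_mono norm_blinfun)
      finally have "norm (y N) * norm (y N) \<le> norm v * norm G * norm (y N)"
        unfolding y2 by (simp add: power2_eq_square mult.assoc)
      then have "norm (y N) \<le> norm v * norm G"
        by (cases "norm (y N) = 0") auto
      then show ?thesis unfolding y2 by (intro power_mono) auto
    qed
    then have "summable (\<lambda>n. (inner v (blinfun_apply G (leg n)))\<^sup>2)"
      by (intro summableI_nonneg_bounded) auto
    then have "summable (\<lambda>n. inner v (blinfun_apply G (leg n)) *\<^sub>R leg n)"
      by (rule riesz_fischer) simp
    then have Av: "(\<lambda>n. inner v (blinfun_apply G (leg n)) *\<^sub>R leg n) sums A v"
      unfolding A_def by (rule summable_sums)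
    have "(\<lambda>K. inner v (blinfun_apply G (leg_proj K h))) \<longlonglongrightarrow> inner v (blinfun_apply G h)"
      by (intro tendsto_intros leg_proj_tendsto)
    moreover have "inner v (blinfun_apply G (leg_proj K h)) = inner h (\<Sum>n<K. inner v (blinfun_apply G (leg n)) *\<^sub>R leg n)" for K
      by (simp add: leg_proj_def blinfun.bilinear_simps inner_sum_right blinfun.sum_right mult.commute)
    moreover have "(\<lambda>K. inner h (\<Sum>n<K. inner v (blinfun_apply G (leg n)) *\<^sub>R leg n)) \<longlonglongrightarrow> inner h (A v)"
      using Av unfolding sums_def by (intro tendsto_intros)
    ultimately show ?thesis
      using LIMSEQ_unique by (simp add: inner_commute)
  qed
  then have "\<exists>f'. \<forall>x y. inner (blinfun_apply G x) y = inner x (f' y)" by blast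
  then have "\<forall>x y. inner (blinfun_apply G x) y = inner x (adjoint (blinfun_apply G) y)"
    unfolding adjoint_def by (rule someI_ex)
  then show ?thesis by (simp add: inner_commute)
qed

section \<open>Weak derivatives\<close>

lemma rho_measurable [measurable]: "rho \<in> borel_measurable I_meas"
  using poly_measurable_I[of rho_poly] by (simp add: poly_rho_poly[abs_def])

lemma rho_bounds: "x \<in> {-1<..<1} \<Longrightarrow> 0 < rho x \<and> rho x \<le> 1"
  by (auto simp: rho_def abs_square_less_1)

text \<open>At the kink \<open>z = 0\<close> the difference quotient is bounded by
  \<open>\<bar>h\<bar> ^ Suc k\<close>, which tends to zero because the exponent of the power is at
  least two.\<close>

lemma max_power_has_derivative:
  "((\<lambda>z. (max 0 z) ^ Suc (Suc k)) has_real_derivative real (Suc (Suc k)) * (max 0 z) ^ Suc k) (at z)"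
proof -
  consider "z < 0" | "z > 0" | "z = 0" by linarith
  then show ?thesis
  proof cases
    case 1
    have "((\<lambda>z. 0 :: real) has_real_derivative 0) (at z)" by simp
    then have "((\<lambda>z. (max 0 z) ^ Suc (Suc k)) has_real_derivative 0) (at z)"
      by (rule has_field_derivative_transform_within_open[where S = "{..<0}"]) (use 1 in auto)
    then show ?thesis using 1 by simp
  next
    case 2
    have "((\<lambda>z. z ^ Suc (Suc k)) has_real_derivative real (Suc (Suc k)) * z ^ Suc k) (at z)"
      using DERIV_pow[of "Suc (Suc k)" z] by simp
    then have "((\<lambda>z. (max 0 z) ^ Suc (Suc k)) has_real_derivative real (Suc (Suc k)) * z ^ Suc k) (at z)"
      by (rule has_field_derivative_transform_within_open[where S = "{0<..}"]) (use 2 in auto)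
    then show ?thesis using 2 by simp
  next
    case 3
    have "((\<lambda>h :: real. (max 0 h) ^ Suc (Suc k) / h) \<longlongrightarrow> 0) (at 0)"
    proof (rule Lim_null_comparison)
      show "\<forall>\<^sub>F h in at 0. norm ((max 0 h) ^ Suc (Suc k) / h) \<le> \<bar>h :: real\<bar> ^ Suc k"
        by (rule eventually_at_ball'[of 1, THEN eventually_mono]) (auto simp: max_def mult_nonpos_nonneg)
      show "((\<lambda>h::real. \<bar>h\<bar> ^ Suc k) \<longlongrightarrow> 0) (at 0)"
        by (rule tendsto_eq_intros refl)+ auto
    qed
    then show ?thesis by (simp add: DERIV_def 3)
  qed
qed

text \<open>A \<open>C\<^sup>1\<close> approximation of \<open>rho\<close> from below by functions of compact support: \<open>y\<^sup>3 / (y\<^sup>2 + e)\<close>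
  tends to \<open>y\<close>, and for \<open>y\<close> the positive part of \<open>1 - e - x\<^sup>2\<close> it is differentiable where \<open>y\<close> vanishes.\<close>

definition bump :: "real \<Rightarrow> real \<Rightarrow> real" where
  "bump e x = (max 0 (1 - e - x\<^sup>2)) ^ 3 / ((max 0 (1 - e - x\<^sup>2))\<^sup>2 + e)"

definition bump_deriv :: "real \<Rightarrow> real \<Rightarrow> real" where
  "bump_deriv e x = ((max 0 (1 - e - x\<^sup>2)) ^ 4 + 3 * e * (max 0 (1 - e - x\<^sup>2))\<^sup>2)
      / ((max 0 (1 - e - x\<^sup>2))\<^sup>2 + e)\<^sup>2 * (- 2 * x)"

lemma bump_has_derivative:
  assumes "e > 0"
  shows "(bump e has_real_derivative bump_deriv e x) (at x)"
proof -
  let ?y = "max 0 (1 - e - x\<^sup>2)"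
  have "((\<lambda>x. 1 - e - x\<^sup>2) has_real_derivative (- 2 * x)) (at x)"
    by (auto intro!: derivative_eq_intros)
  note chain = DERIV_chain2[OF _ this]
  have 3: "((\<lambda>x. (max 0 (1 - e - x\<^sup>2)) ^ 3) has_real_derivative 3 * ?y\<^sup>2 * (- 2 * x)) (at x)"
    using chain[OF max_power_has_derivative[of 1]] by (simp add: numeral_eq_Suc)
  have 2: "((\<lambda>x. (max 0 (1 - e - x\<^sup>2))\<^sup>2) has_real_derivative 2 * ?y * (- 2 * x)) (at x)"
    using chain[OF max_power_has_derivative[of 0]] by (simp add: numeral_eq_Suc)
  have nz: "?y\<^sup>2 + e \<noteq> 0" using assms by (smt (verit) zero_le_power2)
  have "(bump e has_real_derivative
     (3 * ?y\<^sup>2 * (- 2 * x) * (?y\<^sup>2 + e) - ?y ^ 3 * (2 * ?y * (- 2 * x) + 0)) / ((?y\<^sup>2 + e) * (?y\<^sup>2 + e))) (at x)"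
    unfolding bump_def[abs_def] by (intro DERIV_divide 3 DERIV_add 2 DERIV_const nz)
  also have "(3 * ?y\<^sup>2 * (- 2 * x) * (?y\<^sup>2 + e) - ?y ^ 3 * (2 * ?y * (- 2 * x) + 0)) / ((?y\<^sup>2 + e) * (?y\<^sup>2 + e)) = bump_deriv e x"
    unfolding bump_deriv_def power2_eq_square[of "?y\<^sup>2 + e"] times_divide_eq_left
    by (rule arg_cong[where f = "\<lambda>z. z / _"]) (simp add: algebra_simps eval_nat_numeral)
  finally show ?thesis .
qed

lemma bump_deriv_continuous:
  assumes "e > 0"
  shows "continuous_on A (bump_deriv e)"
proof -
  have "(max 0 (1 - e - x\<^sup>2))\<^sup>2 + e \<noteq> 0" for x using assms by (smt (verit) zero_le_power2)
  then show ?thesis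
    unfolding bump_deriv_def[abs_def] by (intro continuous_intros) auto
qed

text \<open>The bounds are independent of \<open>e\<close>, as dominated convergence for
  \<open>e \<rightarrow> 0\<close> requires. The constant \<open>4\<close> is \<open>2\<close> for
  the quotient times \<open>2\<close> for \<open>\<bar>2 x\<bar>\<close>.\<close>

lemma bump_bounds:
  assumes "e > 0" "x \<in> {-1<..<1}"
  shows "0 \<le> bump e x" "bump e x \<le> rho x" "\<bar>bump_deriv e x\<bar> \<le> 4"
proof -
  let ?y = "max 0 (1 - e - x\<^sup>2)"
  have y: "0 \<le> ?y" by simp
  have p: "0 < ?y\<^sup>2 + e" using assms by (smt (verit) zero_le_power2)
  show "0 \<le> bump e x" unfolding bump_def using p by auto
  have "?y ^ 3 \<le> ?y * (?y\<^sup>2 + e)" using assms y by (simp add: algebra_simps eval_nat_numeral)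
  then have "bump e x \<le> ?y" unfolding bump_def using p by (simp add: divide_le_eq)
  also have "\<dots> \<le> rho x" using assms rho_bounds[of x] by (auto simp: rho_def)
  finally show "bump e x \<le> rho x" .
  have "?y ^ 4 + 3 * e * ?y\<^sup>2 \<le> 2 * (?y\<^sup>2 + e)\<^sup>2"
    using assms(1) by (auto simp: power2_sum algebra_simps eval_nat_numeral)
  then have "(?y ^ 4 + 3 * e * ?y\<^sup>2) / (?y\<^sup>2 + e)\<^sup>2 \<le> 2"
    using p by (simp add: divide_le_eq)
  moreover have "0 \<le> (?y ^ 4 + 3 * e * ?y\<^sup>2) / (?y\<^sup>2 + e)\<^sup>2" using assms(1) by auto
  moreover have "\<bar>- 2 * x\<bar> \<le> 2" using assms(2) by auto
  ultimately have "\<bar>(?y ^ 4 + 3 * e * ?y\<^sup>2) / (?y\<^sup>2 + e)\<^sup>2\<bar> * \<bar>- 2 * x\<bar> \<le> 2 * 2"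
    by (intro mult_mono) (auto simp only: abs_of_nonneg)
  then show "\<bar>bump_deriv e x\<bar> \<le> 4" by (simp add: bump_deriv_def abs_mult)
qed

lemma bump_pos:
  assumes "e > 0" "x\<^sup>2 < 1 - e"
  shows "bump e x > 0"
proof -
  have "0 < (max 0 (1 - e - x\<^sup>2))\<^sup>2 + e" using assms by (smt (verit) zero_le_power2)
  moreover have "max 0 (1 - e - x\<^sup>2) > 0" using assms by auto
  ultimately show ?thesis by (simp add: bump_def)
qed

text \<open>\<open>(1 - e/2)^2\<close> exceeds \<open>1 - e\<close>, so the positive part vanishes
  before the end points are reached; this leaves the room that compact support inside
  \<open>(-1,1)\<close> requires.\<close>

lemma bump_eq_0:
  assumes "0 < e" "e < 1" "x \<notin> {- (1 - e/2)..1 - e/2}"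
  shows "bump e x = 0"
proof -
  have "1 - e/2 \<le> \<bar>x\<bar>" using assms(3) by auto
  then have "(1 - e/2)\<^sup>2 \<le> x\<^sup>2" using assms abs_le_square_iff[of "1 - e/2" x] by auto
  moreover have "(1 - e/2)\<^sup>2 = 1 - e + e\<^sup>2/4" by (simp add: power2_eq_square field_simps)
  moreover have "0 \<le> e\<^sup>2/4" by simp
  ultimately have "1 - e - x\<^sup>2 \<le> 0" by linarith
  then show ?thesis by (simp add: bump_def max_def)
qed

lemma test_function_bump_poly:
  assumes "0 < e" "e < 1"
  shows "test_function (\<lambda>x. bump e x * poly p x)"
    and "deriv (\<lambda>x. bump e x * poly p x) x = bump_deriv e x * poly p x + bump e x * poly (pderiv p) x"
proof -
  have d: "((\<lambda>x. bump e x * poly p x) has_real_derivative bump_deriv e x * poly p x + bump e x * poly (pderiv p) x) (at x)" for x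
    using DERIV_mult[OF bump_has_derivative[OF assms(1)] poly_DERIV[of p]] by (simp add: mult.commute add.commute)
  then show "deriv (\<lambda>x. bump e x * poly p x) x = bump_deriv e x * poly p x + bump e x * poly (pderiv p) x"
    by (rule DERIV_imp_deriv)
  have "continuous_on UNIV (bump e)"
    using bump_has_derivative[OF assms(1)] DERIV_continuous_on by blast
  then have "continuous_on UNIV (\<lambda>x. bump_deriv e x * poly p x + bump e x * poly (pderiv p) x)"
    by (intro continuous_intros bump_deriv_continuous assms)
  then have "(\<lambda>x. bump e x * poly p x) C1_differentiable_on UNIV"
    unfolding C1_differentiable_on_def using d
    by (intro exI[of _ "\<lambda>x. bump_deriv e x * poly p x + bump e x * poly (pderiv p) x"])
      (simp add: has_real_derivative_iff_has_vector_derivative)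
  moreover have "\<exists>a b. -1 < a \<and> b < 1 \<and> (\<forall>x. x \<notin> {a..b} \<longrightarrow> bump e x * poly p x = 0)"
    using bump_eq_0[OF assms] assms by (intro exI[of _ "- (1 - e/2)"] exI[of _ "1 - e/2"]) auto
  ultimately show "test_function (\<lambda>x. bump e x * poly p x)"
    unfolding test_function_def by blast
qed

text \<open>Starting at \<open>1/2\<close> keeps every value strictly inside \<open>(0,1)\<close>,
  the range in which \<open>bump\<close> yields test functions.\<close>

abbreviation eps :: "nat \<Rightarrow> real" where "eps n \<equiv> 1 / (real n + 2)"

lemma eps_tendsto: "eps \<longlonglongrightarrow> 0"
  using LIMSEQ_ignore_initial_segment[OF LIMSEQ_inverse_real_of_nat, of 1]
  by (simp add: inverse_eq_divide algebra_simps)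

lemma bump_tendsto:
  assumes "x \<in> {-1<..<1}"
  shows "(\<lambda>n. bump (eps n) x) \<longlonglongrightarrow> rho x" "(\<lambda>n. bump_deriv (eps n) x) \<longlonglongrightarrow> - 2 * x"
proof -
  let ?y = "max 0 (1 - 0 - x\<^sup>2)"
  have y: "?y = rho x" "rho x > 0" using rho_bounds[OF assms] by (auto simp: rho_def)
  then have nz: "?y\<^sup>2 + 0 \<noteq> 0" by simp
  have "(\<lambda>n. bump (eps n) x) \<longlonglongrightarrow> ?y ^ 3 / (?y\<^sup>2 + 0)"
    unfolding bump_def by (intro tendsto_intros eps_tendsto nz)
  then show "(\<lambda>n. bump (eps n) x) \<longlonglongrightarrow> rho x"
    unfolding y using y(2) by (simp add: eval_nat_numeral)
  have "(\<lambda>n. bump_deriv (eps n) x) \<longlonglongrightarrow> (?y ^ 4 + 3 * 0 * ?y\<^sup>2) / (?y\<^sup>2 + 0)\<^sup>2 * (- 2 * x)"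
    unfolding bump_deriv_def using nz by (intro tendsto_intros eps_tendsto) auto
  then show "(\<lambda>n. bump_deriv (eps n) x) \<longlonglongrightarrow> - 2 * x"
    unfolding y using y(2) by (simp add: eval_nat_numeral)
qed

lemma eps_bounds: "0 < eps n" "eps n < 1" by auto

text \<open>Local integrability gives measurability on compact subintervals; cut-offs to an
  exhausting sequence of these converge pointwise.\<close>

lemma has_weak_deriv_measurable:
  assumes "has_weak_deriv w d"
  shows "d \<in> borel_measurable I_meas"
proof (rule borel_measurable_LIMSEQ_real)
  let ?A = "\<lambda>n. {- (1 - eps n)..1 - eps n}"
  show "(\<lambda>n. if x \<in> ?A n then d x else 0) \<longlonglongrightarrow> d x" if "x \<in> space I_meas" for x
  proof -
    have "\<forall>\<^sub>F n in sequentially. eps n < 1 - \<bar>x\<bar>"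
      using order_tendstoD(2)[OF eps_tendsto] that by auto
    then have "\<forall>\<^sub>F n in sequentially. (if x \<in> ?A n then d x else 0) = d x"
      by eventually_elim auto
    then show ?thesis by (rule tendsto_eventually)
  qed
  show "(\<lambda>x. if x \<in> ?A n then d x else 0) \<in> borel_measurable I_meas" for n
  proof -
    have "integrable (lebesgue_on (?A n)) d"
      using assms eps_bounds[of n] by (auto simp: has_weak_deriv_def)
    then have "d \<in> borel_measurable (lebesgue_on (?A n))" by auto
    then have "(\<lambda>x. if x \<in> ?A n then d x else 0) \<in> borel_measurable lebesgue"
      by (subst borel_measurable_if) auto
    then show ?thesis by (rule measurable_restrict_space1)
  qed
qed

lemma test_function_facts:
  assumes "test_function \<phi>"
  shows "\<phi> \<in> borel_measurable I_meas" "deriv \<phi> \<in> borel_measurable I_meas"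
    "\<exists>C. \<forall>x\<in>{-1<..<1}. \<bar>\<phi> x\<bar> \<le> C \<and> \<bar>deriv \<phi> x\<bar> \<le> C"
    "\<And>x. (\<phi> has_real_derivative deriv \<phi> x) (at x)" "\<phi> 1 = 0" "\<phi> (-1) = 0"
    "continuous_on UNIV (deriv \<phi>)"
proof -
  obtain D where D: "\<And>x. (\<phi> has_real_derivative D x) (at x)" "continuous_on UNIV D"
    using assms unfolding test_function_def C1_differentiable_on_def
    by (auto simp: has_real_derivative_iff_has_vector_derivative)
  then have [simp]: "deriv \<phi> = D" using DERIV_imp_deriv by blast
  show "\<And>x. (\<phi> has_real_derivative deriv \<phi> x) (at x)" using D by simp
  have c: "continuous_on UNIV \<phi>" using D(1) DERIV_continuous_on by blast
  show "continuous_on UNIV (deriv \<phi>)" using D by simp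
  have "\<phi> \<in> borel_measurable borel" "D \<in> borel_measurable borel"
    using c D(2) by (auto intro: borel_measurable_continuous_onI)
  then show "\<phi> \<in> borel_measurable I_meas" "deriv \<phi> \<in> borel_measurable I_meas"
    by (auto intro!: measurable_restrict_space1 simp: measurable_completion)
  show "\<phi> 1 = 0" "\<phi> (-1) = 0" using assms unfolding test_function_def by force+
  have "compact (\<phi> ` {-1..1})" "compact (D ` {-1..1})"
    by (auto intro!: compact_continuous_image intro: continuous_on_subset c D(2))
  then have "bounded (\<phi> ` {-1..1} \<union> D ` {-1..1})" by (auto intro: compact_imp_bounded)
  then obtain C where "\<forall>y\<in>\<phi> ` {-1..1} \<union> D ` {-1..1}. \<bar>y\<bar> \<le> C" by (auto simp: bounded_iff)
  then show "\<exists>C. \<forall>x\<in>{-1<..<1}. \<bar>\<phi> x\<bar> \<le> C \<and> \<bar>deriv \<phi> x\<bar> \<le> C"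
    by (intro exI[of _ C]) auto
qed

text \<open>\<open>d\<close> is only locally integrable, but \<open>\<phi>\<close> is bounded and
  vanishes outside a compact subinterval.\<close>

lemma integrable_weak_deriv_test:
  assumes d: "has_weak_deriv w d" and \<phi>: "test_function \<phi>"
  shows "integrable I_meas (\<lambda>x. d x * \<phi> x)"
proof -
  obtain a b where ab: "-1 < a" "b < 1" "\<And>x. x \<notin> {a..b} \<Longrightarrow> \<phi> x = 0"
    using \<phi> unfolding test_function_def by blast
  obtain C where C: "\<And>x. x \<in> {-1<..<1} \<Longrightarrow> \<bar>\<phi> x\<bar> \<le> C" using test_function_facts(3)[OF \<phi>] by blast
  have "integrable (lebesgue_on {a..b}) d" using d ab by (auto simp: has_weak_deriv_def)
  then have "integrable lebesgue (\<lambda>x. indicator {a..b} x *\<^sub>R d x)"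
    by (simp add: integrable_restrict_space)
  then have "integrable lebesgue (\<lambda>x. indicator {-1<..<1} x *\<^sub>R (indicator {a..b} x *\<^sub>R d x))"
    by (rule integrable_mult_indicator[rotated]) auto
  then have i: "integrable I_meas (\<lambda>x. C * (indicator {a..b} x *\<^sub>R d x))"
    by (simp add: integrable_restrict_space)
  show ?thesis
  proof (rule Bochner_Integration.integrable_bound[OF i])
    show "(\<lambda>x. d x * \<phi> x) \<in> borel_measurable I_meas"
      using has_weak_deriv_measurable[OF d] test_function_facts(1)[OF \<phi>] by simp
    show "AE x in I_meas. norm (d x * \<phi> x) \<le> norm (C * (indicator {a..b} x *\<^sub>R d x))"
    proof (rule AE_I2)
      fix x :: real assume "x \<in> space I_meas"
      then have "\<bar>\<phi> x\<bar> \<le> \<bar>C\<bar>" using C[of x] by auto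
      then show "norm (d x * \<phi> x) \<le> norm (C * (indicator {a..b} x *\<^sub>R d x))"
        using ab(3)[of x] mult_right_mono[of "\<bar>\<phi> x\<bar>" "\<bar>C\<bar>" "\<bar>d x\<bar>"]
        by (auto simp: abs_mult indicator_def mult.commute)
    qed
  qed
qed

text \<open>The fundamental lemma of the calculus of variations. Boundedly convergent polynomial
  approximations of \<open>sgn h\<close>, multiplied by a bump, yield
  \<open>\<integral> bump \<bar>h\<bar> = 0\<close>; every point of the interval lies where some
  bump of the sequence is positive.\<close>

lemma has_weak_deriv_unique:
  assumes d1: "has_weak_deriv w d1" and d2: "has_weak_deriv w d2"
  shows "AE x in I_meas. d1 x = d2 x"
proof -
  define h where "h x = d1 x - d2 x" for x
  have [measurable]: "h \<in> borel_measurable I_meas"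
    unfolding h_def using assms[THEN has_weak_deriv_measurable] by simp
  have bm [measurable]: "bump (eps n) \<in> borel_measurable I_meas" for n
    using test_function_facts(1)[OF test_function_bump_poly(1)[OF eps_bounds, of n 1]] by simp
  have i: "integrable I_meas (\<lambda>x. h x * (bump (eps n) x * poly p x))" for n p
    unfolding h_def left_diff_distrib
    using integrable_weak_deriv_test[OF d1 test_function_bump_poly(1)[OF eps_bounds]]
      integrable_weak_deriv_test[OF d2 test_function_bump_poly(1)[OF eps_bounds]]
    by (intro Bochner_Integration.integrable_diff)
  have z: "integral\<^sup>L I_meas (\<lambda>x. h x * (bump (eps n) x * poly p x)) = 0" for n p
  proof -
    have "integral\<^sup>L I_meas (\<lambda>x. d1 x * (bump (eps n) x * poly p x)) = integral\<^sup>L I_meas (\<lambda>x. d2 x * (bump (eps n) x * poly p x))"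
      using assms test_function_bump_poly(1)[OF eps_bounds, of n p] unfolding has_weak_deriv_def by fastforce
    then show ?thesis unfolding h_def left_diff_distrib
      using integrable_weak_deriv_test[OF d1 test_function_bump_poly(1)[OF eps_bounds]]
        integrable_weak_deriv_test[OF d2 test_function_bump_poly(1)[OF eps_bounds]]
      by (subst Bochner_Integration.integral_diff) auto
  qed
  have "\<bar>sgn (h x)\<bar> \<le> 1" for x by (simp add: sgn_real_def)
  then obtain p where p: "\<And>m x. x \<in> {-1..1} \<Longrightarrow> \<bar>poly (p m) x\<bar> \<le> 2" "AE x in I_meas. (\<lambda>m. poly (p m) x) \<longlonglongrightarrow> sgn (h x)"
    using bounded_approx_poly[of "\<lambda>x. sgn (h x)" 1] by force
  have "AE x in I_meas. h x * (bump (eps n) x * sgn (h x)) = 0" for n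
  proof -
    have i1: "integrable I_meas (\<lambda>x. 2 * \<bar>h x * bump (eps n) x\<bar>)"
      using integrable_norm[OF i[of n 1]] by simp
    have "(\<lambda>m. integral\<^sup>L I_meas (\<lambda>x. h x * (bump (eps n) x * poly (p m) x)))
       \<longlonglongrightarrow> integral\<^sup>L I_meas (\<lambda>x. h x * (bump (eps n) x * sgn (h x)))"
    proof (rule integral_dominated_convergence[OF _ _ i1])
      show "AE x in I_meas. (\<lambda>m. h x * (bump (eps n) x * poly (p m) x)) \<longlonglongrightarrow> h x * (bump (eps n) x * sgn (h x))"
        using p(2) by eventually_elim (intro tendsto_intros)
      show "AE x in I_meas. norm (h x * (bump (eps n) x * poly (p m) x)) \<le> 2 * \<bar>h x * bump (eps n) x\<bar>" for m
      proof (rule AE_I2)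
        fix x :: real assume "x \<in> space I_meas"
        then have "\<bar>poly (p m) x\<bar> \<le> 2" using p(1)[of x m] by auto
        from mult_left_mono[OF this, of "\<bar>h x * bump (eps n) x\<bar>"]
        show "norm (h x * (bump (eps n) x * poly (p m) x)) \<le> 2 * \<bar>h x * bump (eps n) x\<bar>"
          by (simp add: abs_mult mult_ac)
      qed
    qed measurable
    then have "integral\<^sup>L I_meas (\<lambda>x. h x * (bump (eps n) x * sgn (h x))) = 0"
      unfolding z using LIMSEQ_unique tendsto_const by blast
    moreover have "AE x in I_meas. 0 \<le> h x * (bump (eps n) x * sgn (h x))"
    proof (rule AE_I2)
      fix x :: real assume "x \<in> space I_meas"
      then have "0 \<le> bump (eps n) x" using bump_bounds(1)[OF eps_bounds(1)] by auto
      then show "0 \<le> h x * (bump (eps n) x * sgn (h x))"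
        by (auto simp: sgn_real_def zero_le_mult_iff mult_le_0_iff)
    qed
    moreover have "integrable I_meas (\<lambda>x. h x * (bump (eps n) x * sgn (h x)))"
      by (rule Bochner_Integration.integrable_bound[OF i1])
        (measurable, auto simp: sgn_real_def abs_mult)
    ultimately show ?thesis
      using integral_nonneg_eq_0_iff_AE by blast
  qed
  then have "AE x in I_meas. \<forall>n. h x * (bump (eps n) x * sgn (h x)) = 0"
    unfolding AE_all_countable by blast
  then show ?thesis using AE_I
  proof eventually_elim
    case (elim x)
    then have "x\<^sup>2 < 1" by (simp add: abs_square_less_1 abs_less_iff)
    then have "\<forall>\<^sub>F n in sequentially. eps n < 1 - x\<^sup>2"
      using order_tendstoD(2)[OF eps_tendsto] by auto
    then obtain n where "eps n < 1 - x\<^sup>2"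
      by (meson eventually_happens sequentially_bot trivial_limit_sequentially)
    then have "bump (eps n) x > 0" by (intro bump_pos eps_bounds) linarith
    moreover have "h x * (bump (eps n) x * sgn (h x)) = 0" using elim by blast
    ultimately have "h x = 0" by (auto simp: sgn_real_def split: if_splits)
    then show ?case by (simp add: h_def)
  qed
qed

lemma integrable_rho_mult:
  assumes [measurable]: "d \<in> borel_measurable I_meas" "e \<in> borel_measurable I_meas"
    and "integrable I_meas (\<lambda>x. rho x * (d x)\<^sup>2)" "integrable I_meas (\<lambda>x. rho x * (e x)\<^sup>2)"
  shows "integrable I_meas (\<lambda>x. rho x * d x * e x)"
proof (rule Bochner_Integration.integrable_bound[where f = "\<lambda>x. rho x * (d x)\<^sup>2 + rho x * (e x)\<^sup>2"])
  show "AE x in I_meas. norm (rho x * d x * e x) \<le> norm (rho x * (d x)\<^sup>2 + rho x * (e x)\<^sup>2)"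
  proof (rule AE_I2)
    fix x :: real assume "x \<in> space I_meas"
    then have r: "0 \<le> rho x" using rho_bounds[of x] by auto
    have "0 \<le> (\<bar>d x\<bar> - \<bar>e x\<bar>)\<^sup>2" by simp
    then have "2 * (\<bar>d x\<bar> * \<bar>e x\<bar>) \<le> (d x)\<^sup>2 + (e x)\<^sup>2" by (simp add: power2_diff)
    then have "\<bar>d x\<bar> * \<bar>e x\<bar> \<le> (d x)\<^sup>2 + (e x)\<^sup>2" using abs_ge_zero[of "d x * e x"] unfolding abs_mult by linarith
    from mult_left_mono[OF this r] show "norm (rho x * d x * e x) \<le> norm (rho x * (d x)\<^sup>2 + rho x * (e x)\<^sup>2)"
      using r by (simp add: abs_mult algebra_simps)
  qed
qed (use assms in auto)

text \<open>\<open>rho p\<close> vanishes only at the end points and is not a test function in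
  general; \<open>bump p\<close> is, and the limit is taken on both sides. The finite weighted
  energy of \<open>d\<close> supplies the majorant on the right.\<close>

lemma weak_deriv_parts:
  assumes w: "square_integrable w" and d: "has_weak_deriv w d" and int: "integrable I_meas (\<lambda>x. rho x * (d x)\<^sup>2)"
  shows "integral\<^sup>L I_meas (\<lambda>x. w x * poly (pderiv (rho_poly * p)) x) = - integral\<^sup>L I_meas (\<lambda>x. rho x * d x * poly p x)"
proof -
  have [measurable]: "d \<in> borel_measurable I_meas" "w \<in> borel_measurable I_meas"
    using has_weak_deriv_measurable[OF d] w by (auto simp: square_integrable_def)
  have bm [measurable]: "bump (eps n) \<in> borel_measurable I_meas" for n
    using test_function_facts(1)[OF test_function_bump_poly(1)[OF eps_bounds, of n 1]] by simp
  have bm' [measurable]: "bump_deriv (eps n) \<in> borel_measurable I_meas" for n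
    using integrable_I_continuous[OF bump_deriv_continuous[OF eps_bounds(1)], of n] by (simp add: integrable_iff_bounded)
  have [measurable]: "(\<lambda>x. x) \<in> borel_measurable I_meas"
    using poly_measurable_I[of "[:0, 1:]"] by (simp add: poly_pCons[abs_def])
  have one: "square_integrable (\<lambda>x. 1)" using square_integrable_poly[of 1] by (simp add: poly_1[abs_def])
  obtain C where C: "\<And>x. x \<in> {-1..1} \<Longrightarrow> \<bar>poly p x\<bar> \<le> C \<and> \<bar>poly (pderiv p) x\<bar> \<le> C"
  proof -
    have "compact (poly p ` {-1..1})" "compact (poly (pderiv p) ` {-1..1})"
      by (auto intro!: compact_continuous_image continuous_intros)
    then have "bounded (poly p ` {-1..1} \<union> poly (pderiv p) ` {-1..1})" by (auto intro: compact_imp_bounded)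
    then obtain C where "\<forall>y\<in>poly p ` {-1..1} \<union> poly (pderiv p) ` {-1..1}. \<bar>y\<bar> \<le> C" by (auto simp: bounded_iff)
    then show ?thesis by (intro that[of C]) auto
  qed
  have eq: "integral\<^sup>L I_meas (\<lambda>x. w x * (bump_deriv (eps n) x * poly p x + bump (eps n) x * poly (pderiv p) x)) =
      - integral\<^sup>L I_meas (\<lambda>x. d x * (bump (eps n) x * poly p x))" for n
    using d test_function_bump_poly[OF eps_bounds, of n p] unfolding has_weak_deriv_def by auto
  have "(\<lambda>n. integral\<^sup>L I_meas (\<lambda>x. w x * (bump_deriv (eps n) x * poly p x + bump (eps n) x * poly (pderiv p) x)))
     \<longlonglongrightarrow> integral\<^sup>L I_meas (\<lambda>x. w x * (- 2 * x * poly p x + rho x * poly (pderiv p) x))"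
  \<comment> \<open>\<open>5 * C\<close> collects \<open>4 * C\<close> from the derivative of the
    bump and \<open>C\<close> from the bump itself; \<open>\<bar>w\<bar>\<close> is integrable
    because the interval is bounded.\<close>
  proof (rule integral_dominated_convergence[where w = "\<lambda>x. 5 * C * \<bar>w x * 1\<bar>"])
    show "integrable I_meas (\<lambda>x. 5 * C * \<bar>w x * 1\<bar>)"
      by (intro integrable_mult_right integrable_abs square_integrable_mult w one)
    show "AE x in I_meas. (\<lambda>n. w x * (bump_deriv (eps n) x * poly p x + bump (eps n) x * poly (pderiv p) x)) \<longlonglongrightarrow>
        w x * (- 2 * x * poly p x + rho x * poly (pderiv p) x)"
      by (rule AE_I2) (intro tendsto_intros bump_tendsto, auto)
    show "AE x in I_meas. norm (w x * (bump_deriv (eps n) x * poly p x + bump (eps n) x * poly (pderiv p) x)) \<le> 5 * C * \<bar>w x * 1\<bar>" for n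
    proof (rule AE_I2)
      fix x :: real assume "x \<in> space I_meas"
      then have x: "x \<in> {-1<..<1}" by simp
      have "\<bar>bump_deriv (eps n) x\<bar> * \<bar>poly p x\<bar> \<le> 4 * C"
        using bump_bounds(3)[OF eps_bounds(1) x] C[of x] x by (intro mult_mono) auto
      moreover have "\<bar>bump (eps n) x\<bar> * \<bar>poly (pderiv p) x\<bar> \<le> 1 * C"
        using bump_bounds(1,2)[OF eps_bounds(1) x, of n] rho_bounds[OF x] C[of x] x by (intro mult_mono) auto
      ultimately have "\<bar>bump_deriv (eps n) x * poly p x + bump (eps n) x * poly (pderiv p) x\<bar> \<le> 5 * C"
        unfolding abs_mult[symmetric] by linarith
      from mult_left_mono[OF this, of "\<bar>w x\<bar>"]
      show "norm (w x * (bump_deriv (eps n) x * poly p x + bump (eps n) x * poly (pderiv p) x)) \<le> 5 * C * \<bar>w x * 1\<bar>"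
        by (simp add: abs_mult mult_ac)
    qed
  qed measurable
  moreover have "(\<lambda>n. - integral\<^sup>L I_meas (\<lambda>x. d x * (bump (eps n) x * poly p x)))
     \<longlonglongrightarrow> - integral\<^sup>L I_meas (\<lambda>x. d x * (rho x * poly p x))"
  \<comment> \<open>From \<open>bump \<le> rho\<close> and
    \<open>\<bar>d\<bar> \<le> d^2 + 1\<close>. The weight must stay in front of \<open>d^2\<close>,
    which by itself need not be integrable up to the end points.\<close>
  proof (rule tendsto_minus, rule integral_dominated_convergence[where w = "\<lambda>x. C * (rho x * (d x)\<^sup>2 + rho x)"])
    have "integrable I_meas rho"
      using integrable_I_poly'[of rho_poly] by (simp add: poly_rho_poly[abs_def])
    then show "integrable I_meas (\<lambda>x. C * (rho x * (d x)\<^sup>2 + rho x))"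
      using int by simp
    show "AE x in I_meas. (\<lambda>n. d x * (bump (eps n) x * poly p x)) \<longlonglongrightarrow> d x * (rho x * poly p x)"
      by (rule AE_I2) (intro tendsto_intros bump_tendsto, auto)
    show "AE x in I_meas. norm (d x * (bump (eps n) x * poly p x)) \<le> C * (rho x * (d x)\<^sup>2 + rho x)" for n
    proof (rule AE_I2)
      fix x :: real assume "x \<in> space I_meas"
      then have x: "x \<in> {-1<..<1}" by simp
      have "0 \<le> (\<bar>d x\<bar> - 1)\<^sup>2" by simp
      then have "2 * \<bar>d x\<bar> \<le> (d x)\<^sup>2 + 1" by (simp add: power2_diff)
      then have "\<bar>d x\<bar> \<le> (d x)\<^sup>2 + 1" using abs_ge_zero[of "d x"] by linarith
      moreover have "\<bar>bump (eps n) x\<bar> * \<bar>poly p x\<bar> \<le> rho x * C"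
        using bump_bounds(1,2)[OF eps_bounds(1) x, of n] rho_bounds[OF x] C[of x] x by (intro mult_mono) auto
      ultimately have "\<bar>d x\<bar> * (\<bar>bump (eps n) x\<bar> * \<bar>poly p x\<bar>) \<le> ((d x)\<^sup>2 + 1) * (rho x * C)"
        by (rule mult_mono) auto
      then show "norm (d x * (bump (eps n) x * poly p x)) \<le> C * (rho x * (d x)\<^sup>2 + rho x)"
        by (simp add: abs_mult algebra_simps)
    qed
  qed measurable
  ultimately have "integral\<^sup>L I_meas (\<lambda>x. w x * (- 2 * x * poly p x + rho x * poly (pderiv p) x)) =
      - integral\<^sup>L I_meas (\<lambda>x. d x * (rho x * poly p x))"
    unfolding eq by (rule LIMSEQ_unique)
  moreover have "poly (pderiv (rho_poly * p)) x = - 2 * x * poly p x + rho x * poly (pderiv p) x" for x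
    unfolding pderiv_mult poly_add poly_mult poly_rho_poly by (simp add: pderiv_pCons)
  ultimately show ?thesis by (simp only: mult_ac)
qed

section \<open>The space V\<close>

lemma has_weak_deriv_add:
  assumes "square_integrable v" "square_integrable w" "has_weak_deriv v d" "has_weak_deriv w e"
  shows "has_weak_deriv (\<lambda>x. v x + w x) (\<lambda>x. d x + e x)"
  unfolding has_weak_deriv_def
proof (intro conjI allI impI)
  show "integrable (lebesgue_on {a..b}) (\<lambda>x. d x + e x)" if "-1 < a \<and> b < 1" for a b
    using assms that by (auto simp: has_weak_deriv_def)
next
  fix \<phi> assume \<phi>: "test_function \<phi>"
  have i: "integrable I_meas (\<lambda>x. v x * deriv \<phi> x)" if "square_integrable v" for v
  proof (rule square_integrable_mult[OF that])
    have "(\<lambda>x. deriv \<phi> x * deriv \<phi> x) = (\<lambda>x. (deriv \<phi> x)\<^sup>2)" by (simp add: power2_eq_square)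
    moreover have "continuous_on {-1..1} (\<lambda>x. (deriv \<phi> x)\<^sup>2)"
      by (intro continuous_intros continuous_on_subset[OF test_function_facts(7)[OF \<phi>]]) auto
    ultimately show "square_integrable (deriv \<phi>)"
      unfolding square_integrable_def using test_function_facts(2)[OF \<phi>] integrable_I_continuous by blast
  qed
  show "integral\<^sup>L I_meas (\<lambda>x. (v x + w x) * deriv \<phi> x) = - integral\<^sup>L I_meas (\<lambda>x. (d x + e x) * \<phi> x)"
    using assms(3,4) \<phi> unfolding has_weak_deriv_def distrib_right
    by (simp add: Bochner_Integration.integral_add[OF i[OF assms(1)] i[OF assms(2)]]
        Bochner_Integration.integral_add[OF integrable_weak_deriv_test[OF assms(3) \<phi>] integrable_weak_deriv_test[OF assms(4) \<phi>]])
qed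

lemma has_weak_deriv_scale:
  assumes "has_weak_deriv w d"
  shows "has_weak_deriv (\<lambda>x. c * w x) (\<lambda>x. c * d x)"
  using assms unfolding has_weak_deriv_def mult.assoc by auto

text \<open>Passage between representatives: weak derivatives are attached to functions,
  \<open>V\<close> consists of classes.\<close>

lemma has_weak_deriv_cong_AE:
  assumes "has_weak_deriv v d" "v \<in> borel_measurable I_meas" "w \<in> borel_measurable I_meas"
    "AE x in I_meas. v x = w x"
  shows "has_weak_deriv w d"
proof -
  have "integral\<^sup>L I_meas (\<lambda>x. w x * deriv \<phi> x) = integral\<^sup>L I_meas (\<lambda>x. v x * deriv \<phi> x)" if "test_function \<phi>" for \<phi>
    using assms test_function_facts(2)[OF that] by (intro integral_cong_AE) auto
  then show ?thesis using assms(1) by (auto simp: has_weak_deriv_def)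
qed

lemma has_weak_deriv_poly: "has_weak_deriv (poly p) (poly (pderiv p))"
  unfolding has_weak_deriv_def
proof (intro conjI allI impI)
  show "integrable (lebesgue_on {a..b}) (poly (pderiv p))" for a b
    by (intro continuous_imp_integrable_real continuous_intros)
next
  fix \<phi> assume \<phi>: "test_function \<phi>"
  have c: "continuous_on A (deriv \<phi>)" "continuous_on A \<phi>" for A
    using continuous_on_subset[OF test_function_facts(7)[OF \<phi>]]
      DERIV_continuous_on[of A \<phi> "deriv \<phi>"] test_function_facts(4)[OF \<phi>]
    by (auto intro: has_field_derivative_at_within)
  have "integral\<^sup>L I_meas (\<lambda>x. poly p x * deriv \<phi> x + poly (pderiv p) x * \<phi> x) = poly p 1 * \<phi> 1 - poly p (-1) * \<phi> (-1)"
  proof (rule integral_I_FTC)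
    show "((\<lambda>x. poly p x * \<phi> x) has_real_derivative poly p x * deriv \<phi> x + poly (pderiv p) x * \<phi> x) (at x)" for x
      using DERIV_mult[OF poly_DERIV[of p x] test_function_facts(4)[OF \<phi>, of x]] by (simp add: mult_ac add.commute)
  qed (intro continuous_intros c)
  moreover have "integral\<^sup>L I_meas (\<lambda>x. poly p x * deriv \<phi> x + poly (pderiv p) x * \<phi> x) =
      integral\<^sup>L I_meas (\<lambda>x. poly p x * deriv \<phi> x) + integral\<^sup>L I_meas (\<lambda>x. poly (pderiv p) x * \<phi> x)"
    by (intro Bochner_Integration.integral_add integrable_I_continuous continuous_intros c)
  ultimately show "integral\<^sup>L I_meas (\<lambda>x. poly p x * deriv \<phi> x) = - integral\<^sup>L I_meas (\<lambda>x. poly (pderiv p) x * \<phi> x)"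
    using test_function_facts(5,6)[OF \<phi>] by simp
qed

text \<open>\<open>weak_deriv\<close> is an arbitrary choice, possibly different from the witness in
  \<open>V\<close>; uniqueness almost everywhere transfers the finite weighted energy.\<close>

lemma V_weak_deriv:
  assumes "w \<in> V"
  shows "has_weak_deriv (fun_of w) (weak_deriv w)"
    and "integrable I_meas (\<lambda>x. rho x * (weak_deriv w x)\<^sup>2)"
    and "weak_deriv w \<in> borel_measurable I_meas"
proof -
  obtain d where d: "has_weak_deriv (fun_of w) d" "integrable I_meas (\<lambda>x. rho x * (d x)\<^sup>2)"
    using assms by (auto simp: V_def)
  then show w: "has_weak_deriv (fun_of w) (weak_deriv w)"
    unfolding weak_deriv_def by (metis someI)
  then show [measurable]: "weak_deriv w \<in> borel_measurable I_meas"
    by (rule has_weak_deriv_measurable)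
  have [measurable]: "d \<in> borel_measurable I_meas" using d(1) by (rule has_weak_deriv_measurable)
  show "integrable I_meas (\<lambda>x. rho x * (weak_deriv w x)\<^sup>2)"
  proof (subst integrable_cong_AE)
    show "AE x in I_meas. rho x * (weak_deriv w x)\<^sup>2 = rho x * (d x)\<^sup>2"
      using has_weak_deriv_unique[OF w d(1)] by eventually_elim simp
  qed (use d(2) in measurable)
qed

lemma V_intro:
  assumes "has_weak_deriv (fun_of w) d" "integrable I_meas (\<lambda>x. rho x * (d x)\<^sup>2)"
  shows "w \<in> V" "AE x in I_meas. weak_deriv w x = d x"
proof -
  show "w \<in> V" using assms by (auto simp: V_def)
  then show "AE x in I_meas. weak_deriv w x = d x"
    using has_weak_deriv_unique[OF V_weak_deriv(1) assms(1)] by blast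
qed

lemma V_add:
  assumes v: "v \<in> V" and w: "w \<in> V"
  shows "v + w \<in> V" "AE x in I_meas. weak_deriv (v + w) x = weak_deriv v x + weak_deriv w x"
proof -
  have "has_weak_deriv (fun_of (v + w)) (\<lambda>x. weak_deriv v x + weak_deriv w x)"
    using fun_of_add[of v w]
    by (intro has_weak_deriv_cong_AE[OF has_weak_deriv_add[OF _ _ V_weak_deriv(1)[OF v] V_weak_deriv(1)[OF w]]]) (auto elim: eventually_mono)
  moreover have "integrable I_meas (\<lambda>x. rho x * (weak_deriv v x + weak_deriv w x)\<^sup>2)"
    using V_weak_deriv[OF v] V_weak_deriv[OF w] integrable_rho_mult[of "weak_deriv v" "weak_deriv w"]
    by (simp add: power2_sum distrib_left mult.assoc mult.left_commute[of _ 2])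
  ultimately show "v + w \<in> V" "AE x in I_meas. weak_deriv (v + w) x = weak_deriv v x + weak_deriv w x"
    by (rule V_intro)+
qed

lemma V_scaleR:
  assumes w: "w \<in> V"
  shows "c *\<^sub>R w \<in> V" "AE x in I_meas. weak_deriv (c *\<^sub>R w) x = c * weak_deriv w x"
proof -
  have "has_weak_deriv (fun_of (c *\<^sub>R w)) (\<lambda>x. c * weak_deriv w x)"
    using fun_of_scaleR[of c w]
    by (intro has_weak_deriv_cong_AE[OF has_weak_deriv_scale[OF V_weak_deriv(1)[OF w]]]) (auto elim: eventually_mono)
  moreover have "integrable I_meas (\<lambda>x. rho x * (c * weak_deriv w x)\<^sup>2)"
    using integrable_mult_right[OF V_weak_deriv(2)[OF w], of "c\<^sup>2"] by (simp add: power_mult_distrib mult.left_commute)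
  ultimately show "c *\<^sub>R w \<in> V" "AE x in I_meas. weak_deriv (c *\<^sub>R w) x = c * weak_deriv w x"
    by (rule V_intro)+
qed

lemma polyL2_V: "polyL2 p \<in> V" "AE x in I_meas. weak_deriv (polyL2 p) x = poly (pderiv p) x"
proof -
  have "has_weak_deriv (fun_of (polyL2 p)) (poly (pderiv p))"
    using fun_of_polyL2[of p]
    by (intro has_weak_deriv_cong_AE[OF has_weak_deriv_poly[of p]]) (auto elim: eventually_mono)
  moreover have "integrable I_meas (\<lambda>x. rho x * (poly (pderiv p) x)\<^sup>2)"
    using integrable_I_poly[of "rho_poly * (pderiv p)\<^sup>2"] unfolding poly_mult poly_rho_poly poly_power .
  ultimately show "polyL2 p \<in> V" "AE x in I_meas. weak_deriv (polyL2 p) x = poly (pderiv p) x"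
    by (rule V_intro)+
qed

lemma leg_V [simp]: "leg k \<in> V"
  by (simp add: leg_eq_polyL2 polyL2_V)

lemma V_0 [simp]: "0 \<in> V"
  using V_scaleR(1)[OF leg_V, of 0] by simp

lemma V_diff: "v \<in> V \<Longrightarrow> w \<in> V \<Longrightarrow> v - w \<in> V"
  using V_add(1)[of v "(-1) *\<^sub>R w"] V_scaleR(1)[of w "-1"] by simp

lemma V_sum: "(\<And>i. i \<in> A \<Longrightarrow> f i \<in> V) \<Longrightarrow> sum f A \<in> V"
  by (induction A rule: infinite_finite_induct) (auto intro: V_add(1))

lemma leg_sum_V: "(\<Sum>k<K. c k *\<^sub>R leg k) \<in> V"
  by (intro V_sum V_scaleR) simp

lemma leg_proj_V: "leg_proj K w \<in> V"
  unfolding leg_proj_def by (rule leg_sum_V)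

section \<open>The weighted Dirichlet form and its diagonalisation\<close>

lemma V_form_integrable:
  assumes "v \<in> V" "w \<in> V"
  shows "integrable I_meas (\<lambda>x. rho x * weak_deriv v x * weak_deriv w x)"
  using V_weak_deriv[OF assms(1)] V_weak_deriv[OF assms(2)] by (intro integrable_rho_mult) auto

lemma V_form_commute: "V_form v w = V_form w v"
  by (simp add: V_form_def mult_ac)

lemma V_form_add:
  assumes "v \<in> V" "w \<in> V" "z \<in> V"
  shows "V_form (v + w) z = V_form v z + V_form w z"
proof -
  have "V_form (v + w) z = integral\<^sup>L I_meas (\<lambda>x. rho x * weak_deriv v x * weak_deriv z x + rho x * weak_deriv w x * weak_deriv z x)"
    unfolding V_form_def
  proof (rule integral_cong_AE)
    show "AE x in I_meas. rho x * weak_deriv (v + w) x * weak_deriv z x =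
        rho x * weak_deriv v x * weak_deriv z x + rho x * weak_deriv w x * weak_deriv z x"
      using V_add(2)[OF assms(1,2)] by eventually_elim (simp add: algebra_simps)
  qed (use V_weak_deriv(3)[OF assms(1)] V_weak_deriv(3)[OF assms(2)] V_weak_deriv(3)[OF assms(3)]
      V_weak_deriv(3)[OF V_add(1)[OF assms(1,2)]] in measurable)
  then show ?thesis
    unfolding V_form_def by (simp add: V_form_integrable assms)
qed

lemma V_form_scaleR:
  assumes "v \<in> V" "z \<in> V"
  shows "V_form (c *\<^sub>R v) z = c * V_form v z"
proof -
  have "V_form (c *\<^sub>R v) z = integral\<^sup>L I_meas (\<lambda>x. c * (rho x * weak_deriv v x * weak_deriv z x))"
    unfolding V_form_def
  proof (rule integral_cong_AE)
    show "AE x in I_meas. rho x * weak_deriv (c *\<^sub>R v) x * weak_deriv z x = c * (rho x * weak_deriv v x * weak_deriv z x)"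
      using V_scaleR(2)[OF assms(1), of c] by eventually_elim (simp add: algebra_simps)
  qed (use V_weak_deriv(3)[OF assms(1)] V_weak_deriv(3)[OF assms(2)] V_weak_deriv(3)[OF V_scaleR(1)[OF assms(1)]] in measurable)
  then show ?thesis unfolding V_form_def by simp
qed

lemma V_form_diff:
  assumes "v \<in> V" "w \<in> V" "z \<in> V"
  shows "V_form (v - w) z = V_form v z - V_form w z"
  using V_form_add[OF assms(1) V_scaleR(1)[OF assms(2), of "-1"] assms(3)] V_form_scaleR[OF assms(2,3), of "-1"] by simp

lemma V_form_nonneg: "0 \<le> V_form w w"
  unfolding V_form_def
proof (rule integral_nonneg_AE, rule AE_I2)
  fix x :: real assume "x \<in> space I_meas"
  then have "0 \<le> rho x" using rho_bounds[of x] by auto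
  then show "0 \<le> rho x * weak_deriv w x * weak_deriv w x" by (simp add: mult.assoc)
qed

text \<open>One integration by parts moves the derivative of \<open>w\<close> onto
  \<open>rho e_k'\<close>, and Legendre's equation turns the result into a multiple of
  \<open>e_k\<close>. No boundary behaviour of \<open>w\<close> enters.\<close>

lemma V_form_leg:
  assumes "w \<in> V"
  shows "V_form w (leg k) = leg_eigenvalue k * inner w (leg k)"
proof -
  have "V_form w (leg k) = integral\<^sup>L I_meas (\<lambda>x. rho x * weak_deriv w x * poly (pderiv (leg_poly k)) x)"
    unfolding V_form_def
  proof (rule integral_cong_AE)
    show "AE x in I_meas. rho x * weak_deriv w x * weak_deriv (leg k) x = rho x * weak_deriv w x * poly (pderiv (leg_poly k)) x"
      using polyL2_V(2)[of "leg_poly k"] unfolding leg_eq_polyL2[symmetric] by eventually_elim simp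
  qed (use V_weak_deriv(3)[OF assms] V_weak_deriv(3)[OF leg_V] in measurable)
  also have "\<dots> = - integral\<^sup>L I_meas (\<lambda>x. fun_of w x * poly (pderiv (rho_poly * pderiv (leg_poly k))) x)"
    using weak_deriv_parts[OF fun_of_square_integrable V_weak_deriv(1,2)[OF assms]] by simp
  also have "pderiv (rho_poly * pderiv (leg_poly k)) = smult (- leg_eigenvalue k) (leg_poly k)"
    unfolding leg_poly_def pderiv_smult mult_smult_right legendre_ode by (simp add: mult.commute)
  also have "- integral\<^sup>L I_meas (\<lambda>x. fun_of w x * poly (smult (- leg_eigenvalue k) (leg_poly k)) x) =
      leg_eigenvalue k * integral\<^sup>L I_meas (\<lambda>x. poly (leg_poly k) x * fun_of w x)"
    by (simp add: mult_ac)
  also have "integral\<^sup>L I_meas (\<lambda>x. poly (leg_poly k) x * fun_of w x) = inner w (leg k)"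
    by (simp add: leg_eq_polyL2 inner_polyL2[symmetric] inner_commute)
  finally show ?thesis .
qed

lemma ex_poly_antiderivative: "\<exists>p. pderiv p = (q :: real poly)"
proof -
  have "\<exists>p. pderiv p = (\<Sum>i\<le>n. monom (a i) i)" for n and a :: "nat \<Rightarrow> real"
  proof (induction n)
    case 0
    have "pderiv (monom (a 0) 1) = monom (a 0) 0" by (simp add: pderiv_monom)
    then show ?case by auto
  next
    case (Suc n)
    then obtain p where "pderiv p = (\<Sum>i\<le>n. monom (a i) i)" by blast
    then have "pderiv (p + monom (a (Suc n) / real (Suc (Suc n))) (Suc (Suc n))) = (\<Sum>i\<le>Suc n. monom (a i) i)"
      by (simp add: pderiv_add pderiv_monom del: of_nat_Suc)
    then show ?case by blast
  qed
  from this[of "coeff q" "degree q"] show ?thesis by (simp add: poly_as_sum_of_monoms)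
qed

text \<open>The derivative is approximated in the weighted space and the approximation is
  integrated. The additive constant, and with it the distance in \<open>H\<close>, stays
  uncontrolled; the form does not see it.\<close>

lemma polyL2_dense_V:
  assumes w: "w \<in> V" and e: "e > 0"
  shows "\<exists>p. V_form (w - polyL2 p) (w - polyL2 p) < e"
proof -
  obtain q where q: "integral\<^sup>L I_meas (\<lambda>x. rho x * (weak_deriv w x - poly q x)\<^sup>2) < e"
    using weighted_poly_dense[OF rho_measurable V_weak_deriv(3)[OF w] _ V_weak_deriv(2)[OF w] e] rho_bounds
    by (meson less_imp_le)
  obtain p where p: "pderiv p = q" using ex_poly_antiderivative by blast
  note [measurable] = V_weak_deriv(3)[OF w] V_weak_deriv(3)[OF V_diff[OF w polyL2_V(1)[of p]]]
  have "V_form (w - polyL2 p) (w - polyL2 p) = integral\<^sup>L I_meas (\<lambda>x. rho x * (weak_deriv w x - poly q x)\<^sup>2)"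
    unfolding V_form_def
  proof (rule integral_cong_AE)
    show "AE x in I_meas. rho x * weak_deriv (w - polyL2 p) x * weak_deriv (w - polyL2 p) x = rho x * (weak_deriv w x - poly q x)\<^sup>2"
      using V_add(2)[OF w V_scaleR(1)[OF polyL2_V(1)[of p], of "-1"]] V_scaleR(2)[OF polyL2_V(1)[of p], of "-1"] polyL2_V(2)[of p]
      by eventually_elim (simp add: p power2_eq_square)
  qed measurable
  then show ?thesis using q by (intro exI[of _ p]) simp
qed

lemma V_form_leg_sum:
  assumes w: "w \<in> V"
  shows "V_form w (\<Sum>k<K. c k *\<^sub>R leg k) = (\<Sum>k<K. leg_eigenvalue k * c k * inner w (leg k))"
proof -
  have "V_form (\<Sum>k<K. c k *\<^sub>R leg k) w = (\<Sum>k<K. c k * V_form (leg k) w)"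
  proof (induction K)
    case 0
    show ?case using V_form_scaleR[OF leg_V w, of 0] by simp
  next
    case (Suc K)
    then show ?case
      using V_form_add[OF leg_sum_V V_scaleR(1)[OF leg_V] w] V_form_scaleR[OF leg_V w] by simp
  qed
  also have "\<dots> = (\<Sum>k<K. leg_eigenvalue k * c k * inner w (leg k))"
    unfolding V_form_commute[of "leg _" w] V_form_leg[OF w] by (simp add: mult_ac)
  finally show ?thesis by (subst V_form_commute)
qed

text \<open>Completing the square in the coefficients: both the optimal choice
  \<open>c k = \<langle>w, e_k\<rangle>\<close> and the excess of any other choice can be read
  off.\<close>

lemma V_form_diff_leg_sum:
  assumes w: "w \<in> V"
  shows "V_form (w - (\<Sum>k<K. c k *\<^sub>R leg k)) (w - (\<Sum>k<K. c k *\<^sub>R leg k)) =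
     V_form w w - (\<Sum>k<K. leg_eigenvalue k * (inner w (leg k))\<^sup>2) + (\<Sum>k<K. leg_eigenvalue k * (c k - inner w (leg k))\<^sup>2)"
proof -
  let ?p = "\<Sum>k<K. c k *\<^sub>R leg k"
  have "V_form (w - ?p) (w - ?p) = V_form w w - 2 * V_form w ?p + V_form ?p ?p"
    using V_form_diff[OF w leg_sum_V V_diff[OF w leg_sum_V], of c K c K]
      V_form_diff[OF w leg_sum_V w, of c K] V_form_diff[OF w leg_sum_V leg_sum_V, of c K c K]
      V_form_commute[of w "w - ?p"] V_form_commute[of ?p "w - ?p"] V_form_commute[of ?p w] by linarith
  also have "\<dots> = V_form w w - 2 * (\<Sum>k<K. leg_eigenvalue k * c k * inner w (leg k)) + (\<Sum>k<K. leg_eigenvalue k * c k * c k)"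
    by (simp add: V_form_leg_sum[OF w] V_form_leg_sum[OF leg_sum_V] inner_leg_sum)
  also have "\<dots> = V_form w w - (\<Sum>k<K. leg_eigenvalue k * (inner w (leg k))\<^sup>2) + (\<Sum>k<K. leg_eigenvalue k * (c k - inner w (leg k))\<^sup>2)"
    by (simp add: power2_diff power2_eq_square algebra_simps sum.distrib sum_subtractf sum_distrib_left)
  finally show ?thesis .
qed

lemma leg_eigenvalue_nonneg [simp]: "0 \<le> leg_eigenvalue k"
  by (simp add: leg_eigenvalue_def)

text \<open>The choice \<open>c k = \<langle>w, e_k\<rangle>\<close> bounds the partial sums from
  above; a polynomial close to \<open>w\<close> in the form bounds them from below.\<close>

lemma V_form_sums:
  assumes w: "w \<in> V"
  shows "(\<lambda>k. leg_eigenvalue k * (inner w (leg k))\<^sup>2) sums V_form w w"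
  unfolding sums_def
proof (rule LIMSEQ_I)
  fix e :: real assume "e > 0"
  then obtain p where p: "V_form (w - polyL2 p) (w - polyL2 p) < e" using polyL2_dense_V[OF w] by blast
  have "norm ((\<Sum>k<K. leg_eigenvalue k * (inner w (leg k))\<^sup>2) - V_form w w) < e" if K: "K \<ge> Suc (degree p)" for K
  proof -
    obtain c where c: "polyL2 p = (\<Sum>k<K. c k *\<^sub>R leg k)"
      using polyL2_in_span_leg[of p K] K by auto
    have "0 \<le> (\<Sum>k<K. leg_eigenvalue k * (c k - inner w (leg k))\<^sup>2)"
      by (intro sum_nonneg mult_nonneg_nonneg) auto
    then have "V_form w w - (\<Sum>k<K. leg_eigenvalue k * (inner w (leg k))\<^sup>2) < e"
      using p V_form_diff_leg_sum[OF w, of c K] unfolding c by linarith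
    moreover have "0 \<le> V_form w w - (\<Sum>k<K. leg_eigenvalue k * (inner w (leg k))\<^sup>2)"
      using V_form_diff_leg_sum[OF w, of "\<lambda>k. inner w (leg k)" K]
        V_form_nonneg[of "w - (\<Sum>k<K. inner w (leg k) *\<^sub>R leg k)"] by simp
    ultimately show ?thesis by simp
  qed
  then show "\<exists>no. \<forall>K\<ge>no. norm ((\<Sum>k<K. leg_eigenvalue k * (inner w (leg k))\<^sup>2) - V_form w w) < e" by blast
qed

text \<open>On \<open>V\<close> this is \<open>norm w ^ 2 + V_form w w\<close>, equivalent to
  \<open>V_norm w ^ 2\<close>. The series is diagonal in the basis and visibly measurable along
  continuous paths.\<close>

definition V_energy :: "L2I \<Rightarrow> real" where
  "V_energy w = (\<Sum>k. (1 + leg_eigenvalue k) * (inner w (leg k))\<^sup>2)"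

lemma V_energy_sums:
  assumes "w \<in> V"
  shows "(\<lambda>k. (1 + leg_eigenvalue k) * (inner w (leg k))\<^sup>2) sums V_energy w"
    and "V_energy w = (norm w)\<^sup>2 + V_form w w"
proof -
  have "(\<lambda>k. (1 + leg_eigenvalue k) * (inner w (leg k))\<^sup>2) sums ((norm w)\<^sup>2 + V_form w w)"
    using sums_add[OF parseval V_form_sums[OF assms]] by (simp add: distrib_right)
  then show "V_energy w = (norm w)\<^sup>2 + V_form w w"
    "(\<lambda>k. (1 + leg_eigenvalue k) * (inner w (leg k))\<^sup>2) sums V_energy w"
    by (auto simp: V_energy_def sums_iff)
qed

lemma V_norm_altdef: "V_norm w = norm w + sqrt (V_form w w)"
  by (simp add: V_norm_def V_form_def power2_eq_square mult.assoc)

lemma V_norm_nonneg [simp]: "0 \<le> V_norm w"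
  by (simp add: V_norm_altdef V_form_nonneg)

lemma V_energy_nonneg: "w \<in> V \<Longrightarrow> 0 \<le> V_energy w"
  by (simp add: V_energy_sums V_form_nonneg)

lemma V_energy_le:
  assumes "w \<in> V"
  shows "V_energy w \<le> (V_norm w)\<^sup>2"
proof -
  have "0 \<le> 2 * norm w * sqrt (V_form w w)" by (simp add: V_form_nonneg)
  then show ?thesis
    by (simp add: V_energy_sums[OF assms] V_norm_altdef power2_sum V_form_nonneg)
qed

lemma V_norm_le:
  assumes "w \<in> V"
  shows "(V_norm w)\<^sup>2 \<le> 2 * V_energy w"
proof -
  have "0 \<le> (norm w - sqrt (V_form w w))\<^sup>2" by simp
  then show ?thesis
    by (simp add: V_energy_sums[OF assms] V_norm_altdef power2_sum power2_diff V_form_nonneg)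
qed

lemma V_energy_partial:
  assumes "w \<in> V"
  shows "(\<Sum>k<K. (1 + leg_eigenvalue k) * (inner w (leg k))\<^sup>2) \<le> V_energy w"
proof -
  have "(\<Sum>k<K. (1 + leg_eigenvalue k) * (inner w (leg k))\<^sup>2) \<le> (\<Sum>k. (1 + leg_eigenvalue k) * (inner w (leg k))\<^sup>2)"
    by (rule sum_le_suminf[OF sums_summable[OF V_energy_sums(1)[OF assms]]]) (auto simp: add_nonneg_nonneg)
  then show ?thesis by (simp add: V_energy_def)
qed

lemma V_energy_diff_leg_proj:
  assumes w: "w \<in> V"
  shows "(\<lambda>K. V_energy (w - leg_proj K w)) \<longlonglongrightarrow> 0"
proof -
  have "V_energy (w - leg_proj K w) = (norm (w - leg_proj K w))\<^sup>2 +
      (V_form w w - (\<Sum>k<K. leg_eigenvalue k * (inner w (leg k))\<^sup>2))" for K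
    using V_form_diff_leg_sum[OF w, of "\<lambda>k. inner w (leg k)" K]
    unfolding V_energy_sums(2)[OF V_diff[OF w leg_proj_V]] unfolding leg_proj_def by simp
  moreover have "(\<lambda>K. (norm (w - leg_proj K w))\<^sup>2 + (V_form w w - (\<Sum>k<K. leg_eigenvalue k * (inner w (leg k))\<^sup>2)))
     \<longlonglongrightarrow> (norm (w - w))\<^sup>2 + (V_form w w - V_form w w)"
    using V_form_sums[OF w] unfolding sums_def by (intro tendsto_intros leg_proj_tendsto)
  ultimately show ?thesis by simp
qed

section \<open>The dual of V\<close>

lemma in_V_dual_sum:
  assumes "in_V_dual l"
  shows "l (\<Sum>k<K. c k *\<^sub>R leg k) = (\<Sum>k<K. c k * l (leg k))"
proof (induction K)
  case 0
  have "l (0 *\<^sub>R 0) = 0 * l 0" using assms V_0 unfolding in_V_dual_def by blast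
  then show ?case by simp
next
  case (Suc K)
  have "l ((\<Sum>k<K. c k *\<^sub>R leg k) + c K *\<^sub>R leg K) = l (\<Sum>k<K. c k *\<^sub>R leg k) + l (c K *\<^sub>R leg K)"
    using assms leg_sum_V V_scaleR(1)[OF leg_V] unfolding in_V_dual_def by blast
  moreover have "l (c K *\<^sub>R leg K) = c K * l (leg K)"
    using assms leg_V unfolding in_V_dual_def by blast
  ultimately show ?case using Suc by simp
qed

text \<open>Projections converge in \<open>V\<close>, not merely in \<open>H\<close>, so a
  functional bounded in \<open>V_norm\<close> may be evaluated term by term.\<close>

lemma in_V_dual_expansion:
  assumes l: "in_V_dual l" and w: "w \<in> V"
  shows "(\<lambda>k. inner w (leg k) * l (leg k)) sums l w"
proof -
  obtain C where C: "\<And>v. v \<in> V \<Longrightarrow> \<bar>l v\<bar> \<le> C * V_norm v" using l unfolding in_V_dual_def by blast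
  have "(\<lambda>K. l w - l (leg_proj K w)) \<longlonglongrightarrow> 0"
  proof (rule Lim_null_comparison)
    show "\<forall>\<^sub>F K in sequentially. norm (l w - l (leg_proj K w)) \<le> \<bar>C\<bar> * sqrt (2 * V_energy (w - leg_proj K w))"
    proof (intro always_eventually allI)
      fix K
      have d: "w - leg_proj K w \<in> V" using w leg_proj_V by (rule V_diff)
      have "l ((w - leg_proj K w) + leg_proj K w) = l (w - leg_proj K w) + l (leg_proj K w)"
        using l d leg_proj_V unfolding in_V_dual_def by blast
      then have "norm (l w - l (leg_proj K w)) = \<bar>l (w - leg_proj K w)\<bar>" by simp
      also have "\<dots> \<le> C * V_norm (w - leg_proj K w)" by (rule C[OF d])
      also have "\<dots> \<le> \<bar>C\<bar> * V_norm (w - leg_proj K w)" by (intro mult_right_mono) auto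
      also have "\<dots> \<le> \<bar>C\<bar> * sqrt (2 * V_energy (w - leg_proj K w))"
        using V_norm_le[OF d] by (intro mult_left_mono real_le_rsqrt) auto
      finally show "norm (l w - l (leg_proj K w)) \<le> \<bar>C\<bar> * sqrt (2 * V_energy (w - leg_proj K w))" .
    qed
    have "(\<lambda>K. \<bar>C\<bar> * sqrt (2 * V_energy (w - leg_proj K w))) \<longlonglongrightarrow> \<bar>C\<bar> * sqrt (2 * 0)"
      by (intro tendsto_intros V_energy_diff_leg_proj w)
    then show "(\<lambda>K. \<bar>C\<bar> * sqrt (2 * V_energy (w - leg_proj K w))) \<longlonglongrightarrow> 0" by simp
  qed
  from tendsto_diff[OF tendsto_const[of "l w"] this] show ?thesis
    by (simp add: sums_def leg_proj_def in_V_dual_sum[OF l])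
qed

text \<open>For a bounded functional, the square of the dual norm that belongs to the inner product
  behind \<open>V_energy\<close>.\<close>

definition V_dual_energy :: "(L2I \<Rightarrow> real) \<Rightarrow> real" where
  "V_dual_energy l = (\<Sum>k. (l (leg k))\<^sup>2 / (1 + leg_eigenvalue k))"

lemma one_plus_leg_eigenvalue_pos [simp]: "0 < 1 + leg_eigenvalue k" "1 + leg_eigenvalue k \<noteq> 0"
  using leg_eigenvalue_nonneg[of k] by linarith+

text \<open>The supremum in \<open>V_dual_norm\<close> is tested with a truncated Riesz
  representative \<open>y\<close> of \<open>l\<close>, for which
  \<open>l y = V_energy y\<close>.\<close>

lemma V_dual_partial_le:
  assumes l: "in_V_dual l"
  shows "ennreal (\<Sum>k<K. (l (leg k))\<^sup>2 / (1 + leg_eigenvalue k)) \<le> 2 * (V_dual_norm l)\<^sup>2"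
proof -
  define c where "c k = l (leg k) / (1 + leg_eigenvalue k)" for k
  define y where "y = (\<Sum>k<K. c k *\<^sub>R leg k)"
  define s where "s = (\<Sum>k<K. (l (leg k))\<^sup>2 / (1 + leg_eigenvalue k))"
  have yV: "y \<in> V" unfolding y_def by (rule leg_sum_V)
  have ly: "l y = s"
    unfolding y_def in_V_dual_sum[OF l] by (simp add: s_def c_def power2_eq_square)
  have "V_energy y = (\<Sum>k<K. (1 + leg_eigenvalue k) * (inner y (leg k))\<^sup>2)"
    unfolding V_energy_def by (rule suminf_finite) (auto simp: y_def inner_leg_sum)
  also have "\<dots> = s"
    unfolding s_def by (rule sum.cong) (auto simp: y_def inner_leg_sum c_def power2_eq_square)
  finally have Ey: "V_energy y = s" .
  have s0: "s \<ge> 0" unfolding s_def by (intro sum_nonneg divide_nonneg_pos) auto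
  have "ennreal s \<le> 2 * (V_dual_norm l)\<^sup>2"
  proof (cases "s = 0")
    case False
    with s0 have s: "s > 0" by simp
    \<comment> \<open>As \<open>V_norm v ^ 2 \<le> 2 * V_energy v\<close>, dividing by
      \<open>sqrt (2 * s)\<close> brings \<open>y\<close> into the unit ball; this is the origin of
      the factor \<open>2\<close> in the bound.\<close>
    define v where "v = (1 / sqrt (2 * s)) *\<^sub>R y"
    have vV: "v \<in> V" unfolding v_def by (rule V_scaleR(1)[OF yV])
    have "V_form v v = (1 / sqrt (2 * s))\<^sup>2 * V_form y y"
      unfolding v_def using V_form_scaleR[OF yV V_scaleR(1)[OF yV]] V_form_scaleR[OF yV yV]
      by (simp add: V_form_commute[of y "_ *\<^sub>R y"] power2_eq_square)
    moreover have "(norm v)\<^sup>2 = (1 / sqrt (2 * s))\<^sup>2 * (norm y)\<^sup>2"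
      unfolding v_def norm_scaleR power_mult_distrib by (simp add: power_divide)
    ultimately have "V_energy v = (1 / sqrt (2 * s))\<^sup>2 * V_energy y"
      unfolding V_energy_sums(2)[OF vV] V_energy_sums(2)[OF yV] by (simp only: distrib_left)
    also have "\<dots> = 1 / 2" using s by (simp add: Ey power_divide)
    finally have "(V_norm v)\<^sup>2 \<le> 1\<^sup>2" using V_norm_le[OF vV] by simp
    then have "V_norm v \<le> 1" by (rule power2_le_imp_le) simp
    then have "ennreal \<bar>l v\<bar> \<le> V_dual_norm l"
      unfolding V_dual_norm_def using vV by (intro SUP_upper) auto
    moreover have "l v = (1 / sqrt (2 * s)) * s"
      unfolding v_def using l yV ly unfolding in_V_dual_def by blast
    ultimately have "(ennreal ((1 / sqrt (2 * s)) * s))\<^sup>2 \<le> (V_dual_norm l)\<^sup>2"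
      using s by (intro power_mono) auto
    moreover have "((1 / sqrt (2 * s)) * s)\<^sup>2 = s / 2"
      using s unfolding power_mult_distrib power_divide by (simp add: power2_eq_square)
    moreover have "(ennreal ((1 / sqrt (2 * s)) * s))\<^sup>2 = ennreal (((1 / sqrt (2 * s)) * s)\<^sup>2)"
      using s by (intro ennreal_power) auto
    ultimately have "ennreal (s / 2) \<le> (V_dual_norm l)\<^sup>2" by (simp only:)
    then have "2 * ennreal (s / 2) \<le> 2 * (V_dual_norm l)\<^sup>2"
      by (intro mult_left_mono) auto
    moreover have "2 * ennreal (s / 2) = ennreal s"
      using s ennreal_mult[of 2 "s / 2"] by simp
    ultimately show ?thesis by simp
  qed simp
  then show ?thesis by (simp add: s_def)
qed

lemma V_dual_norm_finite:
  assumes "in_V_dual l"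
  shows "V_dual_norm l < \<infinity>"
proof -
  obtain C where C: "\<And>v. v \<in> V \<Longrightarrow> \<bar>l v\<bar> \<le> C * V_norm v" using assms unfolding in_V_dual_def by blast
  have "V_dual_norm l \<le> ennreal \<bar>C\<bar>"
    unfolding V_dual_norm_def
  proof (rule SUP_least, rule ennreal_leI)
    fix v assume v: "v \<in> {v \<in> V. V_norm v \<le> 1}"
    have "\<bar>l v\<bar> \<le> C * V_norm v" using C v by auto
    also have "\<dots> \<le> \<bar>C\<bar> * 1" using v by (intro mult_mono) auto
    finally show "\<bar>l v\<bar> \<le> \<bar>C\<bar>" by simp
  qed
  then show ?thesis by (auto intro: le_less_trans)
qed

lemma V_dual_energy:
  assumes l: "in_V_dual l"
  shows "summable (\<lambda>k. (l (leg k))\<^sup>2 / (1 + leg_eigenvalue k))"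
    and "ennreal (V_dual_energy l) \<le> 2 * (V_dual_norm l)\<^sup>2"
    and "(\<Sum>k<K. (l (leg k))\<^sup>2 / (1 + leg_eigenvalue k)) \<le> V_dual_energy l"
    and "0 \<le> V_dual_energy l"
proof -
  have nn: "0 \<le> (l (leg k))\<^sup>2 / (1 + leg_eigenvalue k)" for k
    by (intro divide_nonneg_pos) auto
  obtain B where B: "2 * (V_dual_norm l)\<^sup>2 = ennreal B" "B \<ge> 0"
    using V_dual_norm_finite[OF l] by (cases "V_dual_norm l") (auto simp: ennreal_power ennreal_mult[symmetric] numeral_mult_ennreal)
  have b: "(\<Sum>k<K. (l (leg k))\<^sup>2 / (1 + leg_eigenvalue k)) \<le> B" for K
    using V_dual_partial_le[OF l, of K] B by (simp add: ennreal_le_iff)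
  show s: "summable (\<lambda>k. (l (leg k))\<^sup>2 / (1 + leg_eigenvalue k))"
    by (rule summableI_nonneg_bounded[OF nn b])
  have "V_dual_energy l \<le> B"
    unfolding V_dual_energy_def by (rule suminf_le_const[OF s b])
  then show "ennreal (V_dual_energy l) \<le> 2 * (V_dual_norm l)\<^sup>2"
    unfolding B(1) by (rule ennreal_leI)
  show "(\<Sum>k<K. (l (leg k))\<^sup>2 / (1 + leg_eigenvalue k)) \<le> V_dual_energy l"
    unfolding V_dual_energy_def by (rule sum_le_suminf[OF s]) (use nn in auto)
  show "0 \<le> V_dual_energy l"
    unfolding V_dual_energy_def by (rule suminf_nonneg[OF s nn])
qed

text \<open>Young's inequality with weight \<open>sqrt (1 + leg_eigenvalue k)\<close> in each term.
  The bound does not depend on \<open>K\<close>, which later allows dominated convergence in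
  time.\<close>

lemma dual_pairing_partial_le:
  assumes l: "in_V_dual l" and w: "w \<in> V"
  shows "\<bar>\<Sum>k<K. inner w (leg k) * l (leg k)\<bar> \<le> (V_dual_energy l + V_energy w) / 2"
proof -
  have "\<bar>inner w (leg k) * l (leg k)\<bar> \<le>
      ((l (leg k))\<^sup>2 / (1 + leg_eigenvalue k) + (1 + leg_eigenvalue k) * (inner w (leg k))\<^sup>2) / 2" for k
  proof -
    define m where "m = sqrt (1 + leg_eigenvalue k)"
    have m: "m > 0" "1 + leg_eigenvalue k = m\<^sup>2" by (auto simp: m_def less_imp_le)
    have "0 \<le> (\<bar>l (leg k)\<bar> / m - m * \<bar>inner w (leg k)\<bar>)\<^sup>2" by simp
    also have "\<dots> = (l (leg k))\<^sup>2 / m\<^sup>2 + m\<^sup>2 * (inner w (leg k))\<^sup>2 - 2 * \<bar>inner w (leg k) * l (leg k)\<bar>"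
      using m(1) by (simp add: power2_diff power_divide power_mult_distrib abs_mult)
    finally show ?thesis unfolding m(2) by simp
  qed
  then have "(\<Sum>k<K. \<bar>inner w (leg k) * l (leg k)\<bar>) \<le>
      (\<Sum>k<K. ((l (leg k))\<^sup>2 / (1 + leg_eigenvalue k) + (1 + leg_eigenvalue k) * (inner w (leg k))\<^sup>2) / 2)"
    by (rule sum_mono)
  also have "\<dots> = ((\<Sum>k<K. (l (leg k))\<^sup>2 / (1 + leg_eigenvalue k)) + (\<Sum>k<K. (1 + leg_eigenvalue k) * (inner w (leg k))\<^sup>2)) / 2"
    by (simp add: sum_divide_distrib[symmetric] sum.distrib)
  also have "\<dots> \<le> (V_dual_energy l + V_energy w) / 2"
    using V_dual_energy(3)[OF l, of K] V_energy_partial[OF w, of K] by simp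
  finally show ?thesis using sum_abs[of "\<lambda>k. inner w (leg k) * l (leg k)" "{..<K}"] by linarith
qed

lemma dual_pairing_le:
  assumes l: "in_V_dual l" and w: "w \<in> V"
  shows "\<bar>l w\<bar> \<le> (V_dual_energy l + V_energy w) / 2"
proof (rule LIMSEQ_le_const2)
  show "(\<lambda>K. \<bar>\<Sum>k<K. inner w (leg k) * l (leg k)\<bar>) \<longlonglongrightarrow> \<bar>l w\<bar>"
    using in_V_dual_expansion[OF assms] unfolding sums_def by (intro tendsto_intros)
  show "\<exists>N. \<forall>K\<ge>N. \<bar>\<Sum>k<K. inner w (leg k) * l (leg k)\<bar> \<le> (V_dual_energy l + V_energy w) / 2"
    using dual_pairing_partial_le[OF assms] by blast
qed

section \<open>Functions of time\<close>

abbreviation (input) T_meas :: "real \<Rightarrow> real measure" where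
  "T_meas T \<equiv> lebesgue_on {0<..<T}"

lemma sigma_finite_T_meas: "sigma_finite_measure (T_meas T)"
  by (intro finite_measure.axioms(1) finite_measure_lebesgue_on) auto

lemma continuous_measurable_T:
  fixes c :: "real \<Rightarrow> 'a::metric_space"
  assumes "continuous_on {0..T} c"
  shows "c \<in> borel_measurable (T_meas T)"
proof (rule measurableI)
  fix B :: "'a set" assume "B \<in> sets borel"
  moreover have "c \<in> borel_measurable (restrict_space borel {0<..<T})"
    by (intro borel_measurable_continuous_on_restrict continuous_on_subset[OF assms]) auto
  ultimately have "c -` B \<inter> {0<..<T} \<in> sets (restrict_space borel {0<..<T})"
    by (auto dest: measurable_sets simp: space_restrict_space)
  then show "c -` B \<inter> space (T_meas T) \<in> sets (T_meas T)"
    by (auto simp: sets_restrict_space)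
qed auto

lemma continuous_bounded_T:
  fixes c :: "real \<Rightarrow> real"
  assumes "continuous_on {0..T} c"
  obtains C where "\<And>s. s \<in> {0..T} \<Longrightarrow> \<bar>c s\<bar> \<le> C"
proof -
  have "bounded (c ` {0..T})"
    by (intro compact_imp_bounded compact_continuous_image assms) auto
  then obtain C where "\<forall>y\<in>c ` {0..T}. \<bar>y\<bar> \<le> C" by (auto simp: bounded_iff)
  then show ?thesis by (intro that[of C]) auto
qed

lemma integrable_continuous_mult_T:
  fixes c f :: "real \<Rightarrow> real"
  assumes c: "continuous_on {0..T} c" and f: "integrable (T_meas T) f"
  shows "integrable (T_meas T) (\<lambda>s. c s * f s)"
proof -
  obtain C where C: "\<And>s. s \<in> {0..T} \<Longrightarrow> \<bar>c s\<bar> \<le> C" using continuous_bounded_T[OF c] by blast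
  show ?thesis
  proof (rule Bochner_Integration.integrable_bound[OF integrable_mult_right[OF f, of C]])
    show "(\<lambda>s. c s * f s) \<in> borel_measurable (T_meas T)"
      using f continuous_measurable_T[OF c] by simp
    show "AE s in T_meas T. norm (c s * f s) \<le> norm (C * f s)"
    proof (rule AE_I2)
      fix s assume "s \<in> space (T_meas T)"
      then have "\<bar>c s\<bar> \<le> \<bar>C\<bar>" using C[of s] by auto
      then show "norm (c s * f s) \<le> norm (C * f s)" by (simp add: abs_mult mult_right_mono)
    qed
  qed
qed

lemma integrable_continuous_T:
  fixes c :: "real \<Rightarrow> real"
  assumes c: "continuous_on {0..T} c"
  shows "integrable (T_meas T) c"
  using integrable_continuous_mult_T[OF c, of "\<lambda>_. 1"] finite_measure_lebesgue_on[of "{0<..<T}"]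
  by (simp add: finite_measure.integrable_const)

lemma integrable_indicator_T:
  fixes f :: "real \<Rightarrow> real"
  assumes "integrable (T_meas T) f"
  shows "integrable (T_meas T) (\<lambda>s. indicator {0..t} s * f s)"
proof -
  have "{0..t} \<inter> {0<..<T} \<in> sets (T_meas T)"
    by (auto simp: sets_restrict_space)
  then have "integrable (T_meas T) (\<lambda>s. indicator ({0..t} \<inter> {0<..<T}) s *\<^sub>R f s)"
    using assms by (rule integrable_mult_indicator)
  then show ?thesis
    by (rule Bochner_Integration.integrable_cong[THEN iffD1, rotated -1]) (auto simp: indicator_def)
qed

text \<open>The weak equation integrates over closed intervals, the path spaces over the open
  \<open>(0,T)\<close>. Everything is moved to the latter with an indicator, the end points being
  null.\<close>

lemma integral_closed_interval:
  fixes f g :: "real \<Rightarrow> real"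
  assumes g: "integrable (T_meas T) g" and fg: "AE s in T_meas T. f s = g s" and t: "t \<in> {0..T}"
  shows "integral\<^sup>L (lebesgue_on {0..t}) f = integral\<^sup>L (T_meas T) (\<lambda>s. indicator {0..t} s * g s)"
proof -
  define F where "F s = indicator {0..t} s *\<^sub>R f s" for s
  define H where "H s = indicator {0<..<T} s *\<^sub>R (indicator {0..t} s * g s)" for s
  have "integrable lebesgue H"
    using integrable_indicator_T[OF g, of t] unfolding H_def by (simp add: integrable_restrict_space)
  then have H: "H \<in> borel_measurable lebesgue" by simp
  have "AE s in lebesgue. s \<in> {0<..<T} \<longrightarrow> f s = g s"
    using fg by (simp add: AE_restrict_space_iff)
  moreover have "AE s in lebesgue. s \<noteq> 0 \<and> s \<noteq> T"
    using AE_not_in[of "{0, T}" lebesgue] by (auto elim!: eventually_mono simp: negligible_iff_null_sets[symmetric])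
  ultimately have ae: "AE s in lebesgue. H s = F s"
    by eventually_elim (use t in \<open>auto simp: H_def F_def indicator_def\<close>)
  \<comment> \<open>\<open>f\<close> is not assumed measurable; it inherits measurability from
    \<open>g\<close> because Lebesgue measure is complete.\<close>
  have "F \<in> borel_measurable lebesgue"
    using borel_measurable_AE[OF H ae] .
  then have "integral\<^sup>L lebesgue F = integral\<^sup>L lebesgue H"
    using H ae by (intro integral_cong_AE) (auto elim: eventually_mono)
  then show ?thesis
    by (simp add: integral_restrict_space F_def[abs_def] H_def[abs_def])
qed

text \<open>\<open>c\<close> is merely absolutely continuous. Instead of differentiating its square,
  the double integral of \<open>h r * h s\<close> is split along the diagonal.\<close>

lemma AC_square:
  fixes h c :: "real \<Rightarrow> real"
  assumes h: "integrable (T_meas T) h"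
    and c: "\<And>t. t \<in> {0..T} \<Longrightarrow> c t = integral\<^sup>L (T_meas T) (\<lambda>s. indicator {0..t} s * h s)"
    and t: "t \<in> {0..T}"
  shows "(c t)\<^sup>2 = integral\<^sup>L (T_meas T) (\<lambda>s. indicator {0..t} s * (2 * (c s * h s)))"
proof -
  let ?M = "T_meas T"
  interpret sigma_finite_measure ?M by (rule sigma_finite_T_meas)
  interpret P: pair_sigma_finite ?M ?M ..
  have id [measurable]: "(\<lambda>s. s) \<in> borel_measurable ?M"
    by (rule continuous_measurable_T) (rule continuous_on_id)
  have [measurable]: "h \<in> borel_measurable ?M" using h by simp
  define k where "k s = indicator {0..t} s * h s" for s
  have k: "integrable ?M k" unfolding k_def by (rule integrable_indicator_T[OF h])
  then have [measurable]: "k \<in> borel_measurable ?M" by simp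
  have ik: "integrable ?M (\<lambda>r. indicator {r. P r s} r * k r)" if "Measurable.pred ?M (\<lambda>r. P r s)" for P and s :: real
    by (rule Bochner_Integration.integrable_bound[OF k]) (use that in \<open>auto simp: indicator_def\<close>)
  have cs: "(\<integral> r. (if r \<le> s then k r else 0) \<partial>?M) = c s" if "s \<in> {0..t}" for s
  proof -
    have "(if r \<le> s then k r else 0) = indicator {0..s} r * h r" if "r \<in> space ?M" for r
      using that \<open>s \<in> {0..t}\<close> by (auto simp: k_def indicator_def)
    then have "(\<integral> r. (if r \<le> s then k r else 0) \<partial>?M) = (\<integral> r. indicator {0..s} r * h r \<partial>?M)"
      by (intro Bochner_Integration.integral_cong refl)
    then show ?thesis using c[of s] that t by simp
  qed
  have cs': "(\<integral> r. (if r < s then k r else 0) \<partial>?M) = (\<integral> r. (if r \<le> s then k r else 0) \<partial>?M)" for s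
  proof (rule integral_cong_AE)
    have "AE r in lebesgue. r \<noteq> s"
      using AE_not_in[of "{s}" lebesgue] by (auto elim!: eventually_mono simp: negligible_iff_null_sets[symmetric])
    then show "AE r in ?M. (if r < s then k r else 0) = (if r \<le> s then k r else 0)"
      by (auto simp: AE_restrict_space_iff elim!: eventually_mono)
  qed measurable
  \<comment> \<open>The two triangles of the square: exchanging the variables maps one to the other
    up to the diagonal, which \<open>cs'\<close> discards as null.\<close>
  let ?A = "\<integral> s. k s * (\<integral> r. (if r \<le> s then k r else 0) \<partial>?M) \<partial>?M"
  let ?B = "\<integral> s. k s * (\<integral> r. (if s < r then k r else 0) \<partial>?M) \<partial>?M"
  have ile: "integrable ?M (\<lambda>r. if r \<le> s then k r else 0)" and igt: "integrable ?M (\<lambda>r. if s < r then k r else 0)" for s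
    by (rule Bochner_Integration.integrable_bound[OF k]; simp)+
  have i2: "integrable (?M \<Otimes>\<^sub>M ?M) (\<lambda>(s, r). if s < r then k s * k r else 0)"
  proof (rule P.Fubini_integrable)
    show "(\<lambda>(s, r). if s < r then k s * k r else 0) \<in> borel_measurable (?M \<Otimes>\<^sub>M ?M)"
      by measurable
    have e: "(case (s, r) of (s, r) \<Rightarrow> if s < r then k s * k r else 0) = k s * (if s < r then k r else 0)" for s r
      by simp
    show "AE s in ?M. integrable ?M (\<lambda>r. case (s, r) of (s, r) \<Rightarrow> if s < r then k s * k r else 0)"
      unfolding e using igt by simp
    have "(\<integral> r. norm (case (s, r) of (s, r) \<Rightarrow> if s < r then k s * k r else 0) \<partial>?M) = \<bar>k s\<bar> * (\<integral> r. (if s < r then \<bar>k r\<bar> else 0) \<partial>?M)" for s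
      unfolding e by (subst integral_mult_right_zero[symmetric], rule Bochner_Integration.integral_cong) (auto simp: abs_mult)
    moreover have "integrable ?M (\<lambda>s. \<bar>k s\<bar> * (\<integral> r. (if s < r then \<bar>k r\<bar> else 0) \<partial>?M))"
    proof (rule Bochner_Integration.integrable_bound[where f = "\<lambda>s. \<bar>k s\<bar> * (\<integral> r. \<bar>k r\<bar> \<partial>?M)"])
      show "AE s in ?M. norm (\<bar>k s\<bar> * (\<integral> r. (if s < r then \<bar>k r\<bar> else 0) \<partial>?M)) \<le> norm (\<bar>k s\<bar> * (\<integral> r. \<bar>k r\<bar> \<partial>?M))"
      proof (rule AE_I2)
        fix s
        have "(\<integral> r. (if s < r then \<bar>k r\<bar> else 0) \<partial>?M) \<le> (\<integral> r. \<bar>k r\<bar> \<partial>?M)"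
          by (rule integral_mono_AE') (use k in auto)
        moreover have "0 \<le> (\<integral> r. (if s < r then \<bar>k r\<bar> else 0) \<partial>?M)" by simp
        ultimately show "norm (\<bar>k s\<bar> * (\<integral> r. (if s < r then \<bar>k r\<bar> else 0) \<partial>?M)) \<le> norm (\<bar>k s\<bar> * (\<integral> r. \<bar>k r\<bar> \<partial>?M))"
          by (simp add: abs_mult mult_left_mono)
      qed
    qed (use k in \<open>auto intro!: borel_measurable_times borel_measurable_lebesgue_integral\<close>)
    ultimately show "integrable ?M (\<lambda>s. \<integral> r. norm (case (s, r) of (s, r) \<Rightarrow> if s < r then k s * k r else 0) \<partial>?M)"
      by simp
  qed
  have "?B = (\<integral> s. (\<integral> r. (if s < r then k s * k r else 0) \<partial>?M) \<partial>?M)"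
    by (rule Bochner_Integration.integral_cong[OF refl], subst integral_mult_right_zero[symmetric], rule Bochner_Integration.integral_cong) auto
  also have "\<dots> = (\<integral> r. (\<integral> s. (if s < r then k s * k r else 0) \<partial>?M) \<partial>?M)"
    by (rule P.Fubini_integral[symmetric]) (rule i2)
  also have "\<dots> = (\<integral> r. k r * (\<integral> s. (if s < r then k s else 0) \<partial>?M) \<partial>?M)"
    by (rule Bochner_Integration.integral_cong[OF refl], subst integral_mult_right_zero[symmetric], rule Bochner_Integration.integral_cong) auto
  finally have BA: "?B = ?A" unfolding cs' .
  have kc: "(\<integral> r. k r \<partial>?M) = c t" using c[OF t] by (simp add: k_def)
  have mA: "(\<lambda>s. k s * (\<integral> r. (if r \<le> s then k r else 0) \<partial>?M)) \<in> borel_measurable ?M"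
    and mB: "(\<lambda>s. k s * (\<integral> r. (if s < r then k r else 0) \<partial>?M)) \<in> borel_measurable ?M"
    by (intro borel_measurable_times borel_measurable_lebesgue_integral; measurable)+
  have bnd: "\<bar>\<integral> r. f r \<partial>?M\<bar> \<le> (\<integral> r. \<bar>k r\<bar> \<partial>?M)" if "integrable ?M f" "\<And>r. \<bar>f r\<bar> \<le> \<bar>k r\<bar>" for f
    by (rule order.trans[OF integral_abs_bound integral_mono]) (use that k in auto)
  have iA: "integrable ?M (\<lambda>s. k s * (\<integral> r. (if r \<le> s then k r else 0) \<partial>?M))"
    by (rule Bochner_Integration.integrable_bound[OF integrable_mult_left[OF k, of "\<integral> r. \<bar>k r\<bar> \<partial>?M"] mA])
      (auto simp: abs_mult intro!: mult_left_mono order.trans[OF bnd] ile)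
  have iB: "integrable ?M (\<lambda>s. k s * (\<integral> r. (if s < r then k r else 0) \<partial>?M))"
    by (rule Bochner_Integration.integrable_bound[OF integrable_mult_left[OF k, of "\<integral> r. \<bar>k r\<bar> \<partial>?M"] mB])
      (auto simp: abs_mult intro!: mult_left_mono order.trans[OF bnd] igt)
  have "(c t)\<^sup>2 = (\<integral> s. k s * (\<integral> r. k r \<partial>?M) \<partial>?M)"
    by (simp add: kc power2_eq_square)
  also have "\<dots> = (\<integral> s. k s * (\<integral> r. (if r \<le> s then k r else 0) \<partial>?M) + k s * (\<integral> r. (if s < r then k r else 0) \<partial>?M) \<partial>?M)"
  proof (rule Bochner_Integration.integral_cong[OF refl])
    fix s
    have "(\<integral> r. k r \<partial>?M) = (\<integral> r. (if r \<le> s then k r else 0) + (if s < r then k r else 0) \<partial>?M)"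
      by (rule Bochner_Integration.integral_cong) auto
    also have "\<dots> = (\<integral> r. (if r \<le> s then k r else 0) \<partial>?M) + (\<integral> r. (if s < r then k r else 0) \<partial>?M)"
      by (rule Bochner_Integration.integral_add[OF ile igt])
    finally show "k s * (\<integral> r. k r \<partial>?M) = k s * (\<integral> r. (if r \<le> s then k r else 0) \<partial>?M) + k s * (\<integral> r. (if s < r then k r else 0) \<partial>?M)"
      by (simp add: distrib_left)
  qed
  also have "\<dots> = ?A + ?B" by (rule Bochner_Integration.integral_add[OF iA iB])
  also have "\<dots> = (\<integral> s. 2 * (k s * (\<integral> r. (if r \<le> s then k r else 0) \<partial>?M)) \<partial>?M)"
    unfolding BA by simp
  also have "\<dots> = (\<integral> s. indicator {0..t} s * (2 * (c s * h s)) \<partial>?M)"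
    using cs by (intro Bochner_Integration.integral_cong) (auto simp: k_def indicator_def)
  finally show ?thesis .
qed

text \<open>The factor \<open>exp (- C s)\<close> makes the right-hand side of the hypothesis
  decreasing in time; that side is differentiable even where \<open>\<phi>\<close> is not.\<close>

lemma gronwall:
  fixes \<phi> :: "real \<Rightarrow> real"
  assumes c: "continuous_on {0..T} \<phi>" and C: "C \<ge> 0"
    and le: "\<And>t. t \<in> {0..T} \<Longrightarrow> \<phi> t \<le> a + C * integral {0..t} \<phi>"
    and t: "t \<in> {0..T}"
  shows "\<phi> t \<le> a * exp (C * t)"
proof -
  define W where "W s = exp (- (C * s)) * (a + C * integral {0..s} \<phi>)" for s
  have int: "continuous_on {0..T} (\<lambda>s. integral {0..s} \<phi>)"
    by (intro indefinite_integral_continuous_1 integrable_continuous_interval c)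
  have "W t \<le> W 0"
  proof (rule DERIV_nonpos_imp_decreasing_open[where f = W])
    show "0 \<le> t" using t by simp
    show "continuous_on {0..t} W"
      unfolding W_def using t by (intro continuous_intros continuous_on_subset[OF int]) auto
    fix s assume s: "0 < s" "s < t"
    have "((\<lambda>s. integral {0..s} \<phi>) has_real_derivative \<phi> s) (at s within {0..T})"
      using integral_has_real_derivative[OF c, of s] s t by simp
    moreover have "at s within {0..T} = at s"
      using s t by (intro at_within_interior) auto
    ultimately have d: "((\<lambda>s. integral {0..s} \<phi>) has_real_derivative \<phi> s) (at s)" by simp
    have "(W has_real_derivative exp (- (C * s)) * (- C) * (a + C * integral {0..s} \<phi>) + (C * \<phi> s) * exp (- (C * s))) (at s)"
      unfolding W_def[abs_def] by (auto intro!: derivative_eq_intros d)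
    moreover have "exp (- (C * s)) * (- C) * (a + C * integral {0..s} \<phi>) + (C * \<phi> s) * exp (- (C * s)) =
       (exp (- (C * s)) * C) * (\<phi> s - (a + C * integral {0..s} \<phi>))" by (simp add: algebra_simps)
    moreover have "\<dots> \<le> 0" using le[of s] s t C by (intro mult_nonneg_nonpos) auto
    ultimately show "\<exists>y. (W has_real_derivative y) (at s) \<and> y \<le> 0" by auto
  qed
  then have "exp (- (C * t)) * (a + C * integral {0..t} \<phi>) \<le> a" by (simp add: W_def)
  then have "a + C * integral {0..t} \<phi> \<le> a * exp (C * t)"
    by (simp add: exp_minus field_simps)
  then show ?thesis using le[OF t] by simp
qed

text \<open>Completeness of Lebesgue measure; applied to pairings that equal a measurable series
  only at almost every time.\<close>

lemma borel_measurable_T_AE: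
  fixes f g :: "real \<Rightarrow> real"
  assumes "f \<in> borel_measurable (T_meas T)" "AE s in T_meas T. f s = g s"
  shows "g \<in> borel_measurable (T_meas T)"
proof -
  have "(\<lambda>s. if s \<in> {0<..<T} then f s else 0) \<in> borel_measurable lebesgue"
    using assms(1) by (subst borel_measurable_if) auto
  moreover have "AE s in lebesgue. (if s \<in> {0<..<T} then f s else 0) = (if s \<in> {0<..<T} then g s else 0)"
    using assms(2) by (auto simp: AE_restrict_space_iff elim!: eventually_mono)
  ultimately have "(\<lambda>s. if s \<in> {0<..<T} then g s else 0) \<in> borel_measurable lebesgue"
    by (rule borel_measurable_AE)
  then show ?thesis by (subst (asm) borel_measurable_if) auto
qed

section \<open>The energy inequality\<close>

lemma V_energy_add_le:
  assumes "v \<in> V" "w \<in> V"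
  shows "V_energy (v + w) \<le> 2 * V_energy v + 2 * V_energy w"
proof -
  have "summable (\<lambda>k. 2 * ((1 + leg_eigenvalue k) * (inner v (leg k))\<^sup>2) + 2 * ((1 + leg_eigenvalue k) * (inner w (leg k))\<^sup>2))"
    using V_energy_sums(1)[OF assms(1)] V_energy_sums(1)[OF assms(2)]
    by (intro summable_add summable_mult) (auto simp: sums_iff)
  moreover have "(1 + leg_eigenvalue k) * (inner (v + w) (leg k))\<^sup>2 \<le>
      2 * ((1 + leg_eigenvalue k) * (inner v (leg k))\<^sup>2) + 2 * ((1 + leg_eigenvalue k) * (inner w (leg k))\<^sup>2)" for k
  proof -
    have "(a + b)\<^sup>2 \<le> 2 * a\<^sup>2 + 2 * b\<^sup>2" for a b :: real
      using zero_le_power2[of "a - b"] by (simp add: power2_eq_square algebra_simps)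
    from mult_left_mono[OF this, of "1 + leg_eigenvalue k" "inner v (leg k)" "inner w (leg k)"] show ?thesis
      by (simp add: inner_add_left algebra_simps add_nonneg_nonneg)
  qed
  moreover have "summable (\<lambda>k. (1 + leg_eigenvalue k) * (inner (v + w) (leg k))\<^sup>2)"
    using V_energy_sums(1)[OF V_add(1)[OF assms]] by (auto simp: sums_iff)
  ultimately have "V_energy (v + w) \<le> (\<Sum>k. 2 * ((1 + leg_eigenvalue k) * (inner v (leg k))\<^sup>2) + 2 * ((1 + leg_eigenvalue k) * (inner w (leg k))\<^sup>2))"
    unfolding V_energy_def by (intro suminf_le) auto
  also have "\<dots> = 2 * V_energy v + 2 * V_energy w"
    using sums_unique[OF sums_add[OF sums_mult[OF V_energy_sums(1)[OF assms(1)], of 2] sums_mult[OF V_energy_sums(1)[OF assms(2)], of 2]]]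
    by simp
  finally show ?thesis .
qed

lemma V_energy_scaleR: "V_energy (c *\<^sub>R w) = c\<^sup>2 * V_energy w" if "w \<in> V"
  using sums_unique[OF sums_mult[OF V_energy_sums(1)[OF that], of "c\<^sup>2"]]
  by (simp add: V_energy_def power_mult_distrib mult_ac)

text \<open>Continuity in \<open>H\<close> makes every coefficient measurable, so times at which the
  path is outside \<open>V\<close> cause no difficulty.\<close>

lemma V_energy_measurable_T:
  assumes "continuous_on {0..T} u"
  shows "(\<lambda>t. V_energy (u t)) \<in> borel_measurable (T_meas T)"
proof -
  have [measurable]: "(\<lambda>t. inner (u t) (leg k)) \<in> borel_measurable (T_meas T)" for k
    by (intro continuous_measurable_T continuous_intros assms)
  show ?thesis unfolding V_energy_def by measurable
qed

text \<open>Replaces the nonnegative integral of the squared \<open>V_norm\<close> by integrability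
  of the coefficient energy; the two integrands are comparable up to the factor
  \<open>2\<close>.\<close>

lemma energy_paths_iff:
  "u \<in> energy_paths T \<longleftrightarrow> continuous_on {0..T} u \<and> (AE t in T_meas T. u t \<in> V) \<and> integrable (T_meas T) (\<lambda>t. V_energy (u t))"
proof (intro iffI conjI; (elim conjE)?)
  assume u: "u \<in> energy_paths T"
  then show c: "continuous_on {0..T} u" and V: "AE t in T_meas T. u t \<in> V"
    by (auto simp: energy_paths_def L2_V_def)
  have "(\<integral>\<^sup>+ t. ennreal (norm (V_energy (u t))) \<partial>T_meas T) \<le> (\<integral>\<^sup>+ t. ennreal ((V_norm (u t))\<^sup>2) \<partial>T_meas T)"
    using V by (intro nn_integral_mono_AE) (auto elim!: eventually_mono intro!: ennreal_leI simp: V_energy_le V_energy_nonneg)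
  also have "\<dots> < \<infinity>" using u by (simp add: energy_paths_def L2_V_def)
  finally show "integrable (T_meas T) (\<lambda>t. V_energy (u t))"
    using V_energy_measurable_T[OF c] by (simp add: integrable_iff_bounded)
next
  assume c: "continuous_on {0..T} u" and V: "AE t in T_meas T. u t \<in> V"
    and i: "integrable (T_meas T) (\<lambda>t. V_energy (u t))"
  have "(\<integral>\<^sup>+ t. ennreal ((V_norm (u t))\<^sup>2) \<partial>T_meas T) \<le> (\<integral>\<^sup>+ t. ennreal (norm (2 * V_energy (u t))) \<partial>T_meas T)"
    using V by (intro nn_integral_mono_AE) (auto elim!: eventually_mono intro!: ennreal_leI simp: V_norm_le V_energy_nonneg)
  also have "\<dots> < \<infinity>" using integrable_mult_right[OF i, of 2] unfolding integrable_iff_bounded by simp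
  finally show "u \<in> energy_paths T"
    using c V continuous_measurable_T[OF c] by (simp add: energy_paths_def L2_V_def)
qed

lemma energy_paths_add:
  assumes u: "u \<in> energy_paths T" and v: "v \<in> energy_paths T"
  shows "(\<lambda>t. u t + v t) \<in> energy_paths T"
proof -
  have c: "continuous_on {0..T} (\<lambda>t. u t + v t)"
    using u v by (auto simp: energy_paths_iff intro!: continuous_intros)
  have V: "AE t in T_meas T. u t \<in> V \<and> v t \<in> V"
    using u v by (auto simp: energy_paths_iff)
  have "integrable (T_meas T) (\<lambda>t. V_energy (u t + v t))"
  proof (rule Bochner_Integration.integrable_bound)
    show "integrable (T_meas T) (\<lambda>t. 2 * V_energy (u t) + 2 * V_energy (v t))"
      using u v by (auto simp: energy_paths_iff)
    show "AE t in T_meas T. norm (V_energy (u t + v t)) \<le> norm (2 * V_energy (u t) + 2 * V_energy (v t))"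
      using V by eventually_elim (use V_energy_add_le V_energy_nonneg V_add(1) in \<open>fastforce simp: abs_of_nonneg\<close>)
  qed (rule V_energy_measurable_T[OF c])
  moreover have "AE t in T_meas T. u t + v t \<in> V"
    using V by eventually_elim (simp add: V_add(1))
  ultimately show ?thesis using c by (simp add: energy_paths_iff)
qed

lemma energy_paths_scaleR:
  assumes u: "u \<in> energy_paths T"
  shows "(\<lambda>t. c *\<^sub>R u t) \<in> energy_paths T"
proof -
  have ct: "continuous_on {0..T} (\<lambda>t. c *\<^sub>R u t)"
    using u by (auto simp: energy_paths_iff intro!: continuous_intros)
  have V: "AE t in T_meas T. u t \<in> V"
    using u by (auto simp: energy_paths_iff)
  have "integrable (T_meas T) (\<lambda>t. V_energy (c *\<^sub>R u t))"
  proof (rule Bochner_Integration.integrable_bound)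
    show "integrable (T_meas T) (\<lambda>t. c\<^sup>2 * V_energy (u t))"
      using u by (auto simp: energy_paths_iff)
    show "AE t in T_meas T. norm (V_energy (c *\<^sub>R u t)) \<le> norm (c\<^sup>2 * V_energy (u t))"
      using V by eventually_elim (simp add: V_energy_scaleR)
  qed (rule V_energy_measurable_T[OF ct])
  moreover have "AE t in T_meas T. c *\<^sub>R u t \<in> V"
    using V by eventually_elim (simp add: V_scaleR(1))
  ultimately show ?thesis using ct by (simp add: energy_paths_iff)
qed

text \<open>The content of \<open>L2_V_dual\<close> expressed through the coefficient energy, a form
  that is stable under differences by a termwise estimate.\<close>

definition dual_path :: "real \<Rightarrow> (real \<Rightarrow> L2I \<Rightarrow> real) \<Rightarrow> bool" where
  "dual_path T l \<longleftrightarrow> (\<forall>v\<in>V. (\<lambda>t. l t v) \<in> borel_measurable (T_meas T)) \<and>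
     (AE t in T_meas T. in_V_dual (l t)) \<and> integrable (T_meas T) (\<lambda>t. V_dual_energy (l t))"

lemma V_dual_energy_measurable_T:
  assumes "\<forall>v\<in>V. (\<lambda>t. l t v) \<in> borel_measurable (T_meas T)"
  shows "(\<lambda>t. V_dual_energy (l t)) \<in> borel_measurable (T_meas T)"
proof -
  have [measurable]: "(\<lambda>t. l t (leg k)) \<in> borel_measurable (T_meas T)" for k
    using assms by simp
  show ?thesis unfolding V_dual_energy_def by measurable
qed

lemma L2_V_dual_imp_dual_path:
  assumes l: "l \<in> L2_V_dual T"
  shows "dual_path T l"
proof -
  have m: "\<forall>v\<in>V. (\<lambda>t. l t v) \<in> borel_measurable (T_meas T)" and V: "AE t in T_meas T. in_V_dual (l t)"
    using l by (auto simp: L2_V_dual_def)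
  have half: "ennreal (x / 2) \<le> y" if "ennreal x \<le> 2 * y" "0 \<le> x" for x y
  proof (cases y)
    case (real r)
    then show ?thesis using that by (simp add: numeral_mult_ennreal ennreal_le_iff)
  qed simp
  have "(\<integral>\<^sup>+ t. ennreal (norm (V_dual_energy (l t) / 2)) \<partial>T_meas T) \<le> (\<integral>\<^sup>+ t. (V_dual_norm (l t))\<^sup>2 \<partial>T_meas T)"
    using V by (intro nn_integral_mono_AE) (auto elim!: eventually_mono simp: V_dual_energy intro!: half)
  also have "\<dots> < \<infinity>" using l by (simp add: L2_V_dual_def)
  finally have "integrable (T_meas T) (\<lambda>t. V_dual_energy (l t) / 2)"
    using V_dual_energy_measurable_T[OF m] by (simp add: integrable_iff_bounded)
  from integrable_mult_right[OF this, of 2] show ?thesis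
    using m V by (simp add: dual_path_def)
qed

lemma in_V_dual_diff:
  assumes "in_V_dual l" "in_V_dual m"
  shows "in_V_dual (\<lambda>v. l v - m v)"
proof -
  obtain C D where C: "\<And>v. v \<in> V \<Longrightarrow> \<bar>l v\<bar> \<le> C * V_norm v" and D: "\<And>v. v \<in> V \<Longrightarrow> \<bar>m v\<bar> \<le> D * V_norm v"
    using assms unfolding in_V_dual_def by blast
  have "\<bar>l v - m v\<bar> \<le> (C + D) * V_norm v" if "v \<in> V" for v
    using C[OF that] D[OF that] by (simp add: distrib_right)
  then have "\<exists>C. \<forall>v\<in>V. \<bar>l v - m v\<bar> \<le> C * V_norm v" by blast
  then show ?thesis using assms unfolding in_V_dual_def by (auto simp: right_diff_distrib)
qed

lemma V_dual_energy_diff_le: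
  assumes "in_V_dual l" "in_V_dual m"
  shows "V_dual_energy (\<lambda>v. l v - m v) \<le> 2 * V_dual_energy l + 2 * V_dual_energy m"
proof -
  have s: "summable (\<lambda>k. 2 * ((l (leg k))\<^sup>2 / (1 + leg_eigenvalue k)) + 2 * ((m (leg k))\<^sup>2 / (1 + leg_eigenvalue k)))"
    using V_dual_energy(1)[OF assms(1)] V_dual_energy(1)[OF assms(2)] by (intro summable_add summable_mult)
  have "(l (leg k) - m (leg k))\<^sup>2 / (1 + leg_eigenvalue k) \<le>
      2 * ((l (leg k))\<^sup>2 / (1 + leg_eigenvalue k)) + 2 * ((m (leg k))\<^sup>2 / (1 + leg_eigenvalue k))" for k
  proof -
    have "(a - b)\<^sup>2 \<le> 2 * a\<^sup>2 + 2 * b\<^sup>2" for a b :: real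
      using zero_le_power2[of "a + b"] by (simp add: power2_eq_square algebra_simps)
    from divide_right_mono[OF this, of "1 + leg_eigenvalue k" "l (leg k)" "m (leg k)"] show ?thesis
      by (simp add: add_divide_distrib add_nonneg_nonneg)
  qed
  then have "V_dual_energy (\<lambda>v. l v - m v) \<le> (\<Sum>k. 2 * ((l (leg k))\<^sup>2 / (1 + leg_eigenvalue k)) + 2 * ((m (leg k))\<^sup>2 / (1 + leg_eigenvalue k)))"
    unfolding V_dual_energy_def by (intro suminf_le s V_dual_energy(1)[OF in_V_dual_diff[OF assms]])
  also have "\<dots> = 2 * V_dual_energy l + 2 * V_dual_energy m"
    unfolding V_dual_energy_def
    by (intro sums_unique[symmetric] sums_add sums_mult summable_sums V_dual_energy(1) assms)
  finally show ?thesis .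
qed

lemma dual_path_diff:
  assumes l: "dual_path T l" and m: "dual_path T m"
  shows "dual_path T (\<lambda>t v. l t v - m t v)"
proof -
  have ms: "\<forall>v\<in>V. (\<lambda>t. l t v - m t v) \<in> borel_measurable (T_meas T)"
    using l m unfolding dual_path_def by (intro ballI borel_measurable_diff) auto
  have V: "AE t in T_meas T. in_V_dual (l t) \<and> in_V_dual (m t)"
    using l m by (auto simp: dual_path_def)
  have "integrable (T_meas T) (\<lambda>t. V_dual_energy (\<lambda>v. l t v - m t v))"
  proof (rule Bochner_Integration.integrable_bound)
    show "integrable (T_meas T) (\<lambda>t. 2 * V_dual_energy (l t) + 2 * V_dual_energy (m t))"
      using l m by (auto simp: dual_path_def)
    show "AE t in T_meas T. norm (V_dual_energy (\<lambda>v. l t v - m t v)) \<le> norm (2 * V_dual_energy (l t) + 2 * V_dual_energy (m t))"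
      using V by eventually_elim (use V_dual_energy_diff_le V_dual_energy(4) in_V_dual_diff in \<open>fastforce simp: abs_of_nonneg\<close>)
  qed (rule V_dual_energy_measurable_T[OF ms])
  moreover have "AE t in T_meas T. in_V_dual (\<lambda>v. l t v - m t v)"
    using V by eventually_elim (simp add: in_V_dual_diff)
  ultimately show ?thesis using ms unfolding dual_path_def by blast
qed

text \<open>Both arguments vary in time, whereas measurability is given for a fixed test vector; the
  expansion in the basis reduces the pairing to countably many measurable products.\<close>

lemma dual_pairing_integrable:
  assumes D: "dual_path T D" and z: "z \<in> energy_paths T"
  shows "(\<lambda>s. D s (z s)) \<in> borel_measurable (T_meas T)" "integrable (T_meas T) (\<lambda>s. D s (z s))"
proof -
  have zc: "continuous_on {0..T} z" and zV: "AE s in T_meas T. z s \<in> V"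
    and zi: "integrable (T_meas T) (\<lambda>s. V_energy (z s))"
    using z by (auto simp: energy_paths_iff)
  have DV: "AE s in T_meas T. in_V_dual (D s)" and Di: "integrable (T_meas T) (\<lambda>s. V_dual_energy (D s))"
    using D by (auto simp: dual_path_def)
  have [measurable]: "(\<lambda>s. inner (z s) (leg k)) \<in> borel_measurable (T_meas T)" for k
    by (intro continuous_measurable_T continuous_intros zc)
  have [measurable]: "(\<lambda>s. D s (leg k)) \<in> borel_measurable (T_meas T)" for k
    using D by (auto simp: dual_path_def)
  have "AE s in T_meas T. (\<Sum>k. inner (z s) (leg k) * D s (leg k)) = D s (z s)"
    using zV DV by eventually_elim (use in_V_dual_expansion sums_unique in fastforce)
  moreover have "(\<lambda>s. \<Sum>k. inner (z s) (leg k) * D s (leg k)) \<in> borel_measurable (T_meas T)" by measurable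
  ultimately show m: "(\<lambda>s. D s (z s)) \<in> borel_measurable (T_meas T)"
    by - (rule borel_measurable_T_AE)
  show "integrable (T_meas T) (\<lambda>s. D s (z s))"
  proof (rule Bochner_Integration.integrable_bound[OF _ m])
    show "integrable (T_meas T) (\<lambda>s. (V_dual_energy (D s) + V_energy (z s)) / 2)"
      using Di zi by simp
    show "AE s in T_meas T. norm (D s (z s)) \<le> norm ((V_dual_energy (D s) + V_energy (z s)) / 2)"
      using zV DV by eventually_elim (use dual_pairing_le in \<open>force intro: order.trans[OF _ abs_ge_self]\<close>)
  qed
qed

text \<open>For every \<open>K\<close> the equations of the first \<open>K\<close> coefficients are
  squared and summed; then \<open>K \<rightarrow> \<infinity>\<close>, with Parseval on the left and
  dominated convergence on the right. Thus \<open>z\<close> never has to be differentiated as a path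
  in \<open>V'\<close>.\<close>

lemma energy_inequality:
  assumes z: "z \<in> energy_paths T" and X: "X \<in> energy_paths T" and D: "dual_path T D"
    and eq: "\<And>k t. t \<in> {0..T} \<Longrightarrow> inner (z t) (leg k) = integral\<^sup>L (T_meas T)
       (\<lambda>s. indicator {0..t} s * (D s (leg k) - leg_eigenvalue k * (inner (z s) (leg k) + \<delta> * inner (X s) (leg k))))"
    and t: "t \<in> {0..T}"
  shows "(norm (z t))\<^sup>2 \<le> integral\<^sup>L (T_meas T) (\<lambda>s. indicator {0..t} s * (\<delta>\<^sup>2 / 2 * V_energy (X s) + 2 * D s (z s)))"
proof -
  let ?M = "T_meas T"
  have zc: "continuous_on {0..T} z" and zV: "AE s in ?M. z s \<in> V" and zi: "integrable ?M (\<lambda>s. V_energy (z s))"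
    using z by (auto simp: energy_paths_iff)
  have Xc: "continuous_on {0..T} X" and XV: "AE s in ?M. X s \<in> V" and Xi: "integrable ?M (\<lambda>s. V_energy (X s))"
    using X by (auto simp: energy_paths_iff)
  have DV: "AE s in ?M. in_V_dual (D s)" and Di: "integrable ?M (\<lambda>s. V_dual_energy (D s))"
    and Dm: "\<And>k. (\<lambda>s. D s (leg k)) \<in> borel_measurable ?M"
    using D by (auto simp: dual_path_def)
  define c where "c k s = inner (z s) (leg k)" for k s
  define x where "x k s = inner (X s) (leg k)" for k s
  define h where "h k s = D s (leg k) - leg_eigenvalue k * (c k s + \<delta> * x k s)" for k s
  have cc: "continuous_on {0..T} (c k)" for k
    unfolding c_def by (intro continuous_intros zc)
  have xc: "continuous_on {0..T} (x k)" for k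
    unfolding x_def by (intro continuous_intros Xc)
  have DI: "integrable ?M (\<lambda>s. D s (leg k))" for k
  proof (rule dual_pairing_integrable(2)[OF D])
    show "(\<lambda>_. leg k) \<in> energy_paths T"
      using integrable_continuous_T[OF continuous_on_const, of T "V_energy (leg k)"] by (simp add: energy_paths_iff)
  qed
  have hI: "integrable ?M (h k)" for k
    unfolding h_def
    by (intro Bochner_Integration.integrable_diff DI integrable_mult_right integrable_continuous_T continuous_intros cc xc)
  have sq: "(c k t)\<^sup>2 = integral\<^sup>L ?M (\<lambda>s. indicator {0..t} s * (2 * (c k s * h k s)))" for k
    by (rule AC_square[OF hI _ t]) (auto simp: c_def h_def x_def eq)
  have chI: "integrable ?M (\<lambda>s. c k s * h k s)" for k
    by (rule integrable_continuous_mult_T[OF cc hI])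
  have cDI: "integrable ?M (\<lambda>s. c k s * D s (leg k))" for k
    by (rule integrable_continuous_mult_T[OF cc DI])
  have le: "(\<Sum>k<K. (c k t)\<^sup>2) \<le>
      integral\<^sup>L ?M (\<lambda>s. indicator {0..t} s * (\<delta>\<^sup>2 / 2 * V_energy (X s) + 2 * (\<Sum>k<K. c k s * D s (leg k))))" for K
  proof -
    have "(\<Sum>k<K. (c k t)\<^sup>2) = integral\<^sup>L ?M (\<lambda>s. \<Sum>k<K. indicator {0..t} s * (2 * (c k s * h k s)))"
      unfolding sq by (rule Bochner_Integration.integral_sum[symmetric]) (intro integrable_indicator_T integrable_mult_right chI)
    also have "\<dots> \<le> integral\<^sup>L ?M (\<lambda>s. indicator {0..t} s * (\<delta>\<^sup>2 / 2 * V_energy (X s) + 2 * (\<Sum>k<K. c k s * D s (leg k))))"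
    proof (rule integral_mono_AE)
      show "integrable ?M (\<lambda>s. \<Sum>k<K. indicator {0..t} s * (2 * (c k s * h k s)))"
        by (intro Bochner_Integration.integrable_sum integrable_indicator_T integrable_mult_right chI)
      show "integrable ?M (\<lambda>s. indicator {0..t} s * (\<delta>\<^sup>2 / 2 * V_energy (X s) + 2 * (\<Sum>k<K. c k s * D s (leg k))))"
        by (intro integrable_indicator_T Bochner_Integration.integrable_add integrable_mult_right Xi Bochner_Integration.integrable_sum cDI)
      show "AE s in ?M. (\<Sum>k<K. indicator {0..t} s * (2 * (c k s * h k s))) \<le>
          indicator {0..t} s * (\<delta>\<^sup>2 / 2 * V_energy (X s) + 2 * (\<Sum>k<K. c k s * D s (leg k)))"
        using XV
      proof eventually_elim
        case (elim s)
        have "2 * (c k s * h k s) \<le> \<delta>\<^sup>2 / 2 * ((1 + leg_eigenvalue k) * (x k s)\<^sup>2) + 2 * (c k s * D s (leg k))" for k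
        proof -
          \<comment> \<open>Half of this expression is the difference of the two sides: with
            \<open>\<mu>\<close> the eigenvalue, the cross term \<open>2 \<mu> \<delta> c x\<close>
            is absorbed by \<open>2 \<mu> c^2\<close> at the price
            \<open>\<delta>^2 \<mu> x^2 / 2\<close>, and the extra \<open>x^2\<close> completes the
            weight to \<open>1 + \<mu>\<close>.\<close>
          have "0 \<le> leg_eigenvalue k * (2 * c k s + \<delta> * x k s)\<^sup>2 + \<delta>\<^sup>2 * (x k s)\<^sup>2"
            by (intro add_nonneg_nonneg mult_nonneg_nonneg) auto
          then show ?thesis by (simp add: h_def power2_eq_square algebra_simps)
        qed
        then have "(\<Sum>k<K. 2 * (c k s * h k s)) \<le> (\<Sum>k<K. \<delta>\<^sup>2 / 2 * ((1 + leg_eigenvalue k) * (x k s)\<^sup>2) + 2 * (c k s * D s (leg k)))"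
          by (rule sum_mono)
        also have "\<dots> = \<delta>\<^sup>2 / 2 * (\<Sum>k<K. (1 + leg_eigenvalue k) * (x k s)\<^sup>2) + 2 * (\<Sum>k<K. c k s * D s (leg k))"
          by (simp only: sum.distrib sum_distrib_left)
        also have "\<dots> \<le> \<delta>\<^sup>2 / 2 * V_energy (X s) + 2 * (\<Sum>k<K. c k s * D s (leg k))"
          using V_energy_partial[OF elim, of K] by (intro add_right_mono mult_left_mono) (auto simp: x_def)
        finally show ?case
          unfolding sum_distrib_left[symmetric, of "indicator {0..t} s"] by (rule mult_left_mono) auto
      qed
    qed
    finally show ?thesis .
  qed
  have "(\<lambda>K. integral\<^sup>L ?M (\<lambda>s. indicator {0..t} s * (\<delta>\<^sup>2 / 2 * V_energy (X s) + 2 * (\<Sum>k<K. c k s * D s (leg k)))))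
     \<longlonglongrightarrow> integral\<^sup>L ?M (\<lambda>s. indicator {0..t} s * (\<delta>\<^sup>2 / 2 * V_energy (X s) + 2 * D s (z s)))"
  \<comment> \<open>Twice a partial pairing is at most the sum of the two energies, uniformly in
    \<open>K\<close>.\<close>
  proof (rule integral_dominated_convergence[where w = "\<lambda>s. \<delta>\<^sup>2 / 2 * V_energy (X s) + (V_dual_energy (D s) + V_energy (z s))"])
    show "(\<lambda>s. indicator {0..t} s * (\<delta>\<^sup>2 / 2 * V_energy (X s) + 2 * D s (z s))) \<in> borel_measurable ?M"
      by (intro borel_measurable_integrable integrable_indicator_T Bochner_Integration.integrable_add integrable_mult_right Xi
          dual_pairing_integrable(2) D z)
    show "(\<lambda>s. indicator {0..t} s * (\<delta>\<^sup>2 / 2 * V_energy (X s) + 2 * (\<Sum>k<K. c k s * D s (leg k)))) \<in> borel_measurable ?M" for K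
      by (intro borel_measurable_integrable integrable_indicator_T Bochner_Integration.integrable_add integrable_mult_right Xi Bochner_Integration.integrable_sum cDI)
    show "integrable ?M (\<lambda>s. \<delta>\<^sup>2 / 2 * V_energy (X s) + (V_dual_energy (D s) + V_energy (z s)))"
      by (intro Bochner_Integration.integrable_add integrable_mult_right Xi Di zi)
    show "AE s in ?M. (\<lambda>K. indicator {0..t} s * (\<delta>\<^sup>2 / 2 * V_energy (X s) + 2 * (\<Sum>k<K. c k s * D s (leg k)))) \<longlonglongrightarrow>
        indicator {0..t} s * (\<delta>\<^sup>2 / 2 * V_energy (X s) + 2 * D s (z s))"
      using zV DV
    proof eventually_elim
      case (elim s)
      then show ?case
        using in_V_dual_expansion[of "D s" "z s"] unfolding sums_def c_def by (intro tendsto_intros) auto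
    qed
    show "AE s in ?M. norm (indicator {0..t} s * (\<delta>\<^sup>2 / 2 * V_energy (X s) + 2 * (\<Sum>k<K. c k s * D s (leg k)))) \<le>
        \<delta>\<^sup>2 / 2 * V_energy (X s) + (V_dual_energy (D s) + V_energy (z s))" for K
      using zV DV XV
    proof eventually_elim
      case (elim s)
      have "\<bar>\<Sum>k<K. c k s * D s (leg k)\<bar> \<le> (V_dual_energy (D s) + V_energy (z s)) / 2"
        unfolding c_def using elim by (intro dual_pairing_partial_le)
      moreover have "0 \<le> \<delta>\<^sup>2 / 2 * V_energy (X s)" using V_energy_nonneg elim by simp
      ultimately show ?case by (auto simp: indicator_def)
    qed
  qed
  moreover have "(\<lambda>K. \<Sum>k<K. (c k t)\<^sup>2) \<longlonglongrightarrow> (norm (z t))\<^sup>2"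
    using parseval[of "z t"] by (simp add: sums_def c_def)
  ultimately show ?thesis using le by (intro LIMSEQ_le) auto
qed

section \<open>The pathwise estimate\<close>

text \<open>With \<open>p\<close> and \<open>q\<close> the increments on the left and on the right,
  \<open>q * h\<close> is never negative and \<open>p\<close> has weakly the sign of
  \<open>\<zeta> + h\<close>. If this is also the sign of \<open>\<zeta>\<close>, then
  \<open>p * \<zeta> \<ge> 0\<close>; otherwise
  \<open>\<bar>\<zeta>\<bar> \<le> \<bar>h\<bar>\<close> and
  \<open>\<bar>p\<bar> \<le> \<bar>q\<bar>\<close>.\<close>

lemma monotone_noise_bound:
  fixes g :: "real \<Rightarrow> real"
  assumes "mono g"
  shows "- (g (b + \<zeta> + h) - g b) * \<zeta> \<le> (g (b + h) - g b) * h"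
proof -
  define p where "p = g (b + \<zeta> + h) - g b"
  define q where "q = g (b + h) - g b"
  have m: "g x \<le> g y" if "x \<le> y" for x y using assms that by (rule monoD)
  have "0 \<le> p * \<zeta> + q * h"
  proof (cases "h \<ge> 0")
    case h: True
    have q: "q \<ge> 0" using m[of b "b + h"] h by (simp add: q_def)
    show ?thesis
    proof (cases "\<zeta> \<ge> 0")
      case True
      then have "p \<ge> 0" using m[of b "b + \<zeta> + h"] h by (simp add: p_def)
      then show ?thesis using q h True by simp
    next
      case \<zeta>: False
      then have pq: "p \<le> q" using m[of "b + \<zeta> + h" "b + h"] by (simp add: p_def q_def)
      show ?thesis
      proof (cases "\<zeta> + h \<ge> 0")
        case True
        then have "p * (- \<zeta>) \<le> q * h" using pq q \<zeta> h m[of b "b + \<zeta> + h"]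
          by (intro mult_mono) auto
        then show ?thesis by simp
      next
        case False
        then have "p \<le> 0" using m[of "b + \<zeta> + h" b] by (simp add: p_def)
        then have "0 \<le> p * \<zeta>" using \<zeta> by (simp add: mult_nonpos_nonpos)
        then show ?thesis using q h by simp
      qed
    qed
  next
    case h: False
    have q: "q \<le> 0" using m[of "b + h" b] h by (simp add: q_def)
    then have qh: "0 \<le> q * h" using h by (simp add: mult_nonpos_nonpos)
    show ?thesis
    proof (cases "\<zeta> \<le> 0")
      case True
      then have "p \<le> 0" using m[of "b + \<zeta> + h" b] h by (simp add: p_def)
      then show ?thesis using qh True by (simp add: mult_nonpos_nonpos)
    next
      case \<zeta>: False
      then have pq: "q \<le> p" using m[of "b + h" "b + \<zeta> + h"] by (simp add: p_def q_def)
      show ?thesis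
      proof (cases "\<zeta> + h \<le> 0")
        case True
        then have "(- p) * \<zeta> \<le> (- q) * (- h)" using pq q \<zeta> h m[of "b + \<zeta> + h" b]
          by (intro mult_mono) auto
        then show ?thesis by simp
      next
        case False
        then have "0 \<le> p" using m[of b "b + \<zeta> + h"] by (simp add: p_def)
        then show ?thesis using \<zeta> qh by simp
      qed
    qed
  qed
  then show ?thesis unfolding p_def q_def minus_mult_left[symmetric] by linarith
qed

text \<open>Monotonicity moves the right-hand side from \<open>b + \<delta> h\<close> to
  \<open>b + h\<close> for \<open>\<delta> \<le> 1\<close>. Apart from the factor in front it no
  longer depends on \<open>\<delta>\<close>, so a single constant will serve all noise
  levels.\<close>

lemma monotone_scaled_noise_bound:
  fixes g :: "real \<Rightarrow> real"
  assumes "mono g" "0 \<le> \<delta>" "\<delta> \<le> 1"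
  shows "- (g (b + \<zeta> + \<delta> * h) - g b) * \<zeta> \<le> \<delta> * ((g (b + h) - g b) * h)"
proof -
  have m: "g x \<le> g y" if "x \<le> y" for x y using assms(1) that by (rule monoD)
  have "(g (b + \<delta> * h) - g b) * h \<le> (g (b + h) - g b) * h"
  proof (cases "h \<ge> 0")
    case True
    then show ?thesis using assms mult_right_mono[of \<delta> 1 h] by (intro mult_right_mono diff_right_mono m) auto
  next
    case False
    then show ?thesis using assms mult_right_mono_neg[of \<delta> 1 h] by (intro mult_right_mono_neg diff_right_mono m) auto
  qed
  then have "\<delta> * ((g (b + \<delta> * h) - g b) * h) \<le> \<delta> * ((g (b + h) - g b) * h)"
    using assms(2) by (rule mult_left_mono)
  then show ?thesis using monotone_noise_bound[OF assms(1), of b \<zeta> "\<delta> * h"] by (simp add: mult_ac)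
qed

section \<open>The reaction term along admissible paths\<close>

locale reaction_diffusion =
  fixes T Q S1 L :: real and S g \<beta> :: "real \<Rightarrow> real" and u0 :: L2I and f :: "real \<Rightarrow> L2I \<Rightarrow> real"
  assumes T: "T > 0" and Q: "Q > 0"
    and S_bound: "AE x in I_meas. \<bar>S x\<bar> \<le> S1"
    and g_mono: "mono g"
    and \<beta>_Lipschitz: "\<And>x y. \<bar>\<beta> x - \<beta> y\<bar> \<le> L * \<bar>x - y\<bar>" and S1: "S1 \<ge> 0" and L: "L \<ge> 0"
    and acts: "\<And>w. w \<in> energy_paths T \<Longrightarrow> AE t in T_meas T. acts_on_V (reaction Q S \<beta> g (w t))"
    and dual: "\<And>w. w \<in> energy_paths T \<Longrightarrow> total_forcing Q S \<beta> g f w \<in> L2_V_dual T"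
begin

abbreviation "lip \<equiv> Q * S1 * L"

lemma lip_nonneg: "lip \<ge> 0"
  using Q S1 L by simp

lemma \<beta>_bound:
  assumes "\<bar>S x\<bar> \<le> S1"
  shows "\<bar>Q * S x * \<beta> a - Q * S x * \<beta> b\<bar> \<le> lip * \<bar>a - b\<bar>"
proof -
  have "\<bar>Q * S x * \<beta> a - Q * S x * \<beta> b\<bar> = Q * (\<bar>S x\<bar> * \<bar>\<beta> a - \<beta> b\<bar>)"
    using Q by (simp add: abs_mult right_diff_distrib[symmetric] mult.assoc)
  also have "\<dots> \<le> Q * (S1 * (L * \<bar>a - b\<bar>))"
    using Q S1 assms by (intro mult_left_mono mult_mono \<beta>_Lipschitz) auto
  finally show ?thesis by (simp add: mult_ac)
qed

text \<open>The Lipschitz part is estimated directly and \<open>g\<close> by monotonicity. The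
  result is phrased through \<open>r\<close>, not \<open>g\<close>, because integrability against
  elements of \<open>V\<close> is assumed for the reaction as a whole.\<close>

lemma reaction_pointwise:
  assumes S: "\<bar>S x\<bar> \<le> S1" and \<delta>: "0 \<le> \<delta>" "\<delta> \<le> 1"
  defines "r a \<equiv> Q * S x * \<beta> a - g a"
  shows "(r (b + \<zeta> + \<delta> * \<xi>) - r b) * \<zeta> \<le>
     lip * (2 * \<zeta>\<^sup>2 + 2 * \<delta> * \<xi>\<^sup>2) + \<delta> * ((r b - r (b + \<xi>)) * \<xi>)"
proof -
  have "(Q * S x * \<beta> (b + \<zeta> + \<delta> * \<xi>) - Q * S x * \<beta> b) * \<zeta> \<le> \<bar>Q * S x * \<beta> (b + \<zeta> + \<delta> * \<xi>) - Q * S x * \<beta> b\<bar> * \<bar>\<zeta>\<bar>"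
    unfolding abs_mult[symmetric] by (rule abs_ge_self)
  also have "\<dots> \<le> lip * \<bar>\<zeta> + \<delta> * \<xi>\<bar> * \<bar>\<zeta>\<bar>"
    using \<beta>_bound[OF S, of "b + \<zeta> + \<delta> * \<xi>" b] by (intro mult_right_mono) (auto simp: add.assoc)
  also have "\<dots> \<le> lip * (2 * \<zeta>\<^sup>2 + \<delta> * \<xi>\<^sup>2)"
  proof -
    have "\<bar>\<zeta> + \<delta> * \<xi>\<bar> * \<bar>\<zeta>\<bar> = \<bar>\<zeta>\<^sup>2 + \<delta> * (\<xi> * \<zeta>)\<bar>"
      unfolding abs_mult[symmetric] by (simp add: power2_eq_square algebra_simps)
    also have "\<dots> \<le> \<zeta>\<^sup>2 + \<delta> * \<bar>\<xi> * \<zeta>\<bar>"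
      using \<delta> abs_triangle_ineq[of "\<zeta>\<^sup>2" "\<delta> * (\<xi> * \<zeta>)"] by (simp add: abs_mult)
    also have "\<delta> * \<bar>\<xi> * \<zeta>\<bar> \<le> \<delta> * (\<xi>\<^sup>2 + \<zeta>\<^sup>2)"
    proof (rule mult_left_mono[OF _ \<delta>(1)])
      have "0 \<le> (\<bar>\<xi>\<bar> - \<bar>\<zeta>\<bar>)\<^sup>2" by simp
      then have "2 * \<bar>\<xi> * \<zeta>\<bar> \<le> \<xi>\<^sup>2 + \<zeta>\<^sup>2" by (simp add: power2_diff abs_mult)
      then show "\<bar>\<xi> * \<zeta>\<bar> \<le> \<xi>\<^sup>2 + \<zeta>\<^sup>2" using abs_ge_zero[of "\<xi> * \<zeta>"] by linarith
    qed
    also have "\<delta> * (\<xi>\<^sup>2 + \<zeta>\<^sup>2) \<le> \<delta> * \<xi>\<^sup>2 + \<zeta>\<^sup>2"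
      using \<delta> mult_right_mono[of \<delta> 1 "\<zeta>\<^sup>2"] by (simp add: distrib_left)
    finally have "\<bar>\<zeta> + \<delta> * \<xi>\<bar> * \<bar>\<zeta>\<bar> \<le> 2 * \<zeta>\<^sup>2 + \<delta> * \<xi>\<^sup>2" by simp
    from mult_left_mono[OF this lip_nonneg] show ?thesis by (simp add: mult.assoc)
  qed
  finally have 1: "(Q * S x * \<beta> (b + \<zeta> + \<delta> * \<xi>) - Q * S x * \<beta> b) * \<zeta> \<le> lip * (2 * \<zeta>\<^sup>2 + \<delta> * \<xi>\<^sup>2)" .
  \<comment> \<open>Trading the increment of \<open>g\<close> for that of \<open>r\<close> costs the
    increment of the Lipschitz part, one more \<open>lip * \<xi>^2\<close>; this is why the
    statement has \<open>2 * \<delta>\<close>.\<close>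
  have "(Q * S x * \<beta> (b + \<xi>) - Q * S x * \<beta> b) * \<xi> \<le> \<bar>Q * S x * \<beta> (b + \<xi>) - Q * S x * \<beta> b\<bar> * \<bar>\<xi>\<bar>"
    unfolding abs_mult[symmetric] by (rule abs_ge_self)
  also have "\<dots> \<le> lip * \<bar>\<xi>\<bar> * \<bar>\<xi>\<bar>"
    using \<beta>_bound[OF S, of "b + \<xi>" b] by (intro mult_right_mono) auto
  also have "\<dots> = lip * \<xi>\<^sup>2" by (simp add: power2_eq_square mult.assoc flip: abs_mult)
  finally have "(g (b + \<xi>) - g b) * \<xi> \<le> (r b - r (b + \<xi>)) * \<xi> + lip * \<xi>\<^sup>2"
    by (simp add: r_def algebra_simps)
  from mult_left_mono[OF this \<delta>(1)]
  have "- (g (b + \<zeta> + \<delta> * \<xi>) - g b) * \<zeta> \<le> \<delta> * ((r b - r (b + \<xi>)) * \<xi>) + lip * (\<delta> * \<xi>\<^sup>2)"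
    using monotone_scaled_noise_bound[OF g_mono \<delta>, of b \<zeta> \<xi>] by (simp add: distrib_left mult_ac)
  with 1 show ?thesis by (simp add: r_def algebra_simps)
qed

lemma dual_path_forcing: "w \<in> energy_paths T \<Longrightarrow> dual_path T (total_forcing Q S \<beta> g f w)"
  by (intro L2_V_dual_imp_dual_path dual)

text \<open>Integration of the pointwise bound over the interval. The three arguments for which
  \<open>acts_on_V\<close> is assumed make each of the four products integrable, so that the
  integrals may be split.\<close>

lemma forcing_difference_bound:
  assumes a: "acts_on_V (reaction Q S \<beta> g a)" and b: "acts_on_V (reaction Q S \<beta> g b)"
    and bx: "acts_on_V (reaction Q S \<beta> g (b + \<xi>))"
    and \<zeta>: "\<zeta> \<in> V" and \<xi>: "\<xi> \<in> V" and eq: "a = b + \<zeta> + \<delta> *\<^sub>R \<xi>" and \<delta>: "0 \<le> \<delta>" "\<delta> \<le> 1"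
  shows "fun_pairing (reaction Q S \<beta> g a) \<zeta> - fun_pairing (reaction Q S \<beta> g b) \<zeta> \<le>
     lip * (2 * (norm \<zeta>)\<^sup>2 + 2 * \<delta> * (norm \<xi>)\<^sup>2)
     + \<delta> * (fun_pairing (reaction Q S \<beta> g b) \<xi> - fun_pairing (reaction Q S \<beta> g (b + \<xi>)) \<xi>)"
proof -
  let ?R = "reaction Q S \<beta> g"
  have i1: "integrable I_meas (\<lambda>x. ?R a x * fun_of \<zeta> x)" and i2: "integrable I_meas (\<lambda>x. ?R b x * fun_of \<zeta> x)"
    and i3: "integrable I_meas (\<lambda>x. ?R b x * fun_of \<xi> x)" and i4: "integrable I_meas (\<lambda>x. ?R (b + \<xi>) x * fun_of \<xi> x)"
    using a b bx \<zeta> \<xi> by (auto simp: acts_on_V_def)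
  have "fun_pairing (?R a) \<zeta> - fun_pairing (?R b) \<zeta> = integral\<^sup>L I_meas (\<lambda>x. ?R a x * fun_of \<zeta> x - ?R b x * fun_of \<zeta> x)"
    unfolding fun_pairing_def by (rule Bochner_Integration.integral_diff[OF i1 i2, symmetric])
  also have "\<dots> \<le> integral\<^sup>L I_meas (\<lambda>x. lip * (2 * (fun_of \<zeta> x)\<^sup>2 + 2 * \<delta> * (fun_of \<xi> x)\<^sup>2) +
      \<delta> * (?R b x * fun_of \<xi> x - ?R (b + \<xi>) x * fun_of \<xi> x))"
  proof (rule integral_mono_AE)
    show "AE x in I_meas. ?R a x * fun_of \<zeta> x - ?R b x * fun_of \<zeta> x \<le> lip * (2 * (fun_of \<zeta> x)\<^sup>2 + 2 * \<delta> * (fun_of \<xi> x)\<^sup>2) +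
      \<delta> * (?R b x * fun_of \<xi> x - ?R (b + \<xi>) x * fun_of \<xi> x)"
      using S_bound fun_of_add[of "b + \<zeta>" "\<delta> *\<^sub>R \<xi>"] fun_of_add[of b \<zeta>] fun_of_scaleR[of \<delta> \<xi>] fun_of_add[of b \<xi>]
    proof eventually_elim
      case (elim x)
      then show ?case
        using reaction_pointwise[OF elim(1) \<delta>, of "fun_of b x" "fun_of \<zeta> x" "fun_of \<xi> x"]
        by (simp add: reaction_def eq left_diff_distrib)
    qed
  qed (intro Bochner_Integration.integrable_add Bochner_Integration.integrable_diff integrable_mult_right i1 i2 i3 i4 fun_of_square_integral)+
  also have "\<dots> = lip * (2 * (norm \<zeta>)\<^sup>2 + 2 * \<delta> * (norm \<xi>)\<^sup>2)
     + \<delta> * (fun_pairing (?R b) \<xi> - fun_pairing (?R (b + \<xi>)) \<xi>)"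
    using i3 i4 by (simp add: fun_pairing_def norm_fun_of fun_of_square_integral)
  finally show ?thesis .
qed

text \<open>\<open>A\<close> is chosen before \<open>\<delta>\<close>, \<open>v\<close> and
  \<open>N\<close>: it depends on the path of the noise and on the deterministic solution, hence
  serves all \<open>n\<close> simultaneously.\<close>

lemma pathwise_estimate:
  assumes X: "X \<in> energy_paths T" and b: "b \<in> energy_paths T"
    and b_eq: "weak_equation T Q S \<beta> g f u0 (\<lambda>v t. 0) b"
  shows "\<exists>A. \<forall>\<delta> v N. 0 \<le> \<delta> \<longrightarrow> \<delta> \<le> 1 \<longrightarrow> v \<in> energy_paths T \<longrightarrow>
     weak_equation T Q S \<beta> g f u0 (\<lambda>w t. \<delta> * N w t) v \<longrightarrow>
     (\<forall>k. \<forall>t\<in>{0..T}. N (leg k) t = inner (X t) (leg k)) \<longrightarrow>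
     (\<forall>t\<in>{0..T}. (norm (v t - b t - \<delta> *\<^sub>R X t))\<^sup>2 \<le> \<delta> * A)"
proof -
  let ?M = "T_meas T"
  let ?F = "total_forcing Q S \<beta> g f"
  have bX: "(\<lambda>t. b t + X t) \<in> energy_paths T" by (rule energy_paths_add[OF b X])
  \<comment> \<open>The part of \<open>f\<close> cancels, and \<open>E s (X s)\<close> is integrable
    in time because both \<open>b\<close> and \<open>b + X\<close> are admissible arguments of the
    forcing.\<close>
  define E where "E t v = ?F b t v - ?F (\<lambda>t. b t + X t) t v" for t v
  have E: "dual_path T E"
    unfolding E_def by (intro dual_path_diff dual_path_forcing b bX)
  have EX: "integrable ?M (\<lambda>s. E s (X s))" by (rule dual_pairing_integrable(2)[OF E X])
  have Xc: "continuous_on {0..T} X" and XV: "AE s in ?M. X s \<in> V" and Xi: "integrable ?M (\<lambda>s. V_energy (X s))"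
    using X by (auto simp: energy_paths_iff)
  have X2: "integrable ?M (\<lambda>s. (norm (X s))\<^sup>2)"
    by (intro integrable_continuous_T continuous_intros Xc)
  \<comment> \<open>Collects what multiplies \<open>\<delta>\<close> after the forcing bound is
    doubled, using \<open>\<delta>^2 \<le> \<delta>\<close>. The absolute value makes
    \<open>k\<close> nonnegative almost everywhere, so the integral over \<open>(0,t)\<close> may be
    enlarged to \<open>(0,T)\<close>.\<close>
  define k where "k s = V_energy (X s) / 2 + 4 * lip * (norm (X s))\<^sup>2 + 2 * \<bar>E s (X s)\<bar>" for s
  have k: "integrable ?M k"
    unfolding k_def using EX Xi X2 by simp
  have "(norm (v t - b t - \<delta> *\<^sub>R X t))\<^sup>2 \<le> \<delta> * (integral\<^sup>L ?M k * exp (4 * lip * T))"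
    if \<delta>: "0 \<le> \<delta>" "\<delta> \<le> 1" and v: "v \<in> energy_paths T"
      and v_eq: "weak_equation T Q S \<beta> g f u0 (\<lambda>w t. \<delta> * N w t) v"
      and N: "\<And>k t. t \<in> {0..T} \<Longrightarrow> N (leg k) t = inner (X t) (leg k)" and t: "t \<in> {0..T}"
    for \<delta> v t and N :: "L2I \<Rightarrow> real \<Rightarrow> real"
  proof -
    define z where "z t = v t - b t - \<delta> *\<^sub>R X t" for t
    define D where "D t w = ?F v t w - ?F b t w" for t w
    have D: "dual_path T D"
      unfolding D_def by (intro dual_path_diff dual_path_forcing b v)
    have z: "z \<in> energy_paths T"
    proof -
      have "(\<lambda>t. (v t + (-1) *\<^sub>R b t) + (- \<delta>) *\<^sub>R X t) \<in> energy_paths T"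
        by (intro energy_paths_add energy_paths_scaleR v b X)
      then show ?thesis by (simp add: z_def[abs_def])
    qed
    have zc: "continuous_on {0..T} z" and zV: "AE s in ?M. z s \<in> V"
      using z by (auto simp: energy_paths_iff)
    \<comment> \<open>Subtracting \<open>\<delta> X\<close> removes the noise term, and
      \<open>u0\<close> cancels; the form still sees \<open>v - b = z + \<delta> X\<close>, which
      explains the last summand.\<close>
    have eq: "inner (z t) (leg j) = integral\<^sup>L ?M
       (\<lambda>s. indicator {0..t} s * (D s (leg j) - leg_eigenvalue j * (inner (z s) (leg j) + \<delta> * inner (X s) (leg j))))"
      if t: "t \<in> {0..T}" for j t
    proof -
      have form: "integral\<^sup>L (lebesgue_on {0..t}) (\<lambda>s. V_form (w s) (leg j)) =
          integral\<^sup>L ?M (\<lambda>s. indicator {0..t} s * (leg_eigenvalue j * inner (w s) (leg j)))"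
        and formi: "integrable ?M (\<lambda>s. indicator {0..t} s * (leg_eigenvalue j * inner (w s) (leg j)))"
        if w: "w \<in> energy_paths T" for w
      proof -
        have "continuous_on {0..T} w" using w by (simp add: energy_paths_iff)
        then have i: "integrable ?M (\<lambda>s. leg_eigenvalue j * inner (w s) (leg j))"
          by (intro integrable_continuous_T continuous_intros)
        then show "integrable ?M (\<lambda>s. indicator {0..t} s * (leg_eigenvalue j * inner (w s) (leg j)))"
          by (rule integrable_indicator_T)
        have "AE s in ?M. w s \<in> V" using w by (simp add: energy_paths_iff)
        then have "AE s in ?M. V_form (w s) (leg j) = leg_eigenvalue j * inner (w s) (leg j)"
          by eventually_elim (rule V_form_leg)
        then show "integral\<^sup>L (lebesgue_on {0..t}) (\<lambda>s. V_form (w s) (leg j)) =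
          integral\<^sup>L ?M (\<lambda>s. indicator {0..t} s * (leg_eigenvalue j * inner (w s) (leg j)))"
          by (intro integral_closed_interval i t)
      qed
      have force: "integral\<^sup>L (lebesgue_on {0..t}) (\<lambda>s. ?F w s (leg j)) = integral\<^sup>L ?M (\<lambda>s. indicator {0..t} s * ?F w s (leg j))"
        and forcei: "integrable ?M (\<lambda>s. indicator {0..t} s * ?F w s (leg j))"
        if w: "w \<in> energy_paths T" for w
      proof -
        have "(\<lambda>_. leg j) \<in> energy_paths T"
          using integrable_continuous_T[OF continuous_on_const, of T "V_energy (leg j)"] by (simp add: energy_paths_iff)
        from dual_pairing_integrable(2)[OF dual_path_forcing[OF w] this]
        have i: "integrable ?M (\<lambda>s. ?F w s (leg j))" .
        then show "integrable ?M (\<lambda>s. indicator {0..t} s * ?F w s (leg j))" by (rule integrable_indicator_T)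
        show "integral\<^sup>L (lebesgue_on {0..t}) (\<lambda>s. ?F w s (leg j)) = integral\<^sup>L ?M (\<lambda>s. indicator {0..t} s * ?F w s (leg j))"
          by (intro integral_closed_interval i t) auto
      qed
      have 1: "inner (v t) (leg j) = inner u0 (leg j)
          - integral\<^sup>L ?M (\<lambda>s. indicator {0..t} s * (leg_eigenvalue j * inner (v s) (leg j)))
          + integral\<^sup>L ?M (\<lambda>s. indicator {0..t} s * ?F v s (leg j)) + \<delta> * inner (X t) (leg j)"
        using v_eq t leg_V N[OF t] unfolding weak_equation_def form[OF v, symmetric] force[OF v, symmetric] by simp
      have 2: "inner (b t) (leg j) = inner u0 (leg j)
          - integral\<^sup>L ?M (\<lambda>s. indicator {0..t} s * (leg_eigenvalue j * inner (b s) (leg j)))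
          + integral\<^sup>L ?M (\<lambda>s. indicator {0..t} s * ?F b s (leg j))"
        using b_eq t leg_V unfolding weak_equation_def form[OF b, symmetric] force[OF b, symmetric] by simp
      have "inner (z t) (leg j) =
          (integral\<^sup>L ?M (\<lambda>s. indicator {0..t} s * ?F v s (leg j)) - integral\<^sup>L ?M (\<lambda>s. indicator {0..t} s * ?F b s (leg j)))
          - (integral\<^sup>L ?M (\<lambda>s. indicator {0..t} s * (leg_eigenvalue j * inner (v s) (leg j)))
           - integral\<^sup>L ?M (\<lambda>s. indicator {0..t} s * (leg_eigenvalue j * inner (b s) (leg j))))"
        unfolding z_def inner_diff_left inner_scaleR_left 1 2 by simp
      also have "\<dots> = integral\<^sup>L ?M (\<lambda>s. (indicator {0..t} s * ?F v s (leg j) - indicator {0..t} s * ?F b s (leg j))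
          - (indicator {0..t} s * (leg_eigenvalue j * inner (v s) (leg j)) - indicator {0..t} s * (leg_eigenvalue j * inner (b s) (leg j))))"
        using forcei[OF v] forcei[OF b] formi[OF v] formi[OF b]
        by (simp only: Bochner_Integration.integral_diff Bochner_Integration.integrable_diff)
      also have "\<dots> = integral\<^sup>L ?M
       (\<lambda>s. indicator {0..t} s * (D s (leg j) - leg_eigenvalue j * (inner (z s) (leg j) + \<delta> * inner (X s) (leg j))))"
        by (rule Bochner_Integration.integral_cong[OF refl]) (simp add: D_def z_def inner_diff_left algebra_simps)
      finally show ?thesis .
    qed
    have bound: "AE s in ?M. D s (z s) \<le> 2 * lip * (norm (z s))\<^sup>2 + \<delta> * (2 * lip * (norm (X s))\<^sup>2 + E s (X s))"
      using acts[OF v] acts[OF b] acts[OF bX] zV XV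
    proof eventually_elim
      case (elim s)
      have "v s = b s + z s + \<delta> *\<^sub>R X s" by (simp add: z_def)
      from forcing_difference_bound[OF elim this \<delta>] show ?case
        by (simp add: D_def E_def total_forcing_def algebra_simps)
    qed
    have main: "(norm (z t))\<^sup>2 \<le> \<delta> * integral\<^sup>L ?M k + 4 * lip * integral {0..t} (\<lambda>s. (norm (z s))\<^sup>2)"
      if t: "t \<in> {0..T}" for t
    proof -
      have z2: "integrable ?M (\<lambda>s. (norm (z s))\<^sup>2)"
        by (intro integrable_continuous_T continuous_intros zc)
      have "(norm (z t))\<^sup>2 \<le> integral\<^sup>L ?M (\<lambda>s. indicator {0..t} s * (\<delta>\<^sup>2 / 2 * V_energy (X s) + 2 * D s (z s)))"
        by (rule energy_inequality[OF z X D eq t])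
      also have "\<dots> \<le> integral\<^sup>L ?M (\<lambda>s. \<delta> * k s + 4 * lip * (indicator {0..t} s * (norm (z s))\<^sup>2))"
      proof (rule integral_mono_AE)
        show "integrable ?M (\<lambda>s. indicator {0..t} s * (\<delta>\<^sup>2 / 2 * V_energy (X s) + 2 * D s (z s)))"
          by (intro integrable_indicator_T Bochner_Integration.integrable_add integrable_mult_right Xi dual_pairing_integrable(2) D z)
        show "integrable ?M (\<lambda>s. \<delta> * k s + 4 * lip * (indicator {0..t} s * (norm (z s))\<^sup>2))"
          by (intro Bochner_Integration.integrable_add integrable_mult_right k integrable_indicator_T z2)
        show "AE s in ?M. indicator {0..t} s * (\<delta>\<^sup>2 / 2 * V_energy (X s) + 2 * D s (z s)) \<le>
            \<delta> * k s + 4 * lip * (indicator {0..t} s * (norm (z s))\<^sup>2)"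
          using bound XV
        proof eventually_elim
          case (elim s)
          have V0: "0 \<le> V_energy (X s)" using V_energy_nonneg elim by simp
          have "\<delta>\<^sup>2 \<le> \<delta>" using \<delta> mult_right_mono[of \<delta> 1 \<delta>] by (simp add: power2_eq_square)
          then have "\<delta>\<^sup>2 / 2 * V_energy (X s) \<le> \<delta> / 2 * V_energy (X s)"
            using V0 by (intro mult_right_mono) auto
          moreover have "\<delta> * E s (X s) \<le> \<delta> * \<bar>E s (X s)\<bar>" using \<delta> by (intro mult_left_mono) auto
          ultimately have "\<delta>\<^sup>2 / 2 * V_energy (X s) + 2 * D s (z s) \<le> \<delta> * k s + 4 * lip * (norm (z s))\<^sup>2"
            using elim(1) by (simp add: k_def algebra_simps)
          moreover have "0 \<le> \<delta> * k s"
            using \<delta> V0 lip_nonneg unfolding k_def by (intro mult_nonneg_nonneg[of \<delta>] add_nonneg_nonneg mult_nonneg_nonneg[of "4 * lip"]) auto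
          ultimately show ?case by (auto simp: indicator_def)
        qed
      qed
      also have "\<dots> = \<delta> * integral\<^sup>L ?M k + 4 * lip * integral\<^sup>L ?M (\<lambda>s. indicator {0..t} s * (norm (z s))\<^sup>2)"
        using k integrable_indicator_T[OF z2, of t] by simp
      also have "integral\<^sup>L ?M (\<lambda>s. indicator {0..t} s * (norm (z s))\<^sup>2) = integral\<^sup>L (lebesgue_on {0..t}) (\<lambda>s. (norm (z s))\<^sup>2)"
        by (intro integral_closed_interval[symmetric] z2 t) auto
      also have "\<dots> = integral {0..t} (\<lambda>s. (norm (z s))\<^sup>2)"
        using t by (intro lebesgue_integral_eq_integral continuous_imp_integrable_real continuous_intros
            continuous_on_subset[OF zc]) auto
      finally show ?thesis .
    qed
    have "(norm (z t))\<^sup>2 \<le> \<delta> * integral\<^sup>L ?M k * exp (4 * lip * t)"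
      by (rule gronwall[OF _ _ main t]) (use lip_nonneg in \<open>auto intro!: continuous_intros zc\<close>)
    also have "\<dots> \<le> \<delta> * integral\<^sup>L ?M k * exp (4 * lip * T)"
    proof (rule mult_left_mono)
      show "exp (4 * lip * t) \<le> exp (4 * lip * T)"
        using t lip_nonneg by (simp add: mult_left_mono)
      have "AE s in ?M. 0 \<le> k s"
        using XV by eventually_elim (auto simp: k_def V_energy_nonneg lip_nonneg intro!: add_nonneg_nonneg mult_nonneg_nonneg)
      then show "0 \<le> \<delta> * integral\<^sup>L ?M k" using \<delta> by (intro mult_nonneg_nonneg integral_nonneg_AE)
    qed
    finally show ?thesis by (simp add: z_def mult.assoc)
  qed
  then show ?thesis by (intro exI[of _ "integral\<^sup>L ?M k * exp (4 * lip * T)"]) blast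
qed

end

section \<open>The stochastic integral\<close>

locale brownian_family = prob_space M
  for M :: "'w measure" +
  fixes F :: "real \<Rightarrow> 'w measure" and B :: "nat \<Rightarrow> real \<Rightarrow> 'w \<Rightarrow> real"
  assumes filtered: "filtered_probability M F" and brownian: "independent_brownian_motions M F B"
begin

lemma B_measurable_F: "n \<ge> 1 \<Longrightarrow> t \<ge> 0 \<Longrightarrow> B n t \<in> borel_measurable (F t)"
  using brownian by (auto simp: independent_brownian_motions_def brownian_motion_def)

lemma subalgebra_F: "t \<ge> 0 \<Longrightarrow> subalgebra M (F t)"
  using filtered by (auto simp: filtered_probability_def)

lemma B_measurable: "n \<ge> 1 \<Longrightarrow> t \<ge> 0 \<Longrightarrow> B n t \<in> borel_measurable M"
  using measurable_from_subalg[OF subalgebra_F B_measurable_F] .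

lemma increment_moments:
  assumes n: "n \<ge> 1" and s: "0 \<le> s" "s < t"
  shows "integrable M (\<lambda>\<omega>. B n t \<omega> - B n s \<omega>)" "expectation (\<lambda>\<omega>. B n t \<omega> - B n s \<omega>) = 0"
    "integrable M (\<lambda>\<omega>. (B n t \<omega> - B n s \<omega>)\<^sup>2)" "expectation (\<lambda>\<omega>. (B n t \<omega> - B n s \<omega>)\<^sup>2) = t - s"
proof -
  let ?\<sigma> = "sqrt (t - s)"
  have D: "distributed M lborel (\<lambda>\<omega>. B n t \<omega> - B n s \<omega>) (normal_density 0 ?\<sigma>)"
    using brownian n s by (auto simp: independent_brownian_motions_def brownian_motion_def)
  have \<sigma>: "?\<sigma> > 0" using s by simp
  show "integrable M (\<lambda>\<omega>. B n t \<omega> - B n s \<omega>)"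
    using distributed_integrable[OF D, of "\<lambda>x. x"] integrable_normal_moment[OF \<sigma>, of 0 1] by simp
  show "expectation (\<lambda>\<omega>. B n t \<omega> - B n s \<omega>) = 0"
    using distributed_integral[OF D, of "\<lambda>x. x"] integral_normal_moment_odd[OF \<sigma>, of 0 0] by simp
  show "integrable M (\<lambda>\<omega>. (B n t \<omega> - B n s \<omega>)\<^sup>2)"
    using distributed_integrable[OF D, of "\<lambda>x. x\<^sup>2"] integrable_normal_moment[OF \<sigma>, of 0 2] by simp
  show "expectation (\<lambda>\<omega>. (B n t \<omega> - B n s \<omega>)\<^sup>2) = t - s"
    using distributed_integral[OF D, of "\<lambda>x. x\<^sup>2"] integral_normal_moment_even[OF \<sigma>, of 0 1] s
    by (simp add: power_divide)
qed

lemma B_0: "n \<ge> 1 \<Longrightarrow> AE \<omega> in M. B n 0 \<omega> = 0"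
  using brownian by (auto simp: independent_brownian_motions_def brownian_motion_def)

lemma B_moments:
  assumes n: "n \<ge> 1" and t: "0 \<le> t"
  shows "integrable M (B n t)" "expectation (B n t) = 0"
    "integrable M (\<lambda>\<omega>. (B n t \<omega>)\<^sup>2)" "expectation (\<lambda>\<omega>. (B n t \<omega>)\<^sup>2) = t"
proof -
  note [measurable] = B_measurable[OF n]
  have "integrable M (B n t) \<and> expectation (B n t) = 0 \<and> integrable M (\<lambda>\<omega>. (B n t \<omega>)\<^sup>2) \<and> expectation (\<lambda>\<omega>. (B n t \<omega>)\<^sup>2) = t"
  proof (cases "t = 0")
    case True
    have z: "AE \<omega> in M. B n t \<omega> = 0" "AE \<omega> in M. (B n t \<omega>)\<^sup>2 = 0"
      using B_0[OF n] True by auto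
    show ?thesis
      using integrable_cong_AE[OF _ _ z(1)] integral_cong_AE[OF _ _ z(1)] integrable_cong_AE[OF _ _ z(2)] integral_cong_AE[OF _ _ z(2)] True
      by simp
  next
    case False
    then have s: "0 < t" using t by simp
    have z: "AE \<omega> in M. B n t \<omega> - B n 0 \<omega> = B n t \<omega>" "AE \<omega> in M. (B n t \<omega> - B n 0 \<omega>)\<^sup>2 = (B n t \<omega>)\<^sup>2"
      using B_0[OF n] by (auto elim: eventually_mono)
    show ?thesis
      using increment_moments[OF n order_refl s] t
        integrable_cong_AE[OF _ _ z(1)] integral_cong_AE[OF _ _ z(1)] integrable_cong_AE[OF _ _ z(2)] integral_cong_AE[OF _ _ z(2)]
      by simp
  qed
  then show "integrable M (B n t)" "expectation (B n t) = 0"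
    "integrable M (\<lambda>\<omega>. (B n t \<omega>)\<^sup>2)" "expectation (\<lambda>\<omega>. (B n t \<omega>)\<^sup>2) = t" by auto
qed

lemma integrable_B_mult:
  assumes "n \<ge> 1" "m \<ge> 1" "0 \<le> s" "0 \<le> t"
  shows "integrable M (\<lambda>\<omega>. B n s \<omega> * B m t \<omega>)"
proof (rule Bochner_Integration.integrable_bound[where f = "\<lambda>\<omega>. (B n s \<omega>)\<^sup>2 + (B m t \<omega>)\<^sup>2"])
  show "AE \<omega> in M. norm (B n s \<omega> * B m t \<omega>) \<le> norm ((B n s \<omega>)\<^sup>2 + (B m t \<omega>)\<^sup>2)"
  proof (rule AE_I2)
    fix \<omega>
    have "0 \<le> (\<bar>B n s \<omega>\<bar> - \<bar>B m t \<omega>\<bar>)\<^sup>2" by simp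
    then have "2 * \<bar>B n s \<omega> * B m t \<omega>\<bar> \<le> (B n s \<omega>)\<^sup>2 + (B m t \<omega>)\<^sup>2" by (simp add: power2_diff abs_mult)
    then show "norm (B n s \<omega> * B m t \<omega>) \<le> norm ((B n s \<omega>)\<^sup>2 + (B m t \<omega>)\<^sup>2)"
      using abs_ge_zero[of "B n s \<omega> * B m t \<omega>"] by simp
  qed
qed (use B_moments B_measurable assms in auto)

text \<open>\<open>B n s\<close> is measurable for \<open>F s\<close>, from which the increment is
  independent. Both families of events are stable under intersection, so independence passes to the
  generated sigma-algebras.\<close>

lemma B_covariance_less:
  assumes n: "n \<ge> 1" and s: "0 \<le> s" "s < t"
  shows "expectation (\<lambda>\<omega>. B n s \<omega> * B n t \<omega>) = s"
proof -
  let ?X = "\<lambda>\<omega>. B n t \<omega> - B n s \<omega>"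
  have [measurable]: "B n s \<in> borel_measurable M" "B n t \<in> borel_measurable M"
    using B_measurable n s by auto
  have sp: "space (F s) = space M" and sub: "sets (F s) \<subseteq> sets M"
    using subalgebra_F[OF s(1)] by (auto simp: subalgebra_def)
  have ind: "indep_set (sets (F s)) {?X -` A \<inter> space M | A. A \<in> sets borel}"
    using brownian n s by (auto simp: independent_brownian_motions_def brownian_motion_def)
  have st: "Int_stable (sets (F s))" "Int_stable {?X -` A \<inter> space M | A. A \<in> sets (borel :: real measure)}"
    by (auto simp: Int_stable_def) (metis (no_types, lifting) sets.Int vimage_Int Int_assoc Int_left_commute Int_absorb)
  have "{B n s -` A \<inter> space M | A. A \<in> sets borel} \<subseteq> sets (F s)"
    using measurable_sets[OF B_measurable_F[OF n s(1)]] sp by auto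
  then have "sigma_sets (space M) {B n s -` A \<inter> space M | A. A \<in> sets borel} \<subseteq> sigma_sets (space M) (sets (F s))"
    by (rule sigma_sets_mono')
  moreover have "indep_set (sigma_sets (space M) (sets (F s))) (sigma_sets (space M) {?X -` A \<inter> space M | A. A \<in> sets borel})"
    by (rule indep_set_sigma_sets[OF ind st])
  ultimately have "indep_set (sigma_sets (space M) {B n s -` A \<inter> space M | A. A \<in> sets borel})
      (sigma_sets (space M) {?X -` A \<inter> space M | A. A \<in> sets borel})"
    unfolding indep_sets2_eq by blast
  then have iv: "indep_var borel (B n s) borel ?X"
    unfolding indep_var_eq by simp
  have i: "integrable M (B n s)" "integrable M ?X"
    using B_moments[OF n] increment_moments[OF n s] s by auto
  have "expectation (\<lambda>\<omega>. B n s \<omega> * B n t \<omega>) = expectation (\<lambda>\<omega>. B n s \<omega> * ?X \<omega> + (B n s \<omega>)\<^sup>2)"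
    by (simp add: algebra_simps power2_eq_square)
  also have "\<dots> = expectation (\<lambda>\<omega>. B n s \<omega> * ?X \<omega>) + expectation (\<lambda>\<omega>. (B n s \<omega>)\<^sup>2)"
    by (rule Bochner_Integration.integral_add[OF indep_var_integrable[OF iv i] B_moments(3)[OF n s(1)]])
  also have "\<dots> = s"
    using indep_var_lebesgue_integral[OF iv i] B_moments[OF n s(1)] by simp
  finally show ?thesis .
qed

lemma B_covariance:
  assumes n: "n \<ge> 1" and s: "0 \<le> s" and t: "0 \<le> t"
  shows "expectation (\<lambda>\<omega>. B n s \<omega> * B n t \<omega>) = min s t"
proof -
  consider "s < t" | "t < s" | "s = t" by linarith
  then show ?thesis
  proof cases
    case 1
    then show ?thesis using B_covariance_less[OF n s] by simp
  next
    case 2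
    then show ?thesis using B_covariance_less[OF n t] by (simp add: mult.commute)
  next
    case 3
    then show ?thesis using B_moments(4)[OF n s] by (simp add: power2_eq_square)
  qed
qed

lemma B_uncorrelated:
  assumes "n \<ge> 1" "m \<ge> 1" "n \<noteq> m" "0 \<le> s" "0 \<le> t"
  shows "expectation (\<lambda>\<omega>. B n s \<omega> * B m t \<omega>) = 0"
proof -
  \<comment> \<open>One sampling time per index lets the independence of whole paths be evaluated at
    the two different times \<open>s\<close> and \<open>t\<close>.\<close>
  define r where "r i = (if i = n then s else t)" for i
  have "indep_vars (\<lambda>_. PiM {0..} (\<lambda>_. borel)) (\<lambda>n \<omega>. restrict (\<lambda>t. B n t \<omega>) {0..}) {1..}"
    using brownian by (simp add: independent_brownian_motions_def)
  then have "indep_vars (\<lambda>_. PiM {0..} (\<lambda>_. borel)) (\<lambda>n \<omega>. restrict (\<lambda>t. B n t \<omega>) {0..}) {n, m}"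
    by (rule indep_vars_subset) (use assms in auto)
  then have "indep_vars (\<lambda>_. borel) (\<lambda>i \<omega>. (\<lambda>p. p (r i)) (restrict (\<lambda>t. B i t \<omega>) {0..})) {n, m}"
    by (rule indep_vars_compose2) (use assms in \<open>auto simp: r_def intro!: measurable_component_singleton\<close>)
  moreover have "(\<lambda>i \<omega>. (\<lambda>p. p (r i)) (restrict (\<lambda>t. B i t \<omega>) {0..})) = (\<lambda>i. B i (r i))"
    using assms by (auto simp: r_def fun_eq_iff)
  ultimately have iv: "indep_vars (\<lambda>_. borel) (\<lambda>i. B i (r i)) {n, m}" by simp
  have "expectation (\<lambda>\<omega>. \<Prod>i\<in>{n, m}. B i (r i) \<omega>) = (\<Prod>i\<in>{n, m}. expectation (B i (r i)))"
    by (rule indep_vars_lebesgue_integral[OF _ iv]) (use assms B_moments(1) in \<open>auto simp: r_def\<close>)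
  then show ?thesis
    using assms B_moments(2) by (simp add: r_def)
qed

text \<open>Both sides are the length of the overlap of the two intervals. The integral form matches
  products of step integrands, so the Ito estimate will follow by bilinearity.\<close>

lemma increment_covariance:
  assumes n: "n \<ge> 1" and ab: "0 \<le> a" "a \<le> b" "b \<le> T" and cd: "0 \<le> c" "c \<le> d" "d \<le> T"
  shows "expectation (\<lambda>\<omega>. (B n b \<omega> - B n a \<omega>) * (B n d \<omega> - B n c \<omega>)) =
     integral\<^sup>L (T_meas T) (\<lambda>s. indicator {a<..b} s * indicator {c<..d} s)"
proof -
  have ind: "integral\<^sup>L (T_meas T) (\<lambda>s. indicator {0<..x} s * indicator {0<..y} s) = min x y"
    and indi: "integrable (T_meas T) (\<lambda>s. indicator {0<..x} s * indicator {0<..y} s :: real)"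
    if "0 \<le> x" "x \<le> T" "0 \<le> y" "y \<le> T" for x y
  proof -
    have "AE s in lebesgue. s \<noteq> T"
      using AE_not_in[of "{T}" lebesgue] by (auto elim!: eventually_mono simp: negligible_iff_null_sets[symmetric])
    then have ae: "AE s in lebesgue. indicator {0<..<T} s *\<^sub>R (indicator {0<..x} s * indicator {0<..y} s) = (indicator {0<..min x y} s :: real)"
      by eventually_elim (use that in \<open>auto simp: indicator_def\<close>)
    have i: "integrable lebesgue (indicator {0<..min x y} :: real \<Rightarrow> real)"
      by (rule integrable_real_indicator) (use that in auto)
    have m: "(\<lambda>s. indicator {0<..<T} s *\<^sub>R (indicator {0<..x} s * indicator {0<..y} s :: real)) \<in> borel_measurable lebesgue"
      by (intro borel_measurable_scaleR borel_measurable_times borel_measurable_indicator) simp_all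
    show "integrable (T_meas T) (\<lambda>s. indicator {0<..x} s * indicator {0<..y} s :: real)"
      using integrable_cong_AE[OF m borel_measurable_integrable[OF i] ae] i by (simp add: integrable_restrict_space)
    have "integral\<^sup>L (T_meas T) (\<lambda>s. indicator {0<..x} s * indicator {0<..y} s :: real) = integral\<^sup>L lebesgue (indicator {0<..min x y})"
      using integral_cong_AE[OF m borel_measurable_integrable[OF i] ae] by (simp add: integral_restrict_space)
    also have "\<dots> = min x y" using that by simp
    finally show "integral\<^sup>L (T_meas T) (\<lambda>s. indicator {0<..x} s * indicator {0<..y} s) = min x y" .
  qed
  have "integral\<^sup>L (T_meas T) (\<lambda>s. indicator {a<..b} s * indicator {c<..d} s :: real) =
     integral\<^sup>L (T_meas T) (\<lambda>s. (indicator {0<..b} s * indicator {0<..d} s - indicator {0<..b} s * indicator {0<..c} s)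
       - (indicator {0<..a} s * indicator {0<..d} s - indicator {0<..a} s * indicator {0<..c} s))"
    using ab cd by (intro Bochner_Integration.integral_cong) (auto simp: indicator_def)
  also have "\<dots> = (min b d - min b c) - (min a d - min a c)"
    using ab cd by (simp add: ind indi)
  also have "\<dots> = expectation (\<lambda>\<omega>. (B n b \<omega> * B n d \<omega> - B n b \<omega> * B n c \<omega>) - (B n a \<omega> * B n d \<omega> - B n a \<omega> * B n c \<omega>))"
    using ab cd n by (simp add: integrable_B_mult B_covariance)
  also have "\<dots> = expectation (\<lambda>\<omega>. (B n b \<omega> - B n a \<omega>) * (B n d \<omega> - B n c \<omega>))"
    by (rule Bochner_Integration.integral_cong) (auto simp: algebra_simps)
  finally show ?thesis by simp
qed

section \<open>Almost sure convergence of the noise series\<close>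

lemma leg_eigenvalue_Suc_pos [simp]: "0 < leg_eigenvalue (Suc n)"
  by (simp add: leg_eigenvalue_def)

lemma summable_inverse_leg_eigenvalue: "summable (\<lambda>n. 1 / leg_eigenvalue (Suc n))"
proof (rule summable_comparison_test')
  show "summable (\<lambda>n. 1 / real (Suc n) ^ 2)"
    using inverse_power_summable[of 2, where 'a = real] by (subst summable_Suc_iff) (simp add: inverse_eq_divide)
  show "norm (1 / leg_eigenvalue (Suc n)) \<le> 1 / real (Suc n) ^ 2" for n
    unfolding leg_eigenvalue_def power2_eq_square
    by (simp add: frac_le del: of_nat_Suc)
qed

text \<open>\<open>noise\<close> is a \<open>suminf\<close>, meaningful only where its series
  converges. The eigenvalues grow quadratically, so the expected sum of squared coefficients is
  finite and \<open>riesz_fischer\<close> applies almost surely at the given time.\<close>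

lemma noise_sums:
  assumes t: "0 \<le> t"
  shows "AE \<omega> in M. (\<lambda>n. (B (Suc n) t \<omega> / sqrt (leg_eigenvalue (Suc n))) *\<^sub>R leg (Suc n)) sums noise B t \<omega>"
proof -
  let ?c = "\<lambda>n \<omega>. B (Suc n) t \<omega> / sqrt (leg_eigenvalue (Suc n))"
  have [measurable]: "B (Suc n) t \<in> borel_measurable M" for n using t by (intro B_measurable) auto
  have "(\<integral>\<^sup>+ \<omega>. (\<Sum>n. ennreal ((?c n \<omega>)\<^sup>2)) \<partial>M) = (\<Sum>n. \<integral>\<^sup>+ \<omega>. ennreal ((?c n \<omega>)\<^sup>2) \<partial>M)"
    by (rule nn_integral_suminf) measurable
  also have "\<dots> = (\<Sum>n. ennreal (t * (1 / leg_eigenvalue (Suc n))))"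
  proof (rule suminf_cong)
    fix n
    have "(?c n \<omega>)\<^sup>2 = (B (Suc n) t \<omega>)\<^sup>2 / leg_eigenvalue (Suc n)" for \<omega>
      by (simp add: power_divide less_imp_le)
    then have "(\<integral>\<^sup>+ \<omega>. ennreal ((?c n \<omega>)\<^sup>2) \<partial>M) = ennreal (expectation (\<lambda>\<omega>. (B (Suc n) t \<omega>)\<^sup>2 / leg_eigenvalue (Suc n)))"
      using B_moments(3)[of "Suc n" t] t by (simp add: nn_integral_eq_integral less_imp_le)
    then show "(\<integral>\<^sup>+ \<omega>. ennreal ((?c n \<omega>)\<^sup>2) \<partial>M) = ennreal (t * (1 / leg_eigenvalue (Suc n)))"
      using B_moments(4)[of "Suc n" t] t by simp
  qed
  also have "\<dots> = ennreal (\<Sum>n. t * (1 / leg_eigenvalue (Suc n)))"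
    using t summable_inverse_leg_eigenvalue
    by (intro suminf_ennreal2 summable_mult) (auto simp: less_imp_le)
  also have "\<dots> < \<infinity>" by simp
  finally have "AE \<omega> in M. (\<Sum>n. ennreal ((?c n \<omega>)\<^sup>2)) \<noteq> \<infinity>"
    by (intro nn_integral_PInf_AE) auto
  then show ?thesis
  proof eventually_elim
    case (elim \<omega>)
    then have "summable (\<lambda>n. (?c n \<omega>)\<^sup>2)" by (intro summable_suminf_not_top) auto
    then have "summable (\<lambda>n. ?c n \<omega> *\<^sub>R leg (Suc n))" by (rule riesz_fischer) simp
    then show ?case unfolding noise_def by (rule summable_sums)
  qed
qed

end

lemma J_op_leg: "J_op (leg (Suc n)) = (1 / sqrt (leg_eigenvalue (Suc n))) *\<^sub>R leg (Suc n)"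
proof -
  have "J_op (leg (Suc n)) = (\<Sum>m\<in>{n}. (inner (leg (Suc n)) (leg (Suc m)) / sqrt (leg_eigenvalue (Suc m))) *\<^sub>R leg (Suc m))"
    unfolding J_op_def by (rule suminf_finite) (auto simp: inner_leg)
  then show ?thesis by (simp add: inner_leg)
qed

section \<open>Step integrals and the Ito estimate\<close>

lemma step_value_conv_sum:
  "step_value P s h = (\<Sum>i<length P. indicator {fst (P ! i)<..fst (snd (P ! i))} s *\<^sub>R blinfun_apply (snd (snd (P ! i))) h)"
  unfolding step_value_def
  by (subst sum_list_sum_nth) (auto simp: atLeast0LessThan indicator_def case_prod_beta intro!: sum.cong)

lemma step_integral_conv_sum:
  "step_integral W P t \<omega> = (\<Sum>i<length P. blinfun_apply (snd (snd (P ! i))) (W (min (fst (snd (P ! i))) t) \<omega> - W (min (fst (P ! i)) t) \<omega>))"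
  unfolding step_integral_def
  by (subst sum_list_sum_nth) (auto simp: atLeast0LessThan case_prod_beta intro!: sum.cong)

lemma step_integrand_nth:
  assumes "step_integrand T P" "i < length P"
  shows "0 \<le> fst (P ! i)" "fst (P ! i) \<le> fst (snd (P ! i))" "fst (snd (P ! i)) \<le> T" "0 \<le> fst (snd (P ! i))"
proof -
  show "0 \<le> fst (P ! i)" "fst (P ! i) \<le> fst (snd (P ! i))" "fst (snd (P ! i)) \<le> T"
    using assms nth_mem[OF assms(2)] by (auto simp: step_integrand_def case_prod_beta)
  then show "0 \<le> fst (snd (P ! i))" by linarith
qed

lemma step_value_measurable:
  fixes P :: "(real \<times> real \<times> (L2I \<Rightarrow>\<^sub>L real)) list"
  shows "(\<lambda>s. step_value P s h) \<in> borel_measurable (T_meas T)"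
proof -
  have "(\<lambda>s. indicator {a<..b} s :: real) \<in> borel_measurable (T_meas T)" for a b
    by (intro measurable_restrict_space1 borel_measurable_indicator) simp
  then show ?thesis
    unfolding step_value_conv_sum by (intro borel_measurable_sum borel_measurable_scaleR) auto
qed

context brownian_family
begin

text \<open>The contribution of the single Brownian motion \<open>B (Suc n)\<close> to a step
  integral; being a finite real sum, it gives access to measurability and moments.\<close>

definition step_term :: "(real \<times> real \<times> (L2I \<Rightarrow>\<^sub>L real)) list \<Rightarrow> real \<Rightarrow> nat \<Rightarrow> 'w \<Rightarrow> real" where
  "step_term P t n \<omega> = (\<Sum>i<length P. blinfun_apply (snd (snd (P ! i))) (J_op (leg (Suc n))) *
     (B (Suc n) (min (fst (snd (P ! i))) t) \<omega> - B (Suc n) (min (fst (P ! i)) t) \<omega>))"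

lemma step_term_measurable:
  assumes "step_integrand T P" "0 \<le> t"
  shows "step_term P t n \<in> borel_measurable M"
proof -
  have "B (Suc n) (min (fst (snd (P ! i))) t) \<in> borel_measurable M" "B (Suc n) (min (fst (P ! i)) t) \<in> borel_measurable M"
    if "i < length P" for i
    using step_integrand_nth[OF assms(1) that] assms(2) by (auto intro!: B_measurable)
  then show ?thesis
    unfolding step_term_def[abs_def] by (intro borel_measurable_sum borel_measurable_times borel_measurable_diff) auto
qed

text \<open>A step integral involves finitely many times, so the exceptional sets of the noise
  series may be united; bounded operators then pass through the series.\<close>

lemma step_integral_sums:
  assumes P: "step_integrand T P" and t: "0 \<le> t"
  shows "AE \<omega> in M. (\<lambda>n. step_term P t n \<omega>) sums step_integral (noise B) P t \<omega>"
proof -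
  have "AE \<omega> in M. \<forall>i\<in>{..<length P}. \<forall>r\<in>{min (fst (snd (P ! i))) t, min (fst (P ! i)) t}.
      (\<lambda>n. (B (Suc n) r \<omega> / sqrt (leg_eigenvalue (Suc n))) *\<^sub>R leg (Suc n)) sums noise B r \<omega>"
    using step_integrand_nth[OF P] t by (intro AE_finite_allI noise_sums) auto
  then show ?thesis
  proof eventually_elim
    case (elim \<omega>)
    show ?case
      unfolding step_term_def step_integral_conv_sum
    proof (rule sums_sum)
      fix i assume i: "i \<in> {..<length P}"
      let ?b = "min (fst (snd (P ! i))) t" and ?a = "min (fst (P ! i)) t" and ?\<Phi> = "snd (snd (P ! i))"
      have "(\<lambda>n. (B (Suc n) ?b \<omega> / sqrt (leg_eigenvalue (Suc n))) *\<^sub>R leg (Suc n) - (B (Suc n) ?a \<omega> / sqrt (leg_eigenvalue (Suc n))) *\<^sub>R leg (Suc n))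
          sums (noise B ?b \<omega> - noise B ?a \<omega>)"
        using elim i by (intro sums_diff) auto
      then have "(\<lambda>n. blinfun_apply ?\<Phi> ((B (Suc n) ?b \<omega> / sqrt (leg_eigenvalue (Suc n))) *\<^sub>R leg (Suc n) - (B (Suc n) ?a \<omega> / sqrt (leg_eigenvalue (Suc n))) *\<^sub>R leg (Suc n)))
          sums blinfun_apply ?\<Phi> (noise B ?b \<omega> - noise B ?a \<omega>)"
        by (rule bounded_linear.sums[OF blinfun.bounded_linear_right])
      moreover have "blinfun_apply ?\<Phi> ((B (Suc n) ?b \<omega> / sqrt (leg_eigenvalue (Suc n))) *\<^sub>R leg (Suc n) - (B (Suc n) ?a \<omega> / sqrt (leg_eigenvalue (Suc n))) *\<^sub>R leg (Suc n)) =
         blinfun_apply ?\<Phi> (J_op (leg (Suc n))) * (B (Suc n) ?b \<omega> - B (Suc n) ?a \<omega>)" for n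
        by (simp add: J_op_leg blinfun.bilinear_simps diff_divide_distrib algebra_simps)
      ultimately show "(\<lambda>n. blinfun_apply ?\<Phi> (J_op (leg (Suc n))) * (B (Suc n) ?b \<omega> - B (Suc n) ?a \<omega>))
          sums blinfun_apply ?\<Phi> (noise B ?b \<omega> - noise B ?a \<omega>)" by simp
    qed
  qed
qed

lemma increment_mult_integrable:
  assumes "n \<ge> 1" "m \<ge> 1" "0 \<le> a" "0 \<le> b" "0 \<le> c" "0 \<le> d"
  shows "integrable M (\<lambda>\<omega>. (B n b \<omega> - B n a \<omega>) * (B m d \<omega> - B m c \<omega>))"
  unfolding left_diff_distrib right_diff_distrib
  using assms by (intro Bochner_Integration.integrable_diff integrable_B_mult)

lemma step_term_mult_integrable:
  assumes P: "step_integrand T P" and t: "0 \<le> t"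
  shows "integrable M (\<lambda>\<omega>. step_term P t n \<omega> * step_term P t m \<omega>)"
  unfolding step_term_def sum_product mult.assoc
  unfolding mult.left_commute[of "B _ _ _ - B _ _ _" "blinfun_apply _ _"]
  using step_integrand_nth[OF P] t
  by (intro Bochner_Integration.integrable_sum integrable_mult_right increment_mult_integrable) auto

lemma step_term_orthogonal:
  assumes P: "step_integrand T P" and t: "0 \<le> t" and nm: "n \<noteq> m"
  shows "expectation (\<lambda>\<omega>. step_term P t n \<omega> * step_term P t m \<omega>) = 0"
proof -
  let ?b = "\<lambda>i. min (fst (snd (P ! i))) t" and ?a = "\<lambda>i. min (fst (P ! i)) t" and ?\<Phi> = "\<lambda>i n. blinfun_apply (snd (snd (P ! i))) (J_op (leg (Suc n)))"
  have nn: "0 \<le> ?a i" "0 \<le> ?b i" if "i < length P" for i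
    using step_integrand_nth[OF P that] t by auto
  have z: "expectation (\<lambda>\<omega>. (B (Suc n) (?b i) \<omega> - B (Suc n) (?a i) \<omega>) * (B (Suc m) (?b j) \<omega> - B (Suc m) (?a j) \<omega>)) = 0"
    if "i < length P" "j < length P" for i j
    unfolding left_diff_distrib right_diff_distrib
    using nn[OF that(1)] nn[OF that(2)] nm by (simp add: integrable_B_mult B_uncorrelated)
  have "expectation (\<lambda>\<omega>. step_term P t n \<omega> * step_term P t m \<omega>) =
     expectation (\<lambda>\<omega>. \<Sum>i<length P. \<Sum>j<length P. ?\<Phi> i n * ?\<Phi> j m * ((B (Suc n) (?b i) \<omega> - B (Suc n) (?a i) \<omega>) * (B (Suc m) (?b j) \<omega> - B (Suc m) (?a j) \<omega>)))"
    unfolding step_term_def sum_product by (simp only: mult_ac)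
  also have "\<dots> = (\<Sum>i<length P. \<Sum>j<length P. ?\<Phi> i n * ?\<Phi> j m * expectation (\<lambda>\<omega>. (B (Suc n) (?b i) \<omega> - B (Suc n) (?a i) \<omega>) * (B (Suc m) (?b j) \<omega> - B (Suc m) (?a j) \<omega>)))"
    using nn by (subst Bochner_Integration.integral_sum; (intro Bochner_Integration.integrable_sum integrable_mult_right increment_mult_integrable)?; auto intro!: sum.cong)
      (subst Bochner_Integration.integral_sum; (intro integrable_mult_right increment_mult_integrable)?; auto)
  also have "\<dots> = 0" using z by simp
  finally show ?thesis .
qed

text \<open>Stopping at \<open>t\<close> restricts the integrand to \<open>s \<le> t\<close>; the
  full step integrand on the right therefore gives an inequality.\<close>

lemma step_term_second_moment:
  assumes P: "step_integrand T P" and t: "t \<in> {0..T}"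
  shows "ennreal (expectation (\<lambda>\<omega>. (step_term P t n \<omega>)\<^sup>2)) \<le>
     (\<integral>\<^sup>+ s. ennreal ((step_value P s (J_op (leg (Suc n))))\<^sup>2) \<partial>T_meas T)"
proof -
  let ?b = "\<lambda>i. min (fst (snd (P ! i))) t" and ?a = "\<lambda>i. min (fst (P ! i)) t" and ?\<Phi> = "\<lambda>i. blinfun_apply (snd (snd (P ! i))) (J_op (leg (Suc n)))"
  have nn: "0 \<le> ?a i" "?a i \<le> ?b i" "?b i \<le> T" if "i < length P" for i
    using step_integrand_nth[OF P that] t by auto
  have nn': "0 \<le> ?a i" "0 \<le> ?b i" if "i < length P" for i
    using step_integrand_nth[OF P that] t by auto
  have ii: "integrable (T_meas T) (\<lambda>s. indicator {a<..b} s * indicator {c<..d} s :: real)" for a b c d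
  proof (rule Bochner_Integration.integrable_bound[where f = "\<lambda>_. 1 :: real"])
    show "(\<lambda>s. indicator {a<..b} s * indicator {c<..d} s :: real) \<in> borel_measurable (T_meas T)"
      by (intro measurable_restrict_space1 borel_measurable_times borel_measurable_indicator) simp_all
  qed (auto simp: indicator_def intro: integrable_continuous_T)
  have sv: "(\<Sum>i<length P. ?\<Phi> i * indicator {?a i<..?b i} s) = indicator {..t} s * step_value P s (J_op (leg (Suc n)))" for s
    unfolding step_value_conv_sum sum_distrib_left by (rule sum.cong) (auto simp: indicator_def)
  have "expectation (\<lambda>\<omega>. (step_term P t n \<omega>)\<^sup>2) =
     expectation (\<lambda>\<omega>. \<Sum>i<length P. \<Sum>j<length P. ?\<Phi> i * ?\<Phi> j * ((B (Suc n) (?b i) \<omega> - B (Suc n) (?a i) \<omega>) * (B (Suc n) (?b j) \<omega> - B (Suc n) (?a j) \<omega>)))"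
    unfolding step_term_def power2_eq_square sum_product by (simp only: mult_ac)
  also have "\<dots> = (\<Sum>i<length P. \<Sum>j<length P. ?\<Phi> i * ?\<Phi> j * expectation (\<lambda>\<omega>. (B (Suc n) (?b i) \<omega> - B (Suc n) (?a i) \<omega>) * (B (Suc n) (?b j) \<omega> - B (Suc n) (?a j) \<omega>)))"
    using nn' by (subst Bochner_Integration.integral_sum; (intro Bochner_Integration.integrable_sum integrable_mult_right increment_mult_integrable)?; auto intro!: sum.cong)
      (subst Bochner_Integration.integral_sum; (intro integrable_mult_right increment_mult_integrable)?; auto)
  also have "\<dots> = (\<Sum>i<length P. \<Sum>j<length P. ?\<Phi> i * ?\<Phi> j * integral\<^sup>L (T_meas T) (\<lambda>s. indicator {?a i<..?b i} s * indicator {?a j<..?b j} s))"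
    using nn by (intro sum.cong refl arg_cong2[where f = "(*)"] increment_covariance) auto
  also have "\<dots> = integral\<^sup>L (T_meas T) (\<lambda>s. \<Sum>i<length P. \<Sum>j<length P. ?\<Phi> i * ?\<Phi> j * (indicator {?a i<..?b i} s * indicator {?a j<..?b j} s))"
    by (simp add: Bochner_Integration.integral_sum Bochner_Integration.integrable_sum ii)
  also have "(\<lambda>s. \<Sum>i<length P. \<Sum>j<length P. ?\<Phi> i * ?\<Phi> j * (indicator {?a i<..?b i} s * indicator {?a j<..?b j} s)) =
      (\<lambda>s. (indicator {..t} s * step_value P s (J_op (leg (Suc n))))\<^sup>2)"
    unfolding sv[symmetric] power2_eq_square sum_product by (simp only: mult_ac)
  also have "ennreal (integral\<^sup>L (T_meas T) (\<lambda>s. (indicator {..t} s * step_value P s (J_op (leg (Suc n))))\<^sup>2)) \<le>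
      (\<integral>\<^sup>+ s. ennreal ((step_value P s (J_op (leg (Suc n))))\<^sup>2) \<partial>T_meas T)"
  proof -
    have "integrable (T_meas T) (\<lambda>s. (indicator {..t} s * step_value P s (J_op (leg (Suc n))))\<^sup>2)"
      unfolding sv[symmetric] power2_eq_square sum_product
      unfolding mult.assoc mult.left_commute[of "indicator _ _" "blinfun_apply _ _"]
      by (intro Bochner_Integration.integrable_sum integrable_mult_right ii)
    then have "ennreal (integral\<^sup>L (T_meas T) (\<lambda>s. (indicator {..t} s * step_value P s (J_op (leg (Suc n))))\<^sup>2)) =
       (\<integral>\<^sup>+ s. ennreal ((indicator {..t} s * step_value P s (J_op (leg (Suc n))))\<^sup>2) \<partial>T_meas T)"
      by (intro nn_integral_eq_integral[symmetric]) auto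
    also have "\<dots> \<le> (\<integral>\<^sup>+ s. ennreal ((step_value P s (J_op (leg (Suc n))))\<^sup>2) \<partial>T_meas T)"
      by (intro nn_integral_mono ennreal_leI) (auto simp: indicator_def)
    finally show ?thesis .
  qed
  finally show ?thesis .
qed

text \<open>The half of the Ito isometry by which approximations are compared. Fatou's lemma takes
  the place of convergence of the series in mean square.\<close>

lemma ito_inequality:
  fixes P :: "(real \<times> real \<times> (L2I \<Rightarrow>\<^sub>L real)) list"
  assumes P: "step_integrand T P" and t: "t \<in> {0..T}"
  shows "(\<integral>\<^sup>+ \<omega>. ennreal ((step_integral (noise B) P t \<omega>)\<^sup>2) \<partial>M) \<le>
     (\<integral>\<^sup>+ s. hs_norm_sq (\<lambda>h. step_value P s (J_op h)) \<partial>T_meas T)"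
proof -
  have t0: "0 \<le> t" using t by simp
  note [measurable] = step_term_measurable[OF P t0] step_value_measurable
  have "(\<integral>\<^sup>+ \<omega>. ennreal ((step_integral (noise B) P t \<omega>)\<^sup>2) \<partial>M) =
      (\<integral>\<^sup>+ \<omega>. liminf (\<lambda>m. ennreal ((\<Sum>n<m. step_term P t n \<omega>)\<^sup>2)) \<partial>M)"
  proof (rule nn_integral_cong_AE, use step_integral_sums[OF P t0] in eventually_elim)
    case (elim \<omega>)
    then have "(\<lambda>m. ennreal ((\<Sum>n<m. step_term P t n \<omega>)\<^sup>2)) \<longlonglongrightarrow> ennreal ((step_integral (noise B) P t \<omega>)\<^sup>2)"
      unfolding sums_def by (intro tendsto_ennrealI tendsto_power)
    then show ?case by (intro lim_imp_Liminf[symmetric]) auto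
  qed
  also have "\<dots> \<le> liminf (\<lambda>m. \<integral>\<^sup>+ \<omega>. ennreal ((\<Sum>n<m. step_term P t n \<omega>)\<^sup>2) \<partial>M)"
    by (rule nn_integral_liminf) measurable
  also have "\<dots> \<le> (\<integral>\<^sup>+ s. hs_norm_sq (\<lambda>h. step_value P s (J_op h)) \<partial>T_meas T)"
  proof (rule order.trans[OF Liminf_le_Limsup[OF trivial_limit_sequentially]
        Limsup_bounded[OF always_eventually[OF allI]]])
    fix m
    have sq: "(\<Sum>n<m. step_term P t n \<omega>)\<^sup>2 = (\<Sum>n<m. \<Sum>k<m. step_term P t n \<omega> * step_term P t k \<omega>)" for \<omega>
      by (simp add: power2_eq_square sum_product)
    have "(\<integral>\<^sup>+ \<omega>. ennreal ((\<Sum>n<m. step_term P t n \<omega>)\<^sup>2) \<partial>M) = ennreal (expectation (\<lambda>\<omega>. (\<Sum>n<m. step_term P t n \<omega>)\<^sup>2))"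
      unfolding sq using step_term_mult_integrable[OF P t0]
      by (intro nn_integral_eq_integral Bochner_Integration.integrable_sum AE_I2) (auto simp flip: sum_product)
    also have "expectation (\<lambda>\<omega>. (\<Sum>n<m. step_term P t n \<omega>)\<^sup>2) = (\<Sum>n<m. \<Sum>k<m. expectation (\<lambda>\<omega>. step_term P t n \<omega> * step_term P t k \<omega>))"
      unfolding sq by (simp add: Bochner_Integration.integral_sum Bochner_Integration.integrable_sum step_term_mult_integrable[OF P t0])
    also have "\<dots> = (\<Sum>n<m. \<Sum>k<m. if n = k then expectation (\<lambda>\<omega>. (step_term P t n \<omega>)\<^sup>2) else 0)"
      by (intro sum.cong refl) (auto simp: step_term_orthogonal[OF P t0] power2_eq_square)
    also have "\<dots> = (\<Sum>n<m. expectation (\<lambda>\<omega>. (step_term P t n \<omega>)\<^sup>2))" by simp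
    also have "ennreal \<dots> = (\<Sum>n<m. ennreal (expectation (\<lambda>\<omega>. (step_term P t n \<omega>)\<^sup>2)))"
      by (rule sum_ennreal[symmetric]) simp
    also have "\<dots> \<le> (\<Sum>n<m. \<integral>\<^sup>+ s. ennreal ((step_value P s (J_op (leg (Suc n))))\<^sup>2) \<partial>T_meas T)"
      by (intro sum_mono step_term_second_moment[OF P t])
    also have "\<dots> = (\<integral>\<^sup>+ s. (\<Sum>n<m. ennreal ((step_value P s (J_op (leg (Suc n))))\<^sup>2)) \<partial>T_meas T)"
      by (rule nn_integral_sum[symmetric]) measurable
    also have "\<dots> \<le> (\<integral>\<^sup>+ s. hs_norm_sq (\<lambda>h. step_value P s (J_op h)) \<partial>T_meas T)"
    proof (rule nn_integral_mono)
      fix s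
      \<comment> \<open>\<open>hs_norm_sq\<close> also counts the constant \<open>leg 0\<close>,
        which the noise omits; the additional term is nonnegative.\<close>
      let ?f = "\<lambda>n. ennreal ((step_value P s (J_op (leg n)))\<^sup>2)"
      have "(\<Sum>n<m. ?f (Suc n)) \<le> (\<Sum>n<Suc m. ?f n)"
        unfolding sum.lessThan_Suc_shift by simp
      also have "\<dots> \<le> (\<Sum>n. ?f n)"
        by (rule sum_le_suminf) auto
      finally show "(\<Sum>n<m. ?f (Suc n)) \<le> hs_norm_sq (\<lambda>h. step_value P s (J_op h))"
        by (simp add: hs_norm_sq_def)
    qed
    finally show "(\<integral>\<^sup>+ \<omega>. ennreal ((\<Sum>n<m. step_term P t n \<omega>)\<^sup>2) \<partial>M) \<le>
       (\<integral>\<^sup>+ s. hs_norm_sq (\<lambda>h. step_value P s (J_op h)) \<partial>T_meas T)" .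
  qed
  finally show ?thesis .
qed

end

section \<open>Testing the stochastic integral with a unit vector\<close>

definition step_compose :: "('k::real_normed_vector \<Rightarrow>\<^sub>L 'l::real_normed_vector) \<Rightarrow>
    (real \<times> real \<times> (L2I \<Rightarrow>\<^sub>L 'k)) list \<Rightarrow> (real \<times> real \<times> (L2I \<Rightarrow>\<^sub>L 'l)) list" where
  "step_compose A = map (\<lambda>(a, b, \<Phi>). (a, b, A o\<^sub>L \<Phi>))"

lemma step_integrand_compose: "step_integrand T P \<Longrightarrow> step_integrand T (step_compose A P)"
  by (auto simp: step_integrand_def step_compose_def)

lemma step_integrand_append: "step_integrand T P \<Longrightarrow> step_integrand T P' \<Longrightarrow> step_integrand T (P @ P')"
  by (auto simp: step_integrand_def)

lemma step_value_append: "step_value (P @ P') s h = step_value P s h + step_value P' s h"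
  by (simp add: step_value_def)

lemma step_integral_append: "step_integral W (P @ P') t \<omega> = step_integral W P t \<omega> + step_integral W P' t \<omega>"
  by (simp add: step_integral_def)

lemma step_value_compose: "step_value (step_compose A P) s h = blinfun_apply A (step_value P s h)"
  by (induction P) (auto simp: step_value_def step_compose_def blinfun.bilinear_simps)

lemma step_integral_compose: "step_integral W (step_compose A P) t \<omega> = blinfun_apply A (step_integral W P t \<omega>)"
  by (induction P) (auto simp: step_integral_def step_compose_def blinfun.bilinear_simps)

text \<open>Rational points are dense in the open interval, whose closure is \<open>{0..T}\<close>
  because \<open>T > 0\<close>.\<close>

lemma continuous_eq_on_rationals:
  fixes p q :: "real \<Rightarrow> real"
  assumes "T > 0" "continuous_on {0..T} p" "continuous_on {0..T} q"
    and eq: "\<And>r. r \<in> \<rat> \<Longrightarrow> r \<in> {0..T} \<Longrightarrow> p r = q r" and t: "t \<in> {0..T}"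
  shows "p t = q t"
proof -
  have "{0<..<T} \<subseteq> closure ({0<..<T} \<inter> \<rat>)"
    using open_Int_closure_subset[of "{0<..<T}" \<rat>] by (simp add: Rats_closure_real)
  then have "closure {0<..<T} \<subseteq> closure ({0<..<T} \<inter> \<rat>)"
    by (rule closure_minimal) simp
  then have sub: "{0..T} \<subseteq> closure ({0<..<T} \<inter> \<rat>)"
    using assms(1) by simp
  have sup: "closure ({0<..<T} \<inter> \<rat>) \<subseteq> {0..T}"
    by (rule closure_minimal) auto
  have "p t - q t = 0"
  proof (rule continuous_constant_on_closure[where f = "\<lambda>t. p t - q t" and x = t])
    show "continuous_on (closure ({0<..<T} \<inter> \<rat>)) (\<lambda>t. p t - q t)"
      using sup by (intro continuous_on_subset[OF continuous_on_diff[OF assms(2,3)]])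
    show "p t - q t = 0" if "t \<in> {0<..<T} \<inter> \<rat>" for t using eq[of t] that by simp
    show "t \<in> closure ({0<..<T} \<inter> \<rat>)" using sub t by blast
  qed
  then show ?thesis by simp
qed

context brownian_family
begin

text \<open>The two integrals are limits along unrelated step sequences \<open>E\<close> and
  \<open>E'\<close>. After pairing \<open>E\<close> with \<open>v\<close>, the difference of the
  step integrals is again a step integral, and its integrand tends to zero because both sequences
  approximate \<open>\<langle>v, G J h\<rangle>\<close>.\<close>

lemma stochastic_integral_inner:
  fixes G :: "real \<Rightarrow> L2I \<Rightarrow>\<^sub>L L2I" and v :: L2I
  assumes v: "norm v = 1" and t: "t \<in> {0..T}"
    and G: "\<And>h. (\<lambda>s. blinfun_apply (G s) h) \<in> borel_measurable (T_meas T)"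
    and X: "stochastic_integral M B T (\<lambda>s. blinfun_apply (G s)) X"
    and N: "stochastic_integral M B T (\<lambda>s h. inner (adjoint (blinfun_apply (G s)) v) h) N"
  shows "AE \<omega> in M. N t \<omega> = inner (X t \<omega>) v"
proof -
  let ?W = "noise B" and ?A = "blinfun_inner_left v :: L2I \<Rightarrow>\<^sub>L real"
  have A: "blinfun_apply ?A x = inner x v" for x by simp
  obtain E where E: "\<And>k. step_integrand T (E k)"
    and E_val: "(\<lambda>k. \<integral>\<^sup>+ s. hs_norm_sq (\<lambda>h. blinfun_apply (G s) (J_op h) - step_value (E k) s (J_op h)) \<partial>T_meas T) \<longlonglongrightarrow> 0"
    and E_int: "(\<lambda>k. \<integral>\<^sup>+ \<omega>. ennreal ((norm (X t \<omega> - step_integral ?W (E k) t \<omega>))\<^sup>2) \<partial>M) \<longlonglongrightarrow> 0"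
    using X t unfolding stochastic_integral_def by blast
  obtain E' where E': "\<And>k. step_integrand T (E' k)"
    and E'_val: "(\<lambda>k. \<integral>\<^sup>+ s. hs_norm_sq (\<lambda>h. inner (adjoint (blinfun_apply (G s)) v) (J_op h) - step_value (E' k) s (J_op h)) \<partial>T_meas T) \<longlonglongrightarrow> 0"
    and E'_int: "(\<lambda>k. \<integral>\<^sup>+ \<omega>. ennreal ((norm (N t \<omega> - step_integral ?W (E' k) t \<omega>))\<^sup>2) \<partial>M) \<longlonglongrightarrow> 0"
    using N t unfolding stochastic_integral_def by blast
  let ?dN = "\<lambda>k. \<integral>\<^sup>+ \<omega>. ennreal ((norm (N t \<omega> - step_integral ?W (E' k) t \<omega>))\<^sup>2) \<partial>M"
  let ?dX = "\<lambda>k. \<integral>\<^sup>+ \<omega>. ennreal ((norm (X t \<omega> - step_integral ?W (E k) t \<omega>))\<^sup>2) \<partial>M"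
  let ?hg = "\<lambda>k s. hs_norm_sq (\<lambda>h. inner (adjoint (blinfun_apply (G s)) v) (J_op h) - step_value (E' k) s (J_op h))"
  let ?hG = "\<lambda>k s. hs_norm_sq (\<lambda>h. inner (blinfun_apply (G s) (J_op h) - step_value (E k) s (J_op h)) v)"
  let ?dg = "\<lambda>k. \<integral>\<^sup>+ s. ?hg k s \<partial>T_meas T"
  let ?dG = "\<lambda>k. \<integral>\<^sup>+ s. hs_norm_sq (\<lambda>h. blinfun_apply (G s) (J_op h) - step_value (E k) s (J_op h)) \<partial>T_meas T"
  have [measurable]: "N t \<in> borel_measurable M" using N t unfolding stochastic_integral_def by blast
  have "X t \<in> borel_measurable M" using X t unfolding stochastic_integral_def by blast
  moreover have "(\<lambda>x. inner x v) \<in> borel_measurable borel"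
    by (intro borel_measurable_continuous_onI continuous_intros)
  ultimately have [measurable]: "(\<lambda>\<omega>. inner (X t \<omega>) v) \<in> borel_measurable M"
    by (rule measurable_compose)
  have t0: "0 \<le> t" using t by simp
  \<comment> \<open>Concatenation adds step integrands, and composing with \<open>- ?A\<close>
    subtracts the tested \<open>E k\<close>.\<close>
  define P where "P k = E' k @ step_compose (- ?A) (E k)" for k
  have P: "step_integrand T (P k)" for k
    unfolding P_def by (intro step_integrand_append step_integrand_compose E E')
  have inner_le: "(inner x v)\<^sup>2 \<le> (norm x)\<^sup>2" for x
    using Cauchy_Schwarz_ineq2[of x v] v by (simp add: abs_le_square_iff[symmetric])
  have "(\<integral>\<^sup>+ \<omega>. ennreal ((N t \<omega> - inner (X t \<omega>) v)\<^sup>2) \<partial>M) \<le>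
     3 * ?dN k +
     3 * ?dX k +
     3 * (2 * ?dg k +
      2 * ?dG k)" for k
  proof -
    \<comment> \<open>Measurable versions: step integrals involve \<open>noise\<close>, an infinite
      sum of classes for which no measurability is established, whereas real series of
      \<open>step_term\<close> are measurable.\<close>
    define p where "p \<omega> = (\<Sum>n. step_term (E' k) t n \<omega>)" for \<omega>
    define q where "q \<omega> = (\<Sum>n. step_term (step_compose ?A (E k)) t n \<omega>)" for \<omega>
    have [measurable]: "p \<in> borel_measurable M" "q \<in> borel_measurable M"
      unfolding p_def[abs_def] q_def[abs_def]
      by (intro borel_measurable_suminf step_term_measurable[OF E' t0] step_term_measurable[OF step_integrand_compose[OF E] t0])+
    have p: "AE \<omega> in M. step_integral ?W (E' k) t \<omega> = p \<omega>"
      using step_integral_sums[OF E'[of k] t0] by eventually_elim (simp add: p_def sums_iff)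
    have q: "AE \<omega> in M. inner (step_integral ?W (E k) t \<omega>) v = q \<omega>"
      using step_integral_sums[OF step_integrand_compose[OF E[of k]] t0, of ?A]
      by eventually_elim (simp add: q_def sums_iff step_integral_compose)
    have 1: "(\<integral>\<^sup>+ \<omega>. ennreal ((N t \<omega> - p \<omega>)\<^sup>2) \<partial>M) = ?dN k"
      by (rule nn_integral_cong_AE) (use p in \<open>eventually_elim, simp\<close>)
    have 2: "(\<integral>\<^sup>+ \<omega>. ennreal ((q \<omega> - inner (X t \<omega>) v)\<^sup>2) \<partial>M) \<le> ?dX k"
    proof (rule nn_integral_mono_AE, use q in eventually_elim)
      case (elim \<omega>)
      then have "(q \<omega> - inner (X t \<omega>) v)\<^sup>2 = (inner (X t \<omega> - step_integral ?W (E k) t \<omega>) v)\<^sup>2"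
        by (simp add: inner_diff_left power2_commute)
      then show ?case using inner_le[of "X t \<omega> - step_integral ?W (E k) t \<omega>"] by (intro ennreal_leI) simp
    qed
    have 3: "(\<integral>\<^sup>+ \<omega>. ennreal ((p \<omega> - q \<omega>)\<^sup>2) \<partial>M) \<le>
      2 * ?dg k +
      2 * ?dG k"
    proof -
      have "(\<integral>\<^sup>+ \<omega>. ennreal ((p \<omega> - q \<omega>)\<^sup>2) \<partial>M) = (\<integral>\<^sup>+ \<omega>. ennreal ((step_integral ?W (P k) t \<omega>)\<^sup>2) \<partial>M)"
      proof (rule nn_integral_cong_AE, use p q in eventually_elim)
        case (elim \<omega>)
        then show ?case by (simp add: P_def step_integral_append step_integral_compose blinfun.minus_left)
      qed
      also have "\<dots> \<le> (\<integral>\<^sup>+ s. hs_norm_sq (\<lambda>h. step_value (P k) s (J_op h)) \<partial>T_meas T)"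
        by (rule ito_inequality[OF P t])
      also have "\<dots> \<le> (\<integral>\<^sup>+ s. 2 * ?hg k s
           + 2 * ?hG k s \<partial>T_meas T)"
      proof (rule nn_integral_mono)
        fix s
        let ?a = "\<lambda>n. inner (adjoint (blinfun_apply (G s)) v) (J_op (leg n)) - step_value (E' k) s (J_op (leg n))"
        let ?b = "\<lambda>n. inner (blinfun_apply (G s) (J_op (leg n)) - step_value (E k) s (J_op (leg n))) v"
        have "step_value (P k) s (J_op (leg n)) = ?b n - ?a n" for n
          by (simp add: P_def step_value_append step_value_compose blinfun.minus_left adjoint_blinfun_L2I inner_diff_left inner_commute[of v])
        moreover have "(b - a)\<^sup>2 \<le> 2 * a\<^sup>2 + 2 * b\<^sup>2" for a b :: real
          using zero_le_power2[of "a + b"] by (simp add: power2_eq_square algebra_simps)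
        ultimately have "ennreal ((step_value (P k) s (J_op (leg n)))\<^sup>2) \<le> 2 * ennreal ((?a n)\<^sup>2) + 2 * ennreal ((?b n)\<^sup>2)" for n
          using ennreal_leI[of "(?b n - ?a n)\<^sup>2" "2 * (?a n)\<^sup>2 + 2 * (?b n)\<^sup>2"]
          by (simp add: ennreal_mult)
        then have "(\<Sum>n. ennreal ((step_value (P k) s (J_op (leg n)))\<^sup>2)) \<le> (\<Sum>n. 2 * ennreal ((?a n)\<^sup>2) + 2 * ennreal ((?b n)\<^sup>2))"
          by (intro suminf_le) auto
        also have "\<dots> = 2 * (\<Sum>n. ennreal ((?a n)\<^sup>2)) + 2 * (\<Sum>n. ennreal ((?b n)\<^sup>2))"
          by (simp add: suminf_add[symmetric] ennreal_suminf_cmult)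
        finally show "hs_norm_sq (\<lambda>h. step_value (P k) s (J_op h)) \<le>
            2 * ?hg k s
           + 2 * ?hG k s"
          by (simp add: hs_norm_sq_def)
      qed
      also have "\<dots> = 2 * ?dg k
           + 2 * (\<integral>\<^sup>+ s. ?hG k s \<partial>T_meas T)"
      proof -
        \<comment> \<open>Splitting the integral requires measurable integrands; they come from the
          measurability of \<open>G\<close> on each fixed vector and the adjoint identity.\<close>
        have "(\<lambda>x. inner x v) \<in> borel_measurable borel"
          by (intro borel_measurable_continuous_onI continuous_intros)
        from measurable_compose[OF G this]
        have g: "(\<lambda>s. inner (blinfun_apply (G s) h) v) \<in> borel_measurable (T_meas T)" for h .
        have sE: "(\<lambda>s. inner (step_value (E k) s h) v) \<in> borel_measurable (T_meas T)" for h
          using step_value_measurable[of "step_compose ?A (E k)" h T] by (simp add: step_value_compose)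
        have "(\<lambda>s. ?hg k s) \<in> borel_measurable (T_meas T)"
          "(\<lambda>s. ?hG k s) \<in> borel_measurable (T_meas T)"
          unfolding hs_norm_sq_def adjoint_blinfun_L2I inner_diff_left inner_commute[of v] real_norm_def power2_abs
          by (intro borel_measurable_suminf_order measurable_compose[OF _ measurable_ennreal] borel_measurable_power
              borel_measurable_diff g sE step_value_measurable)+
        then show ?thesis by (simp add: nn_integral_add nn_integral_cmult)
      qed
      also have "\<dots> \<le> 2 * ?dg k
           + 2 * ?dG k"
        unfolding hs_norm_sq_def
        by (intro add_left_mono mult_left_mono nn_integral_mono suminf_le ennreal_leI) (auto simp: inner_le)
      finally show ?thesis .
    qed
    have "(\<integral>\<^sup>+ \<omega>. ennreal ((N t \<omega> - inner (X t \<omega>) v)\<^sup>2) \<partial>M) \<le>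
       (\<integral>\<^sup>+ \<omega>. 3 * ennreal ((N t \<omega> - p \<omega>)\<^sup>2) + 3 * ennreal ((q \<omega> - inner (X t \<omega>) v)\<^sup>2) + 3 * ennreal ((p \<omega> - q \<omega>)\<^sup>2) \<partial>M)"
    proof (rule nn_integral_mono)
      fix \<omega>
      have "(a + b + c)\<^sup>2 \<le> 3 * a\<^sup>2 + 3 * b\<^sup>2 + 3 * c\<^sup>2" for a b c :: real
        using zero_le_power2[of "a - b"] zero_le_power2[of "b - c"] zero_le_power2[of "a - c"]
        by (simp add: power2_eq_square algebra_simps)
      from this[of "N t \<omega> - p \<omega>" "q \<omega> - inner (X t \<omega>) v" "p \<omega> - q \<omega>"]
      have "(N t \<omega> - inner (X t \<omega>) v)\<^sup>2 \<le> 3 * (N t \<omega> - p \<omega>)\<^sup>2 + 3 * (q \<omega> - inner (X t \<omega>) v)\<^sup>2 + 3 * (p \<omega> - q \<omega>)\<^sup>2" by simp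
      from ennreal_leI[OF this]
      show "ennreal ((N t \<omega> - inner (X t \<omega>) v)\<^sup>2) \<le> 3 * ennreal ((N t \<omega> - p \<omega>)\<^sup>2) + 3 * ennreal ((q \<omega> - inner (X t \<omega>) v)\<^sup>2) + 3 * ennreal ((p \<omega> - q \<omega>)\<^sup>2)"
        by (simp add: ennreal_mult)
    qed
    also have "\<dots> = 3 * (\<integral>\<^sup>+ \<omega>. ennreal ((N t \<omega> - p \<omega>)\<^sup>2) \<partial>M) + 3 * (\<integral>\<^sup>+ \<omega>. ennreal ((q \<omega> - inner (X t \<omega>) v)\<^sup>2) \<partial>M) + 3 * (\<integral>\<^sup>+ \<omega>. ennreal ((p \<omega> - q \<omega>)\<^sup>2) \<partial>M)"
      by (simp add: nn_integral_add nn_integral_cmult)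
    also have "\<dots> \<le> 3 * ?dN k +
     3 * ?dX k +
     3 * (2 * ?dg k +
      2 * ?dG k)"
      unfolding 1 by (intro add_mono mult_left_mono 2 3) auto
    finally show ?thesis .
  qed
  moreover have "(\<lambda>k. 3 * ?dN k +
     3 * ?dX k +
     3 * (2 * ?dg k +
      2 * ?dG k))
    \<longlonglongrightarrow> 3 * 0 + 3 * 0 + 3 * (2 * 0 + 2 * 0)"
    by (intro tendsto_add ennreal_tendsto_cmult E'_int E_int E'_val E_val) auto
  ultimately have "(\<integral>\<^sup>+ \<omega>. ennreal ((N t \<omega> - inner (X t \<omega>) v)\<^sup>2) \<partial>M) \<le> 3 * 0 + 3 * 0 + 3 * (2 * 0 + 2 * 0)"
    by (intro LIMSEQ_le_const) auto
  then have "AE \<omega> in M. ennreal ((N t \<omega> - inner (X t \<omega>) v)\<^sup>2) = 0"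
    by (subst nn_integral_0_iff_AE[symmetric]) auto
  then show ?thesis by eventually_elim (simp add: ennreal_eq_0_iff)
qed

text \<open>Every single time has its own null set; rational times unite to one null set, and
  continuity of both paths covers the remaining times.\<close>

lemma stochastic_integral_inner_paths:
  fixes G :: "real \<Rightarrow> L2I \<Rightarrow>\<^sub>L L2I" and v :: L2I
  assumes T: "T > 0" and v: "norm v = 1"
    and G: "\<And>h. (\<lambda>s. blinfun_apply (G s) h) \<in> borel_measurable (T_meas T)"
    and X: "stochastic_integral M B T (\<lambda>s. blinfun_apply (G s)) X"
    and N: "stochastic_integral M B T (\<lambda>s h. inner (adjoint (blinfun_apply (G s)) v) h) N"
  shows "AE \<omega> in M. \<forall>t\<in>{0..T}. N t \<omega> = inner (X t \<omega>) v"
proof -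
  have "countable (\<rat> \<inter> {0..T})" using countable_rat by blast
  then have "AE \<omega> in M. \<forall>r\<in>\<rat> \<inter> {0..T}. N r \<omega> = inner (X r \<omega>) v"
    using stochastic_integral_inner[OF v _ G X N] by (subst AE_ball_countable) auto
  moreover have "AE \<omega> in M. continuous_on {0..T} (\<lambda>t. X t \<omega>)" "AE \<omega> in M. continuous_on {0..T} (\<lambda>t. N t \<omega>)"
    using X N by (auto simp: stochastic_integral_def)
  ultimately show ?thesis
  proof eventually_elim
    case (elim \<omega>)
    show ?case
    proof
      fix t assume "t \<in> {0..T}"
      then show "N t \<omega> = inner (X t \<omega>) v"
        using elim by - (rule continuous_eq_on_rationals[OF T, of "\<lambda>t. N t \<omega>" "\<lambda>t. inner (X t \<omega>) v"];
            auto intro!: continuous_intros)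
    qed
  qed
qed

end

section \<open>Almost sure uniform convergence of the solutions\<close>

theorem theorem6:
  fixes M :: "'w measure" and F :: "real \<Rightarrow> 'w measure"
    and B :: "nat \<Rightarrow> real \<Rightarrow> 'w \<Rightarrow> real"
    and G :: "real \<Rightarrow> L2I \<Rightarrow>\<^sub>L L2I" and GW :: "real \<Rightarrow> 'w \<Rightarrow> L2I"
    and T Q S0 S1 Cg :: real and S g \<beta> :: "real \<Rightarrow> real"
    and u0 :: L2I and f :: "real \<Rightarrow> L2I \<Rightarrow> real"
    and u :: "nat \<Rightarrow> real \<Rightarrow> 'w \<Rightarrow> L2I" and u_inf :: "real \<Rightarrow> L2I"
  assumes "T > 0" and "Q > 0"
    and "S \<in> borel_measurable I_meas" and "S0 > 0"
    and "AE x in I_meas. S0 \<le> S x \<and> S x \<le> S1"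
    and "continuous_on UNIV g" and "mono g"
    and "Cg > 0" and "\<And>r. g r * r \<ge> Cg * r\<^sup>2"
    and "mono \<beta>" and "bounded (range \<beta>)" and "\<exists>L. L-lipschitz_on UNIV \<beta>"
    and "filtered_probability M F" and "independent_brownian_motions M F B"
    and "\<And>t. t \<in> {0<..<T} \<Longrightarrow> hs_norm_sq (blinfun_apply (G t)) < \<infinity>"
    and "\<And>h. (\<lambda>t. blinfun_apply (G t) h) \<in> borel_measurable (lebesgue_on {0<..<T})"
    and "(\<integral>\<^sup>+ t. hs_norm_sq (\<lambda>h. blinfun_apply (G t) (J_op h)) \<partial>lebesgue_on {0<..<T}) < \<infinity>"
    and "stochastic_integral M B T (\<lambda>t. blinfun_apply (G t)) GW"
    and "AE \<omega> in M. (\<lambda>t. GW t \<omega>) \<in> energy_paths T"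
    and "f \<in> L2_V_dual T"
    and "\<And>w. w \<in> energy_paths T \<Longrightarrow>
           (AE t in lebesgue_on {0<..<T}. acts_on_V (reaction Q S \<beta> g (w t))) \<and>
           total_forcing Q S \<beta> g f w \<in> L2_V_dual T"
    and "\<And>n. n \<ge> 1 \<Longrightarrow> weak_solution M F B T Q S \<beta> g f u0 (1 / real n) G (u n)"
    and "\<And>n. n \<ge> 1 \<Longrightarrow> AE \<omega> in M. (\<lambda>t. u n t \<omega>) \<in> energy_paths T"
    and "weak_equation T Q S \<beta> g f u0 (\<lambda>v t. 0) u_inf" and "u_inf \<in> energy_paths T"
  shows "AE \<omega> in M. uniform_limit {0..T} (\<lambda>n t. u n t \<omega>) u_inf sequentially"
proof -
  interpret brownian_family M F B
  proof (intro brownian_family.intro brownian_family_axioms.intro)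
    show "prob_space M" using assms(13) by (simp add: filtered_probability_def)
  qed (fact assms)+
  obtain L where L: "L-lipschitz_on UNIV \<beta>" using assms(12) by blast
  \<comment> \<open>\<open>\<bar>S1\<bar>\<close> makes nonnegativity immediate, and it dominates
    \<open>\<bar>S\<bar>\<close> because \<open>S\<close> is positive almost everywhere.\<close>
  interpret reaction_diffusion T Q "\<bar>S1\<bar>" L S g \<beta> u0 f
  proof
    show "AE x in I_meas. \<bar>S x\<bar> \<le> \<bar>S1\<bar>" using assms(5) by eventually_elim (use assms(4) in auto)
    show "\<bar>\<beta> x - \<beta> y\<bar> \<le> L * \<bar>x - y\<bar>" for x y using lipschitz_onD[OF L, of x y] by (simp add: dist_real_def)
    show "0 \<le> L" using L by (rule lipschitz_on_nonneg)
    show "AE t in T_meas T. acts_on_V (reaction Q S \<beta> g (w t))" "total_forcing Q S \<beta> g f w \<in> L2_V_dual T"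
      if "w \<in> energy_paths T" for w
      using assms(21)[OF that] by auto
  qed (simp_all add: assms(1,2,7))
  have "\<exists>N. AE \<omega> in M. weak_equation T Q S \<beta> g f u0 (\<lambda>v t. 1 / real n * N v t \<omega>) (\<lambda>t. u n t \<omega>) \<and>
     (\<forall>k. \<forall>t\<in>{0..T}. N (leg k) t \<omega> = inner (GW t \<omega>) (leg k))" if n: "n \<ge> 1" for n
  proof -
    obtain N where N: "\<And>v. v \<in> V \<Longrightarrow> stochastic_integral M B T (\<lambda>s h. inner (adjoint (blinfun_apply (G s)) v) h) (N v)"
      and eq: "AE \<omega> in M. weak_equation T Q S \<beta> g f u0 (\<lambda>v t. 1 / real n * N v t \<omega>) (\<lambda>t. u n t \<omega>)"
      using assms(22)[OF n] unfolding weak_solution_def by blast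
    \<comment> \<open>The exceptional set of \<open>N v\<close> depends on \<open>v\<close>;
      restricting \<open>v\<close> to the basis leaves a countable union.\<close>
    have "AE \<omega> in M. \<forall>k. \<forall>t\<in>{0..T}. N (leg k) t \<omega> = inner (GW t \<omega>) (leg k)"
      unfolding AE_all_countable
      using stochastic_integral_inner_paths[OF assms(1) norm_leg assms(16,18) N[OF leg_V]] by blast
    with eq have "AE \<omega> in M. weak_equation T Q S \<beta> g f u0 (\<lambda>v t. 1 / real n * N v t \<omega>) (\<lambda>t. u n t \<omega>) \<and>
     (\<forall>k. \<forall>t\<in>{0..T}. N (leg k) t \<omega> = inner (GW t \<omega>) (leg k))" by eventually_elim blast
    then show ?thesis by blast
  qed
  then have "\<forall>n\<in>{1..}. \<exists>N. (AE \<omega> in M. weak_equation T Q S \<beta> g f u0 (\<lambda>v t. 1 / real n * N v t \<omega>) (\<lambda>t. u n t \<omega>) \<and>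
     (\<forall>k. \<forall>t\<in>{0..T}. N (leg k) t \<omega> = inner (GW t \<omega>) (leg k)))"
    by simp
  \<comment> \<open>One \<open>N n\<close> per \<open>n\<close> is fixed outside the
    almost-everywhere quantifier, so that the countable intersection over \<open>n\<close> can be
    formed.\<close>
  from bchoice[OF this] obtain N where "\<forall>n\<in>{1..}. (AE \<omega> in M. weak_equation T Q S \<beta> g f u0 (\<lambda>v t. 1 / real n * N n v t \<omega>) (\<lambda>t. u n t \<omega>) \<and>
     (\<forall>k. \<forall>t\<in>{0..T}. N n (leg k) t \<omega> = inner (GW t \<omega>) (leg k)))"
    by (elim exE)
  then have "AE \<omega> in M. \<forall>n\<in>{1..}. weak_equation T Q S \<beta> g f u0 (\<lambda>v t. 1 / real n * N n v t \<omega>) (\<lambda>t. u n t \<omega>) \<and>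
     (\<forall>k. \<forall>t\<in>{0..T}. N n (leg k) t \<omega> = inner (GW t \<omega>) (leg k))"
    by (subst AE_ball_countable) auto
  moreover have "AE \<omega> in M. \<forall>n\<in>{1..}. (\<lambda>t. u n t \<omega>) \<in> energy_paths T"
    using assms(23) by (subst AE_ball_countable) auto
  ultimately show ?thesis using assms(19)
  proof eventually_elim
    case (elim \<omega>)
    let ?X = "\<lambda>t. GW t \<omega>"
    obtain A where "\<forall>\<delta> v N. 0 \<le> \<delta> \<longrightarrow> \<delta> \<le> 1 \<longrightarrow> v \<in> energy_paths T \<longrightarrow>
     weak_equation T Q S \<beta> g f u0 (\<lambda>w t. \<delta> * N w t) v \<longrightarrow>
     (\<forall>k. \<forall>t\<in>{0..T}. N (leg k) t = inner (?X t) (leg k)) \<longrightarrow>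
     (\<forall>t\<in>{0..T}. (norm (v t - u_inf t - \<delta> *\<^sub>R ?X t))\<^sup>2 \<le> \<delta> * A)"
      using pathwise_estimate[OF elim(3) assms(25,24)] by blast
    note A = this[rule_format]
    have est: "(norm (u n t \<omega> - u_inf t - (1 / real n) *\<^sub>R ?X t))\<^sup>2 \<le> 1 / real n * A"
      if n: "n \<ge> 1" and t: "t \<in> {0..T}" for n t
      using elim(1,2) n by (intro A[where v = "\<lambda>t. u n t \<omega>" and N = "\<lambda>v t. N n v t \<omega>"] t) auto
    have "continuous_on {0..T} (\<lambda>t. norm (?X t))"
      using elim(3) by (auto simp: energy_paths_iff intro!: continuous_intros)
    then obtain C where C: "\<And>t. t \<in> {0..T} \<Longrightarrow> \<bar>norm (?X t)\<bar> \<le> C" using continuous_bounded_T by blast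
    \<comment> \<open>The estimate gives \<open>sqrt (A / n)\<close>, and adding back
      \<open>(1 / n) X\<close> costs \<open>C / n\<close>. Both are uniform on
      \<open>{0..T}\<close>, since \<open>C\<close> bounds the continuous path of
      \<open>GW\<close>.\<close>
    have lim: "(\<lambda>n. sqrt (1 / real n * A) + 1 / real n * C) \<longlonglongrightarrow> sqrt (0 * A) + 0 * C"
      by (intro tendsto_intros lim_1_over_n)
    show ?case
    proof (rule uniform_limitI)
      fix e :: real assume "e > 0"
      then have "\<forall>\<^sub>F n in sequentially. sqrt (1 / real n * A) + 1 / real n * C < e"
        using lim by (intro order_tendstoD(2)) auto
      then show "\<forall>\<^sub>F n in sequentially. \<forall>t\<in>{0..T}. dist (u n t \<omega>) (u_inf t) < e"
        using eventually_ge_at_top[of 1]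
      proof eventually_elim
        case (elim n)
        show ?case
        proof
          fix t assume t: "t \<in> {0..T}"
          have "norm (u n t \<omega> - u_inf t) \<le> norm (u n t \<omega> - u_inf t - (1 / real n) *\<^sub>R ?X t) + norm ((1 / real n) *\<^sub>R ?X t)"
            using norm_triangle_ineq[of "u n t \<omega> - u_inf t - (1 / real n) *\<^sub>R ?X t" "(1 / real n) *\<^sub>R ?X t"] by simp
          also have "\<dots> \<le> sqrt (1 / real n * A) + 1 / real n * C"
            using C[OF t] real_le_rsqrt[OF est[OF elim(2) t]] by (intro add_mono) (auto simp: divide_right_mono)
          finally show "dist (u n t \<omega>) (u_inf t) < e" using elim(1) by (simp add: dist_norm)
        qed
      qed
    qed
  qed
qed

end
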